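(* Let $0<r<q<\infty$ and $A>0$. Then there is a constant $C>0$, depending only on $d,q,r,A$, such that the following holds. For every sequence $\{f_k\}_{k\in\mathbb{Z}}$ with $f_k\in\mathcal{E}(A2^k)$ for all $k\in\mathbb{Z}$, every $\mu\in\mathbb{Z}$ and every $P\in\mathcal{D}_\mu$, $$\Big(\frac{1}{|P|}\int_P\sum_{k=\mu}^{\infty}\big(\mathfrak{M}_{d/r,2^k}f_k(x)\big)^q\,dx\Big)^{1/q}\le C\sup_{R\in\mathcal{D}_\mu}\Big(\frac{1}{|R|}\int_R\sum_{k=\mu}^{\infty}|f_k(x)|^q\,dx\Big)^{1/q}.$$ In particular $C$ is independent of $\mu$ and $P$.
   Context: Everything is on $\mathbb{R}^d$, and the Fourier transform is $\widehat{f}(\xi)=\int_{\mathbb{R}^d}f(x)e^{-2\pi i\langle x,\xi\rangle}dx$. For $\rho>0$, $\mathcal{E}(\rho)$ is the space of tempered distributions on $\mathbb{R}^d$ whose Fourier transforms are supported in $\{\xi:|\xi|\le 2\rho\}$ (such distributions are identified with smooth functions). $\mathcal{D}_\mu$ is the set of dyadic cubes in $\mathbb{R}^d$ of side length $2^{-\mu}$. For $k\in\mathbb{Z}$ and $\sigma>0$ the Peetre maximal operator is $$\mathfrak{M}_{\sigma,2^k}f(x):=\sup_{y\in\mathbb{R}^d}\frac{|f(x-y)|}{(1+2^k|y|)^\sigma}.$$ *)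

theory Defs
  imports "HOL-Analysis.Analysis"
begin

section \<open>Smooth functions and test functions\<close>

definition partial_deriv :: "'n::finite \<Rightarrow> (real^'n \<Rightarrow> complex) \<Rightarrow> real^'n \<Rightarrow> complex" where
  "partial_deriv i f x = frechet_derivative f (at x) (axis i 1)"

text \<open>A multi-index is given as the list of the coordinates to differentiate in.\<close>

definition iter_partial :: "'n::finite list \<Rightarrow> (real^'n \<Rightarrow> complex) \<Rightarrow> real^'n \<Rightarrow> complex" where
  "iter_partial is f = foldr partial_deriv is f"

definition smooth :: "(real^'n::finite \<Rightarrow> complex) \<Rightarrow> bool" where
  "smooth f \<longleftrightarrow> (\<forall>is x. iter_partial is f differentiable (at x))"

definition fun_support :: "(real^'n::finite \<Rightarrow> complex) \<Rightarrow> (real^'n) set" where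
  "fun_support f = closure {x. f x \<noteq> 0}"

definition test_functions :: "(real^'n::finite \<Rightarrow> complex) set" where
  "test_functions = {\<phi>. smooth \<phi> \<and> compact (fun_support \<phi>)}"

definition schwartz_space :: "(real^'n::finite \<Rightarrow> complex) set" where
  "schwartz_space =
     {\<phi>. smooth \<phi> \<and>
          (\<forall>N is. bounded (range (\<lambda>x. (1 + norm x) ^ N *\<^sub>R iter_partial is \<phi> x)))}"

definition schwartz_seminorm :: "nat \<Rightarrow> (real^'n::finite \<Rightarrow> complex) \<Rightarrow> real" where
  "schwartz_seminorm N \<phi> =
     (\<Sum>is \<in> {is. length is \<le> N}. SUP x. (1 + norm x) ^ N * norm (iter_partial is \<phi> x))"

section \<open>Tempered distributions and their Fourier transforms\<close>

definition fourier :: "(real^'n::finite \<Rightarrow> complex) \<Rightarrow> real^'n \<Rightarrow> complex" where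
  "fourier f \<xi> =
     (LINT x|lborel. f x * exp (- 2 * complex_of_real pi * \<i> * complex_of_real (x \<bullet> \<xi>)))"

text \<open>Tempered distributions are total functionals in the type, but only their values on
  the Schwartz space are meaningful.  Since the seminorms are increasing and generate the
  Schwartz topology, continuity of a linear functional is a bound by a single seminorm.\<close>

definition tempered_distribution :: "((real^'n::finite \<Rightarrow> complex) \<Rightarrow> complex) \<Rightarrow> bool" where
  "tempered_distribution T \<longleftrightarrow>
     (\<forall>\<phi>\<in>schwartz_space. \<forall>\<psi>\<in>schwartz_space. T (\<lambda>x. \<phi> x + \<psi> x) = T \<phi> + T \<psi>) \<and>
     (\<forall>c. \<forall>\<phi>\<in>schwartz_space. T (\<lambda>x. c * \<phi> x) = c * T \<phi>) \<and>
     (\<exists>B N. \<forall>\<phi>\<in>schwartz_space. norm (T \<phi>) \<le> B * schwartz_seminorm N \<phi>)"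

definition dist_fourier ::
  "((real^'n::finite \<Rightarrow> complex) \<Rightarrow> complex) \<Rightarrow> (real^'n \<Rightarrow> complex) \<Rightarrow> complex" where
  "dist_fourier T = (\<lambda>\<phi>. T (fourier \<phi>))"

definition supported_in ::
  "((real^'n::finite \<Rightarrow> complex) \<Rightarrow> complex) \<Rightarrow> (real^'n) set \<Rightarrow> bool" where
  "supported_in T K \<longleftrightarrow> (\<forall>\<phi>\<in>test_functions. fun_support \<phi> \<inter> K = {} \<longrightarrow> T \<phi> = 0)"

definition represented_by ::
  "((real^'n::finite \<Rightarrow> complex) \<Rightarrow> complex) \<Rightarrow> (real^'n \<Rightarrow> complex) \<Rightarrow> bool" where
  "represented_by T f \<longleftrightarrow>
     (\<forall>\<phi>\<in>schwartz_space. integrable lborel (\<lambda>x. f x * \<phi> x) \<and> T \<phi> = (LINT x|lborel. f x * \<phi> x))"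

text \<open>The elements of the space are the smooth functions with which the band-limited tempered
  distributions are identified.\<close>

definition band_limited :: "real \<Rightarrow> (real^'n::finite \<Rightarrow> complex) set" where
  "band_limited \<rho> =
     {f. smooth f \<and>
         (\<exists>T. tempered_distribution T \<and> represented_by T f \<and>
              supported_in (dist_fourier T) {\<xi>. norm \<xi> \<le> 2 * \<rho>})}"

section \<open>Dyadic cubes and the Peetre maximal operator\<close>

text \<open>Cubes are half-open, so that those of a given side length partition the space.\<close>

definition dyadic_cube :: "int \<Rightarrow> ('n::finite \<Rightarrow> int) \<Rightarrow> (real^'n) set" where
  "dyadic_cube \<mu> m =
     {x. \<forall>i. of_int (m i) * 2 powi (- \<mu>) \<le> x $ i \<and> x $ i < (of_int (m i) + 1) * 2 powi (- \<mu>)}"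

definition dyadic_cubes :: "int \<Rightarrow> (real^'n::finite) set set" where
  "dyadic_cubes \<mu> = range (dyadic_cube \<mu>)"

definition peetre_maximal :: "real \<Rightarrow> int \<Rightarrow> (real^'n::finite \<Rightarrow> complex) \<Rightarrow> real^'n \<Rightarrow> ennreal" where
  "peetre_maximal \<sigma> k f x =
     (SUP y. ennreal (norm (f (x - y)) / (1 + 2 powi k * norm y) powr \<sigma>))"

text \<open>Real powers on the extended half-line; meant for positive exponents only.\<close>

definition ennpowr :: "ennreal \<Rightarrow> real \<Rightarrow> ennreal" where
  "ennpowr a p = (if a = \<infinity> then \<infinity> else ennreal (enn2real a powr p))"

definition cube_mean :: "(real^'n::finite) set \<Rightarrow> (real^'n \<Rightarrow> ennreal) \<Rightarrow> ennreal" where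
  "cube_mean P g = (\<integral>\<^sup>+x\<in>P. g x \<partial>lborel) / emeasure lborel P"

end

theory Submission
  imports Defs "HOL-Probability.Characteristic_Functions"
begin

text \<open>A function of spectrum in the ball of radius \<open>2 A s\<close> is reproduced by convolution with the
  \<open>s\<close>-dilate of a fixed Schwartz function \<open>H\<close>, the Fourier transform of a test function that equals a constant
  near that ball: the pairings of the distribution with all finer dilates of \<open>H\<close> coincide, and they
  converge to a multiple of the value of the function.  From the decay of \<open>H\<close> one gets
  \<open>(M f x)\<^sup>q \<le> C \<integral> s\<^sup>d |f w|\<^sup>q (1 + s|x - w|) powr (- d q / r) dw\<close> for \<open>s = 2\<^sup>k\<close>; for \<open>q < 1\<close> a factor
  \<open>|f|\<^sup>1\<^sup>-\<^sup>q\<close> is absorbed into the maximal function, which requires its finiteness first.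
  Since \<open>d q / r > d\<close>, the kernel is integrable, and averaging it over a cube of
  side \<open>2 powi (- \<mu>)\<close>, \<open>\<mu> \<le> k\<close>, gives a weight that is essentially constant on the cubes of that side and whose
  total mass is bounded independently of \<open>k\<close> and \<open>\<mu>\<close>.\<close>

section \<open>Smooth functions\<close>

text \<open>Two obstacles shape the argument. A function of \<open>band_limited\<close> is known
  only to be smooth and integrable against Schwartz functions, so limits in its pairings with
  shrinking kernels cannot rest on growth bounds; away from the centre they rest on the continuity
  of the distribution, and polynomial growth is then a consequence. Secondly, all constants must be
  uniform in k: \<open>H\<close> depends on \<open>A\<close> and the dimension only, and the scale
  enters by dilation alone. The estimate for a single function is linear in \<open>|f|^q\<close>, so
  the sum over k, the average over P and the convolution can be exchanged by Tonelli. The condition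
  k \<ge> \<mu> is used for the tail: averaged over a cube of side 2^(-\<mu>), the kernel of scale
  2^(-k) has a tail smaller than that of scale 2^(-\<mu>) by 2^((k - \<mu>)(d - d q / r)) \<le> 1.
  All k thus share one majorant, and the sum over k is taken inside a single integral.\<close>

lemma partial_deriv_eqI:
  "(f has_derivative D) (at x) \<Longrightarrow> partial_deriv i f x = D (axis i 1)"
  unfolding partial_deriv_def by (metis frechet_derivative_at)

lemma iter_partial_Nil [simp]: "iter_partial [] f = f"
  by (simp add: iter_partial_def)

lemma iter_partial_Cons [simp]: "iter_partial (i # is) f = partial_deriv i (iter_partial is f)"
  by (simp add: iter_partial_def)

lemma iter_partial_snoc: "iter_partial (is @ [i]) f = iter_partial is (partial_deriv i f)"
  by (simp add: iter_partial_def)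

lemma smooth_imp_differentiable: "smooth f \<Longrightarrow> f differentiable (at x)"
  unfolding smooth_def by (metis iter_partial_Nil)

lemma smooth_partial_deriv: "smooth f \<Longrightarrow> smooth (partial_deriv i f)"
  unfolding smooth_def by (metis iter_partial_snoc)

lemma smooth_iter_partial: "smooth f \<Longrightarrow> smooth (iter_partial is f)"
  by (induction "is") (auto intro: smooth_partial_deriv)

lemma smooth_imp_continuous_on: "smooth f \<Longrightarrow> continuous_on S f"
  by (meson continuous_at_imp_continuous_on differentiable_imp_continuous_within smooth_imp_differentiable)

lemma partial_deriv_const: "partial_deriv i (\<lambda>x. c) = (\<lambda>x. 0)"
  by (rule ext, rule partial_deriv_eqI) (auto intro!: derivative_eq_intros)

lemma partial_deriv_add:
  assumes "f differentiable (at x)" "g differentiable (at x)"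
  shows "partial_deriv i (\<lambda>x. f x + g x) x = partial_deriv i f x + partial_deriv i g x"
proof -
  have "((\<lambda>x. f x + g x) has_derivative
     (\<lambda>h. frechet_derivative f (at x) h + frechet_derivative g (at x) h)) (at x)"
    using assms by (intro has_derivative_add) (auto simp: frechet_derivative_works[symmetric])
  from partial_deriv_eqI[OF this] show ?thesis
    by (simp add: partial_deriv_def)
qed

lemma partial_deriv_mult:
  assumes "f differentiable (at x)" "g differentiable (at x)"
  shows "partial_deriv i (\<lambda>x. f x * g x) x = partial_deriv i f x * g x + f x * partial_deriv i g x"
proof -
  have "((\<lambda>x. f x * g x) has_derivative
     (\<lambda>h. f x * frechet_derivative g (at x) h + frechet_derivative f (at x) h * g x)) (at x)"
    using assms by (intro has_derivative_mult) (auto simp: frechet_derivative_works[symmetric])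
  from partial_deriv_eqI[OF this] show ?thesis
    by (simp add: partial_deriv_def)
qed

section \<open>Closure of smooth functions under algebraic operations\<close>

lemma has_derivative_inverse_complex:
  fixes f :: "real^'n::finite \<Rightarrow> complex"
  assumes "f differentiable (at x)" "f x \<noteq> 0"
  shows "((\<lambda>x. inverse (f x)) has_derivative
     (\<lambda>h. - (inverse (f x) * frechet_derivative f (at x) h * inverse (f x)))) (at x)"
  using Deriv.has_derivative_inverse[of f x "frechet_derivative f (at x)" UNIV] assms
  by (simp add: frechet_derivative_works)

text \<open>The algebra generated by \<open>B\<close>, with reciprocals of its nowhere vanishing
  members. As \<open>smooth\<close> speaks of all iterated partial derivatives, closure under
  products and quotients is obtained by induction over expressions instead of multi-indices.\<close>

inductive_set falgebra :: "(real^'n::finite \<Rightarrow> complex) set \<Rightarrow> (real^'n \<Rightarrow> complex) set"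
  for B where
  gen: "g \<in> B \<Longrightarrow> g \<in> falgebra B"
| const: "(\<lambda>x. c) \<in> falgebra B"
| add: "f \<in> falgebra B \<Longrightarrow> g \<in> falgebra B \<Longrightarrow> (\<lambda>x. f x + g x) \<in> falgebra B"
| mult: "f \<in> falgebra B \<Longrightarrow> g \<in> falgebra B \<Longrightarrow> (\<lambda>x. f x * g x) \<in> falgebra B"
| inverse: "f \<in> falgebra B \<Longrightarrow> (\<And>x. f x \<noteq> 0) \<Longrightarrow> (\<lambda>x. inverse (f x)) \<in> falgebra B"

text \<open>The Leibniz and quotient rules keep the algebra stable under
  \<open>partial_deriv\<close> as soon as the derivatives of the generators stay inside it, so every
  iterated derivative is again a differentiable member. Only first-order information on the
  generators has to be supplied: a single exponential, a single coordinate and the family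
  \<open>flat_exp\<close> are treated in this way.\<close>

lemma falgebra_smooth:
  fixes B :: "(real^'n::finite \<Rightarrow> complex) set"
  assumes diff: "\<And>g x. g \<in> B \<Longrightarrow> g differentiable (at x)"
    and deriv: "\<And>g i. g \<in> B \<Longrightarrow> partial_deriv i g \<in> falgebra B"
    and f: "f \<in> falgebra B"
  shows "smooth f"
proof -
  have d: "g differentiable (at x)" if "g \<in> falgebra B" for g x
    using that
  proof (induction)
    case (inverse f)
    show ?case
      using has_derivative_inverse_complex[OF inverse(3) inverse(2)] by (auto simp: differentiable_def)
  qed (auto intro: diff)
  have pd: "partial_deriv i g \<in> falgebra B" if "g \<in> falgebra B" for g i
    using that
  proof (induction)
    case (gen g)
    then show ?case by (rule deriv)
  next
    case (const c)
    then show ?case by (simp add: partial_deriv_const falgebra.const)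
  next
    case (add f g)
    have "partial_deriv i (\<lambda>x. f x + g x) = (\<lambda>x. partial_deriv i f x + partial_deriv i g x)"
      using add d by (intro ext partial_deriv_add) auto
    then show ?case using add by (auto intro: falgebra.add)
  next
    case (mult f g)
    have "partial_deriv i (\<lambda>x. f x * g x) = (\<lambda>x. partial_deriv i f x * g x + f x * partial_deriv i g x)"
      using mult d by (intro ext partial_deriv_mult) auto
    then show ?case using mult by (auto intro!: falgebra.add falgebra.mult)
  next
    case (inverse f)
    have "partial_deriv i (\<lambda>x. inverse (f x)) = (\<lambda>x. - 1 * (inverse (f x) * partial_deriv i f x * inverse (f x)))"
      using partial_deriv_eqI[OF has_derivative_inverse_complex[OF d[OF inverse(1)] inverse(2)]]
      by (intro ext) (simp add: partial_deriv_def)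
    then show ?case using inverse
      by (simp only:) (intro falgebra.mult falgebra.const falgebra.inverse)
  qed
  have "iter_partial is f \<in> falgebra B" for "is"
    by (induction "is") (auto simp: f pd)
  then show ?thesis unfolding smooth_def by (simp add: d)
qed

lemma falgebra_smooth': "f \<in> falgebra (Collect smooth) \<Longrightarrow> smooth f"
  by (erule falgebra_smooth[rotated 2])
    (auto simp: smooth_imp_differentiable intro: falgebra.gen smooth_partial_deriv)

lemma smooth_const: "smooth (\<lambda>x. c)"
  by (intro falgebra_smooth' falgebra.const)

lemma smooth_add: "smooth f \<Longrightarrow> smooth g \<Longrightarrow> smooth (\<lambda>x. f x + g x)"
  by (intro falgebra_smooth') (auto intro: falgebra.intros)

lemma smooth_mult: "smooth f \<Longrightarrow> smooth g \<Longrightarrow> smooth (\<lambda>x. f x * g x)"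
  by (intro falgebra_smooth') (auto intro: falgebra.intros)

lemma smooth_inverse: "smooth f \<Longrightarrow> (\<And>x. f x \<noteq> 0) \<Longrightarrow> smooth (\<lambda>x. inverse (f x))"
  by (intro falgebra_smooth') (auto intro: falgebra.intros)

lemma smooth_diff: "smooth f \<Longrightarrow> smooth g \<Longrightarrow> smooth (\<lambda>x. f x - g x)"
  using smooth_add[OF _ smooth_mult[OF smooth_const[of "-1"]], of f g] by simp

lemma smooth_prod: "(\<And>i. i \<in> I \<Longrightarrow> smooth (f i)) \<Longrightarrow> smooth (\<lambda>x. \<Prod>i\<in>I. f i x)"
  by (induction I rule: infinite_finite_induct) (auto intro: smooth_const smooth_mult)

lemma smooth_exp_inner: "smooth (\<lambda>x::real^'n::finite. exp (c * of_real (x \<bullet> v)))"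
proof -
  let ?g = "\<lambda>x::real^'n. exp (c * of_real (x \<bullet> v))"
  have D: "(?g has_derivative (\<lambda>h. c * of_real (h \<bullet> v) * ?g x)) (at x)" for x
    by (rule has_derivative_eq_rhs[OF has_derivative_compose[OF _ DERIV_exp[unfolded has_field_derivative_def]]])
      (auto intro!: derivative_eq_intros)
  have "partial_deriv i ?g = (\<lambda>x. c * of_real (axis i 1 \<bullet> v) * ?g x)" for i
    using partial_deriv_eqI[OF D] by (intro ext) simp
  then have "partial_deriv i ?g \<in> falgebra {?g}" for i
    using falgebra.mult[OF falgebra.const falgebra.gen[OF singletonI]] by metis
  then show ?thesis
    using D by (intro falgebra_smooth[where B="{?g}"])
       (auto intro: falgebra.gen simp: differentiable_def)
qed

lemma smooth_component: "smooth (\<lambda>x::real^'n::finite. complex_of_real (x $ i))"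
proof -
  let ?g = "\<lambda>x::real^'n. complex_of_real (x $ i)"
  have D: "(?g has_derivative (\<lambda>h. of_real (h $ i))) (at x)" for x
    by (intro has_derivative_of_real bounded_linear_imp_has_derivative bounded_linear_vec_nth)
  have "partial_deriv j ?g = (\<lambda>x. of_real (axis j 1 $ i))" for j
    using partial_deriv_eqI[OF D] by (intro ext) simp
  then show ?thesis
    using D by (intro falgebra_smooth[where B="{?g}"])
       (auto intro!: falgebra.intros simp: differentiable_def)
qed

section \<open>Affine substitutions, locality and the Leibniz bound\<close>

lemma has_derivative_affine:
  fixes g :: "real^'n::finite \<Rightarrow> complex"
  assumes "\<And>y. g differentiable (at y)"
  shows "((\<lambda>x. c * g (a *\<^sub>R x + b)) has_derivative
    (\<lambda>h. c * frechet_derivative g (at (a *\<^sub>R x + b)) (a *\<^sub>R h))) (at x)"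
proof -
  have "(g has_derivative frechet_derivative g (at (a *\<^sub>R x + b))) (at (a *\<^sub>R x + b))"
    using assms frechet_derivative_works by blast
  then have "((\<lambda>x. g (a *\<^sub>R x + b)) has_derivative (\<lambda>h. frechet_derivative g (at (a *\<^sub>R x + b)) (a *\<^sub>R h))) (at x)"
    by (rule has_derivative_compose[rotated]) (auto intro!: derivative_eq_intros)
  then show ?thesis
    by (rule has_derivative_mult_right)
qed

lemma partial_deriv_affine:
  fixes g :: "real^'n::finite \<Rightarrow> complex"
  assumes "\<And>y. g differentiable (at y)"
  shows "partial_deriv i (\<lambda>x. c * g (a *\<^sub>R x + b)) x = of_real a * c * partial_deriv i g (a *\<^sub>R x + b)"
  using partial_deriv_eqI[OF has_derivative_affine[OF assms], of i c a b x]
  by (simp add: partial_deriv_def linear_cmul[OF linear_frechet_derivative[OF assms]])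
    (simp add: scaleR_conv_of_real)

lemma iter_partial_affine:
  assumes "smooth f"
  shows "iter_partial is (\<lambda>x. f (a *\<^sub>R x + b)) =
     (\<lambda>x. of_real a ^ length is * iter_partial is f (a *\<^sub>R x + b))"
proof (induction "is")
  case (Cons i "is")
  show ?case
    unfolding iter_partial_Cons Cons
    by (intro ext) (simp add: partial_deriv_affine smooth_imp_differentiable smooth_iter_partial assms)
qed simp

lemma smooth_affine:
  assumes "smooth f"
  shows "smooth (\<lambda>x. f (a *\<^sub>R x + b))"
  unfolding smooth_def iter_partial_affine[OF assms]
proof (intro allI)
  fix "is" x
  show "(\<lambda>x. of_real a ^ length is * iter_partial is f (a *\<^sub>R x + b)) differentiable (at x)"
    unfolding differentiable_def
    by (rule exI, rule has_derivative_affine)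
      (rule smooth_imp_differentiable[OF smooth_iter_partial[OF assms]])
qed

lemma iter_partial_eq_zero_on_open:
  assumes "open U" "\<And>x. x \<in> U \<Longrightarrow> f x = 0" "x \<in> U"
  shows "iter_partial is f x = 0"
  using assms(3)
proof (induction "is" arbitrary: x)
  case Nil
  then show ?case by (simp add: assms)
next
  case (Cons i "is")
  have "(iter_partial is f has_derivative (\<lambda>h. 0)) (at x)"
    by (rule has_derivative_transform_within_open[where f="\<lambda>x. 0", OF _ assms(1) Cons.prems])
      (auto simp: Cons.IH)
  from partial_deriv_eqI[OF this] show ?case by simp
qed

lemma iter_partial_add:
  assumes "smooth f" "smooth g"
  shows "iter_partial is (\<lambda>x. f x + g x) = (\<lambda>x. iter_partial is f x + iter_partial is g x)"
proof (induction "is")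
  case (Cons i "is")
  show ?case unfolding iter_partial_Cons Cons
    by (intro ext partial_deriv_add smooth_imp_differentiable smooth_iter_partial assms)
qed simp

text \<open>Leibniz in a crude form: each differentiation turns a product into two, whence at most
  \<open>2 ^ n\<close> terms, all bounded by \<open>a * b\<close>.\<close>

lemma iter_partial_mult_bound:
  assumes "smooth f" "smooth g" "length is \<le> n"
    and "\<And>js. length js \<le> n \<Longrightarrow> norm (iter_partial js f x) \<le> a"
    and "\<And>js. length js \<le> n \<Longrightarrow> norm (iter_partial js g x) \<le> b"
  shows "norm (iter_partial is (\<lambda>x. f x * g x) x) \<le> 2 ^ n * a * b"
  using assms
proof (induction n arbitrary: "is" f g)
  case 0
  have f: "norm (f x) \<le> a" and g: "norm (g x) \<le> b"
    using "0.prems"(4,5)[of "[]"] by auto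
  have "norm (f x * g x) \<le> a * b"
    unfolding norm_mult using f g order_trans[OF norm_ge_zero f] by (intro mult_mono) auto
  then show ?case using "0.prems"(3) by simp
next
  case (Suc n)
  have f: "norm (f x) \<le> a" and g: "norm (g x) \<le> b"
    using Suc.prems(4,5)[of "[]"] by auto
  have ab: "0 \<le> a" "0 \<le> b"
    using order_trans[OF norm_ge_zero f] order_trans[OF norm_ge_zero g] .
  show ?case
  proof (cases "is" rule: rev_cases)
    case Nil
    have "norm (f x * g x) \<le> a * b" 
      unfolding norm_mult using f g ab by (intro mult_mono) auto
    also have "\<dots> \<le> 2 ^ Suc n * (a * b)"
      using ab mult_right_mono[of 1 "2 ^ Suc n" "a * b"] one_le_power[of "2::real" "Suc n"]
      by (simp del: power_Suc)
    finally show ?thesis using Nil by (simp add: mult.assoc)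
  next
    \<comment> \<open>The innermost derivative is split off: it yields a sum of two products with
      one factor differentiated, and bounds for lists of length \<open>Suc n\<close> contain those
      of length \<open>n\<close> for the derivative, as the induction hypothesis demands.\<close>
    case (snoc js i)
    note sm = Suc.prems(1,2) smooth_partial_deriv[OF Suc.prems(1)] smooth_partial_deriv[OF Suc.prems(2)]
    have eq: "iter_partial is (\<lambda>x. f x * g x) =
       (\<lambda>x. iter_partial js (\<lambda>x. partial_deriv i f x * g x) x + iter_partial js (\<lambda>x. f x * partial_deriv i g x) x)"
    proof -
      have "partial_deriv i (\<lambda>x. f x * g x) = (\<lambda>x. partial_deriv i f x * g x + f x * partial_deriv i g x)"
        using sm smooth_imp_differentiable by (intro ext partial_deriv_mult) auto
      then show ?thesis
        unfolding snoc iter_partial_snoc using sm by (simp add: iter_partial_add smooth_mult)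
    qed
    have 1: "norm (iter_partial js (\<lambda>x. partial_deriv i f x * g x) x) \<le> 2 ^ n * a * b"
      using Suc.prems(3) snoc
      by (intro Suc.IH sm) (auto simp flip: iter_partial_snoc intro!: Suc.prems)
    have 2: "norm (iter_partial js (\<lambda>x. f x * partial_deriv i g x) x) \<le> 2 ^ n * a * b"
      using Suc.prems(3) snoc
      by (intro Suc.IH sm) (auto simp flip: iter_partial_snoc intro!: Suc.prems)
    show ?thesis unfolding eq using norm_triangle_mono[OF 1 2] by (simp add: algebra_simps)
  qed
qed

section \<open>Bump functions\<close>

text \<open>The powers of \<open>t\<close> in the denominator close the family under
  differentiation: the derivative of member \<open>n\<close> is a combination of the members
  \<open>n + 2\<close> and \<open>n + 1\<close>.\<close>

definition flat_exp :: "nat \<Rightarrow> real \<Rightarrow> real" where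
  "flat_exp n t = (if t \<le> 0 then 0 else exp (- 1 / t) / t ^ n)"

lemma flat_exp_nonneg: "0 \<le> flat_exp n t"
  by (simp add: flat_exp_def)

lemma flat_exp_Suc: "t * flat_exp (Suc n) t = flat_exp n t"
  by (simp add: flat_exp_def)

text \<open>A single term of a positive series is at most its sum:
  \<open>(1 / t) ^ n / fact n \<le> exp (1 / t)\<close>.\<close>

lemma flat_exp_le: "flat_exp n t \<le> fact n"
proof (cases "t \<le> 0")
  case False
  have "(1 / t) ^ n / fact n \<le> exp (1 / t)"
  proof -
    have "(\<lambda>k. (1/t) ^ k /\<^sub>R fact k) sums exp (1/t)" by (rule exp_converges)
    then have "(\<Sum>k\<in>{n}. (1/t) ^ k /\<^sub>R fact k) \<le> exp (1/t)"
      using False unfolding sums_iff by (elim conjE, erule_tac subst, intro sum_le_suminf) auto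
    then show ?thesis by (simp add: field_simps)
  qed
  then show ?thesis using False
    by (simp add: flat_exp_def exp_minus field_simps)
qed (auto simp: flat_exp_def)

lemma flat_exp_has_derivative:
  "(flat_exp n has_real_derivative (flat_exp (n + 2) t - n * flat_exp (n + 1) t)) (at t)"
proof (cases t "0::real" rule: linorder_cases)
  case greater
  have "((\<lambda>t. exp (- 1 / t) / t ^ n) has_real_derivative (flat_exp (n + 2) t - n * flat_exp (n + 1) t)) (at t)"
    using greater
    apply (auto intro!: derivative_eq_intros simp: flat_exp_def)
    apply (cases n)
    apply (auto simp: field_simps power2_eq_square)
    done
  then show ?thesis
    by (rule DERIV_cong_ev[THEN iffD2, OF refl _ refl, rotated])
      (use greater in \<open>auto simp: flat_exp_def eventually_at_topological intro!: eventually_nhds_in_open[of "{0<..}", THEN eventually_mono]\<close>)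
next
  case less
  have "((\<lambda>t. 0::real) has_real_derivative (flat_exp (n + 2) t - n * flat_exp (n + 1) t)) (at t)"
    using less by (auto simp: flat_exp_def)
  then show ?thesis
    by (rule DERIV_cong_ev[THEN iffD2, OF refl _ refl, rotated])
      (use less in \<open>auto simp: flat_exp_def intro!: eventually_nhds_in_open[of "{..<0}", THEN eventually_mono]\<close>)
next
  case equal
  \<comment> \<open>At the origin the difference quotient of member \<open>n\<close> is member
    \<open>n + 1\<close>, which is \<open>h\<close> times the bounded member \<open>n + 2\<close>
    and so tends to 0.\<close>
  have "((\<lambda>h. flat_exp (Suc n) h) \<longlongrightarrow> 0) (at 0)"
  proof (rule Lim_null_comparison)
    show "\<forall>\<^sub>F h in at 0. norm (flat_exp (Suc n) h) \<le> \<bar>h\<bar> * fact (Suc (Suc n))"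
      by (intro always_eventually allI, subst flat_exp_Suc[symmetric])
        (auto simp: abs_mult flat_exp_nonneg flat_exp_le simp del: fact_Suc intro!: mult_left_mono)
    show "((\<lambda>h. \<bar>h\<bar> * fact (Suc (Suc n))) \<longlongrightarrow> (0::real)) (at 0)"
      by (auto intro!: tendsto_eq_intros)
  qed
  then have "(flat_exp n has_real_derivative 0) (at 0)"
    unfolding DERIV_def
    by (rule tendsto_cong[THEN iffD1, rotated])
      (auto simp: eventually_at_filter flat_exp_Suc[symmetric, of n] flat_exp_def)
  then show ?thesis using equal by (simp add: flat_exp_def)
qed

lemma smooth_flat_exp: "smooth (\<lambda>x::real^'n::finite. complex_of_real (flat_exp n (a * x $ i + b)))"
proof -
  let ?g = "\<lambda>n. \<lambda>x::real^'n. complex_of_real (flat_exp n (a * x $ i + b))"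
  define B where "B = range ?g"
  have D: "(?g n has_derivative (\<lambda>h. of_real ((flat_exp (n + 2) (a * x $ i + b) - n * flat_exp (n + 1) (a * x $ i + b)) * (a * h $ i)))) (at x)" for x n
  proof -
    have "((\<lambda>x. flat_exp n (a * x $ i + b)) has_derivative (\<lambda>h. (flat_exp (n + 2) (a * x $ i + b) - n * flat_exp (n + 1) (a * x $ i + b)) * (a * h $ i))) (at x)"
      by (rule has_derivative_compose[OF _ flat_exp_has_derivative[unfolded has_field_derivative_def]])
        (auto intro!: derivative_eq_intros bounded_linear_imp_has_derivative)
    from has_derivative_of_real[OF this] show ?thesis .
  qed
  have gB: "?g m \<in> falgebra B" for m by (auto simp: B_def intro: falgebra.gen)
  have "partial_deriv j (?g n) = (\<lambda>x. complex_of_real (a * axis j 1 $ i) * (?g (n+2) x + (- of_nat n) * ?g (n+1) x))" for j n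
    by (intro ext, subst partial_deriv_eqI[OF D]) (simp add: algebra_simps)
  then have pd: "partial_deriv j (?g n) \<in> falgebra B" for j n
    by (simp only:) (rule falgebra.mult[OF falgebra.const falgebra.add[OF gB falgebra.mult[OF falgebra.const gB]]])
  have diff: "g differentiable (at x)" if "g \<in> B" for g x
    using that D by (auto simp: B_def differentiable_def)
  show ?thesis
    using pd by (intro falgebra_smooth[where B="B", OF diff _ gB]) (auto simp: B_def)
qed

text \<open>Smooth descent from 1 on \<open>t \<le> s\<close> to 0 on \<open>t \<ge> s + 1\<close>:
  the numerator vanishes on the latter half-line, the second summand of the denominator on the
  former, and never both.\<close>

definition plateau :: "real \<Rightarrow> real \<Rightarrow> real" where
  "plateau s t = flat_exp 0 (s + 1 - t) / (flat_exp 0 (s + 1 - t) + flat_exp 0 (t - s))"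

lemma plateau_denom_pos: "0 < flat_exp 0 (s + 1 - t) + flat_exp 0 (t - s)"
  by (auto simp: flat_exp_def add_pos_pos)

text \<open>A product over the coordinates avoids the norm, which is not smooth at the origin. For
  \<open>s \<ge> 0\<close> it is 1 on the cube of half side \<open>s\<close>, hence on the ball of
  radius \<open>s\<close>, and 0 off the cube of half side \<open>s + 1\<close>.\<close>

definition bump :: "real \<Rightarrow> real^'n::finite \<Rightarrow> real" where
  "bump s x = (\<Prod>i\<in>UNIV. plateau s (x $ i) * plateau s (- x $ i))"

lemma bump_nonneg: "0 \<le> bump s x"
  unfolding bump_def plateau_def by (intro prod_nonneg) (auto simp: flat_exp_nonneg)

lemma bump_eq_1: "norm x \<le> s \<Longrightarrow> bump s x = 1"
proof -
  assume *: "norm x \<le> s"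
  have "plateau s (x $ i) * plateau s (- x $ i) = 1" for i
    using component_le_norm_cart[of x i] * plateau_denom_pos
    by (auto simp: plateau_def flat_exp_def)
  then show ?thesis by (simp add: bump_def)
qed

lemma bump_eq_0: "s + 1 \<le> \<bar>x $ i\<bar> \<Longrightarrow> bump s x = 0"
  unfolding bump_def
  by (intro prod_zero bexI[of _ i]) (auto simp: plateau_def flat_exp_def abs_real_def split: if_splits)

lemma smooth_bump: "smooth (\<lambda>x::real^'n::finite. complex_of_real (bump s x))"
proof -
  have *: "smooth (\<lambda>x::real^'n. complex_of_real (plateau s (a * x $ i)))" for i a
  proof -
    have "smooth (\<lambda>x::real^'n. complex_of_real (flat_exp 0 ((-a) * x $ i + (s + 1))) * 
       inverse (complex_of_real (flat_exp 0 ((-a) * x $ i + (s + 1))) + complex_of_real (flat_exp 0 (a * x $ i + (- s)))))"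
      using plateau_denom_pos[of s "a * x $ i" for x :: "real^'n"]
      by (intro smooth_mult smooth_inverse smooth_add smooth_flat_exp)
        (smt (verit, best) flat_exp_nonneg mult_minus_left of_real_add of_real_eq_0_iff)
    then show ?thesis
      by (simp add: plateau_def divide_inverse algebra_simps)
  qed
  show ?thesis
    using *[of 1] *[of "-1"] by (auto simp: bump_def intro!: smooth_prod smooth_mult)
qed

lemma bump_test_function: "(\<lambda>x::real^'n::finite. complex_of_real (bump s x)) \<in> test_functions"
proof -
  have "bounded {x::real^'n. bump s x \<noteq> 0}"
  proof (rule boundedI)
    fix x :: "real^'n" assume "x \<in> {x. bump s x \<noteq> 0}"
    then have "\<bar>x $ i\<bar> \<le> s + 1" for i using bump_eq_0[of s x i] by fastforce
    then show "norm x \<le> of_nat CARD('n) * (s + 1)"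
      by (intro order_trans[OF norm_le_l1_cart] order_trans[OF sum_bounded_above]) auto
  qed
  then show ?thesis
    by (simp add: test_functions_def fun_support_def compact_closure smooth_bump)
qed

section \<open>Test functions and Schwartz functions\<close>

lemma test_functions_smooth: "\<phi> \<in> test_functions \<Longrightarrow> smooth \<phi>"
  by (simp add: test_functions_def)

lemma test_functionsI:
  assumes "smooth \<phi>" "\<And>x. R < norm x \<Longrightarrow> \<phi> x = 0"
  shows "\<phi> \<in> test_functions"
proof -
  have "bounded {x. \<phi> x \<noteq> 0}"
    by (rule boundedI[of _ R]) (use assms(2) not_less in blast)
  with assms(1) show ?thesis
    by (simp add: test_functions_def fun_support_def)
qed

lemma test_functions_bounded_support:
  assumes "\<phi> \<in> test_functions"
  obtains R where "0 < R" "\<And>x. R < norm x \<Longrightarrow> \<phi> x = 0"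
proof -
  have "bounded {x. \<phi> x \<noteq> 0}"
    using assms by (simp add: test_functions_def fun_support_def)
  then obtain R where "0 < R" "\<And>x. x \<in> {x. \<phi> x \<noteq> 0} \<Longrightarrow> norm x \<le> R"
    unfolding bounded_pos by blast
  then show thesis using that[of R] by force
qed

lemma test_functions_mult:
  assumes "\<phi> \<in> test_functions" "smooth g"
  shows "(\<lambda>x. \<phi> x * g x) \<in> test_functions"
proof -
  obtain R where R: "\<And>x. R < norm x \<Longrightarrow> \<phi> x = 0"
    using assms(1) by (rule test_functions_bounded_support) blast
  show ?thesis
    using assms R by (intro test_functionsI[of _ R] smooth_mult) (auto simp: test_functions_smooth)
qed

lemma test_functions_cmult:
  "\<phi> \<in> test_functions \<Longrightarrow> (\<lambda>x. c * \<phi> x) \<in> test_functions"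
  using test_functions_mult[OF _ smooth_const[of c]] by (simp add: mult.commute)

lemma test_functions_diff:
  assumes "\<phi> \<in> test_functions" "\<psi> \<in> test_functions"
  shows "(\<lambda>x. \<phi> x - \<psi> x) \<in> test_functions"
proof -
  obtain R where R: "\<And>x. R < norm x \<Longrightarrow> \<phi> x = 0"
    using assms(1) by (rule test_functions_bounded_support) blast
  obtain S where S: "\<And>x. S < norm x \<Longrightarrow> \<psi> x = 0"
    using assms(2) by (rule test_functions_bounded_support) blast
  show ?thesis
    using assms R S by (intro test_functionsI[of _ "max R S"] smooth_diff) (auto simp: test_functions_smooth)
qed

lemma test_functions_affine:
  fixes b :: "real^'n::finite"
  assumes "\<phi> \<in> test_functions" "a \<noteq> 0"
  shows "(\<lambda>x. \<phi> (a *\<^sub>R x + b)) \<in> test_functions"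
proof -
  obtain R where R: "\<And>x. R < norm x \<Longrightarrow> \<phi> x = 0"
    using assms(1) by (rule test_functions_bounded_support) blast
  show ?thesis
  proof (rule test_functionsI[of _ "(R + norm b) / \<bar>a\<bar>"])
    show "smooth (\<lambda>x. \<phi> (a *\<^sub>R x + b))"
      using assms by (intro smooth_affine test_functions_smooth)
    fix x :: "real^'n" assume "(R + norm b) / \<bar>a\<bar> < norm x"
    then have "R + norm b < norm (a *\<^sub>R x)"
      using assms(2) by (simp add: field_simps)
    also have "norm (a *\<^sub>R x) \<le> norm (a *\<^sub>R x + b) + norm b"
      using norm_triangle_ineq4[of "a *\<^sub>R x + b" b] by simp
    finally show "\<phi> (a *\<^sub>R x + b) = 0" by (intro R) simp
  qed
qed

lemma test_functions_partial_deriv: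
  fixes \<phi> :: "real^'n::finite \<Rightarrow> complex"
  assumes "\<phi> \<in> test_functions"
  shows "partial_deriv i \<phi> \<in> test_functions"
proof -
  obtain R where R: "\<And>x. R < norm x \<Longrightarrow> \<phi> x = 0"
    using assms(1) by (rule test_functions_bounded_support) blast
  have "open {x :: real^'n. R < norm x}"
    by (intro open_Collect_less continuous_intros)
  then have "iter_partial [i] \<phi> x = 0" if "R < norm x" for x
    by (rule iter_partial_eq_zero_on_open) (use that R in simp_all)
  then show ?thesis
    using assms by (intro test_functionsI[of _ R]) (simp_all add: smooth_partial_deriv test_functions_smooth)
qed

lemma test_functions_iter_partial:
  "\<phi> \<in> test_functions \<Longrightarrow> iter_partial is \<phi> \<in> test_functions"
  by (induction "is") (auto intro: test_functions_partial_deriv)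

lemma test_functions_bounded:
  assumes "\<phi> \<in> test_functions"
  obtains K where "0 < K" "\<And>x. norm (\<phi> x) \<le> K"
proof -
  obtain R where R: "\<And>x. R < norm x \<Longrightarrow> \<phi> x = 0"
    using assms(1) by (rule test_functions_bounded_support) blast
  have "compact (\<phi> ` cball 0 R)"
    using assms by (intro compact_continuous_image smooth_imp_continuous_on test_functions_smooth) auto
  then obtain K where K: "0 < K" "\<And>y. y \<in> \<phi> ` cball 0 R \<Longrightarrow> norm y \<le> K"
    using compact_imp_bounded[of "\<phi> ` cball 0 R"] unfolding bounded_pos by auto
  have "norm (\<phi> x) \<le> K" for x
  proof (cases "R < norm x")
    case True
    then show ?thesis using R[of x] K(1) by simp
  next
    case False
    then show ?thesis by (intro K(2) imageI) simp
  qed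
  with K(1) show thesis by (rule that)
qed

lemma borel_measurable_smooth [measurable]:
  "smooth f \<Longrightarrow> f \<in> borel_measurable borel"
  using smooth_imp_continuous_on[of f UNIV] by (rule borel_measurable_continuous_onI)

lemma schwartz_space_iff:
  "\<phi> \<in> schwartz_space \<longleftrightarrow>
     smooth \<phi> \<and> (\<forall>N is. \<exists>K. \<forall>x. (1 + norm x) ^ N * norm (iter_partial is \<phi> x) \<le> K)"
proof -
  have "bounded (range (\<lambda>x. (1 + norm x) ^ N *\<^sub>R iter_partial is \<phi> x)) \<longleftrightarrow>
     (\<exists>K. \<forall>x. (1 + norm x) ^ N * norm (iter_partial is \<phi> x) \<le> K)" for N "is"
    by (simp add: bounded_iff)
  then show ?thesis by (simp add: schwartz_space_def)
qed

lemma test_functions_schwartz: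
  assumes "\<phi> \<in> test_functions"
  shows "\<phi> \<in> schwartz_space"
  unfolding schwartz_space_iff
proof (intro conjI allI)
  show "smooth \<phi>" using assms by (rule test_functions_smooth)
  fix N "is"
  have t: "iter_partial is \<phi> \<in> test_functions"
    using assms by (rule test_functions_iter_partial)
  obtain R where R: "0 < R" "\<And>x. R < norm x \<Longrightarrow> iter_partial is \<phi> x = 0"
    using t by (rule test_functions_bounded_support) blast
  obtain K where K: "0 < K" "\<And>x. norm (iter_partial is \<phi> x) \<le> K"
    using t by (rule test_functions_bounded) blast
  have "(1 + norm x) ^ N * norm (iter_partial is \<phi> x) \<le> (1 + R) ^ N * K" for x
  proof (cases "R < norm x")
    case True
    then show ?thesis using R K by simp
  next
    case False
    then show ?thesis using R K by (intro mult_mono power_mono) auto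
  qed
  then show "\<exists>K. \<forall>x. (1 + norm x) ^ N * norm (iter_partial is \<phi> x) \<le> K" by blast
qed

section \<open>Integrability of polynomial weights and Schwartz functions\<close>

lemma nn_integral_decay_finite:
  assumes "real CARD('n) < M"
  shows "(\<integral>\<^sup>+x. ennreal ((1 + norm (x::real^'n::finite)) powr (- M)) \<partial>lborel) < \<infinity>"
proof -
  define d where "d = CARD('n)"
  define V where "V = unit_ball_vol (real d)"
  have V: "0 \<le> V" by (simp add: V_def)
  define c where "c j = 2 powr (- M * real j)" for j
  have le: "ennreal ((1 + norm x) powr (- M)) \<le> (\<Sum>j. ennreal (c j) * indicator (cball 0 (2 ^ (j + 1))) x)"
    for x :: "real^'n"
  proof -
    \<comment> \<open>Dyadic shells: where \<open>2 ^ j \<le> 1 + norm x < 2 ^ (j + 1)\<close> the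
      weight is at most \<open>c j\<close>, and the ball of radius \<open>2 ^ (j + 1)\<close>
      contains \<open>x\<close>. Its volume makes the series geometric with ratio
      \<open>2 powr (d - M)\<close>, below 1 by the hypothesis on \<open>M\<close>.\<close>
    define j where "j = nat \<lfloor>log 2 (1 + norm x)\<rfloor>"
    have nn: "0 \<le> log 2 (1 + norm x)" by (subst zero_le_log_cancel_iff) (auto simp: add_pos_nonneg)
    have j: "real j \<le> log 2 (1 + norm x)" "log 2 (1 + norm x) < real j + 1"
      unfolding j_def using nn by linarith+
    have "2 powr real j \<le> 2 powr log 2 (1 + norm x)" using j(1) by (intro powr_mono) auto
    also have "\<dots> = 1 + norm x" by (intro powr_log_cancel) (auto simp: add_pos_nonneg)
    finally have 1: "2 powr real j \<le> 1 + norm x" .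
    have "1 + norm x = 2 powr log 2 (1 + norm x)" by (rule powr_log_cancel[symmetric]) (auto simp: add_pos_nonneg)
    also have "\<dots> \<le> 2 powr (real j + 1)" using j(2) by (intro powr_mono) auto
    also have "\<dots> = 2 ^ (j + 1)" using powr_realpow[of 2 "j + 1"] by (simp add: add.commute)
    finally have 2: "x \<in> cball 0 (2 ^ (j + 1))" by simp
    have "(1 + norm x) powr (- M) \<le> (2 powr real j) powr (- M)"
      using assms 1 by (intro powr_mono2') auto
    also have "\<dots> = c j" by (simp add: c_def powr_powr mult.commute)
    finally have "ennreal ((1 + norm x) powr (- M)) \<le> ennreal (c j) * indicator (cball 0 (2 ^ (j + 1))) x"
      using 2 by (simp add: ennreal_leI)
    also have "\<dots> = (\<Sum>j\<in>{j}. ennreal (c j) * indicator (cball 0 (2 ^ (j + 1))) x)"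
      by (simp only: sum.insert finite.emptyI empty_iff not_False_eq_True sum.empty add_0_right)
    also have "\<dots> \<le> (\<Sum>j. ennreal (c j) * indicator (cball 0 (2 ^ (j + 1))) x)"
      by (intro sum_le_suminf) auto
    finally show ?thesis .
  qed
  have summ: "summable (\<lambda>j. c j * (V * (2 ^ (j + 1)) ^ d))"
  proof -
    have "c j * (V * (2 ^ (j + 1)) ^ d) = (V * 2 ^ d) * (2 powr (real d - M)) ^ j" for j
    proof -
      have "c j * (2 ^ j) ^ d = (2 powr (real d - M)) ^ j"
        by (simp add: c_def powr_realpow[symmetric] powr_powr powr_add[symmetric] algebra_simps)
      then show ?thesis by (simp add: power_mult_distrib)
    qed
    moreover have "norm (2 powr (real d - M)) < 1"
      using assms by (simp add: d_def powr_less_one)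
    ultimately show ?thesis
      by (simp only:) (intro summable_mult summable_geometric)
  qed
  have "(\<integral>\<^sup>+x. ennreal ((1 + norm (x::real^'n)) powr (- M)) \<partial>lborel)
     \<le> (\<integral>\<^sup>+x. (\<Sum>j. ennreal (c j) * indicator (cball 0 (2 ^ (j + 1))) (x::real^'n)) \<partial>lborel)"
    by (intro nn_integral_mono le)
  also have "\<dots> = (\<Sum>j. ennreal (c j) * emeasure lborel (cball (0::real^'n) (2 ^ (j + 1))))"
    by (subst nn_integral_suminf)
      (auto intro!: borel_measurable_times_ennreal borel_measurable_indicator simp: nn_integral_cmult_indicator)
  also have "\<dots> = (\<Sum>j. ennreal (c j * (V * (2 ^ (j + 1)) ^ d)))"
    by (simp add: emeasure_cball ennreal_mult'[symmetric] c_def V_def d_def)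
  also have "\<dots> < \<infinity>"
    using summ V by (subst suminf_ennreal2) (auto simp: c_def)
  finally show ?thesis .
qed

lemma integrable_decay:
  assumes "real CARD('n) < M"
  shows "integrable lborel (\<lambda>x::real^'n::finite. (1 + norm x) powr (- M))"
  using nn_integral_decay_finite[OF assms]
  by (intro integrableI_nonneg) auto

lemma schwartz_integrable:
  fixes \<phi> :: "real^'n::finite \<Rightarrow> complex"
  assumes "\<phi> \<in> schwartz_space"
  shows "integrable lborel \<phi>"
proof -
  obtain K where K: "\<And>x. (1 + norm x) ^ (CARD('n) + 1) * norm (iter_partial [] \<phi> x) \<le> K"
    using assms unfolding schwartz_space_iff by meson
  have "integrable lborel (\<lambda>x::real^'n. K * (1 + norm x) powr (- (real CARD('n) + 1)))"
    by (intro integrable_mult_right integrable_decay) auto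
  then show ?thesis
  proof (rule Bochner_Integration.integrable_bound)
    show "\<phi> \<in> borel_measurable lborel"
      using assms borel_measurable_smooth by (auto simp: schwartz_space_iff)
    show "AE x in lborel. norm (\<phi> x) \<le> norm (K * (1 + norm x) powr (- (real CARD('n) + 1)))"
    proof (intro always_eventually allI)
      fix x :: "real^'n"
      have "norm (\<phi> x) \<le> K / (1 + norm x) ^ (CARD('n) + 1)"
        using K[of x] by (subst pos_le_divide_eq) (auto simp: mult.commute add_pos_nonneg)
      also have "\<dots> = K * (1 + norm x) powr (- (real CARD('n) + 1))"
        using powr_realpow[of "1 + norm x" "CARD('n) + 1"]
        by (simp only: powr_minus divide_inverse) (simp add: add_pos_nonneg add.commute)
      finally show "norm (\<phi> x) \<le> norm (K * (1 + norm x) powr (- (real CARD('n) + 1)))" by simp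
    qed
  qed
qed

lemmas test_functions_integrable = schwartz_integrable[OF test_functions_schwartz]

section \<open>Fourier transforms of test functions\<close>

definition character :: "real^'n::finite \<Rightarrow> real^'n \<Rightarrow> complex" where
  "character \<xi> x = exp (- 2 * complex_of_real pi * \<i> * complex_of_real (x \<bullet> \<xi>))"

lemma fourier_character: "fourier f \<xi> = (LINT x|lborel. f x * character \<xi> x)"
  by (simp add: fourier_def character_def)

lemma character_eq_cis: "character \<xi> x = cis (- (2 * pi * (x \<bullet> \<xi>)))"
  by (simp add: character_def cis_conv_exp algebra_simps)

lemma norm_character [simp]: "norm (character \<xi> x) = 1"
  by (simp add: character_eq_cis)

lemma smooth_character: "smooth (character \<xi>)"
  unfolding character_def[abs_def] by (rule smooth_exp_inner)

lemma character_measurable [measurable]: "character \<xi> \<in> borel_measurable borel"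
  by (intro borel_measurable_smooth smooth_character)

lemma character_add: "character (\<xi> + \<eta>) x = character \<xi> x * character \<eta> x"
  by (simp add: character_eq_cis cis_mult inner_add_right algebra_simps)

lemma partial_deriv_character:
  "partial_deriv i (character \<xi>) x = - 2 * complex_of_real pi * \<i> * of_real (\<xi> $ i) * character \<xi> x"
proof -
  have D: "(character \<xi> has_derivative
      (\<lambda>h. (- 2 * complex_of_real pi * \<i>) * of_real (h \<bullet> \<xi>) * character \<xi> x)) (at x)"
    unfolding character_def[abs_def]
    by (rule has_derivative_eq_rhs[OF has_derivative_compose[OF _ DERIV_exp[unfolded has_field_derivative_def]]])
      (auto intro!: derivative_eq_intros)
  show ?thesis using partial_deriv_eqI[OF D, of i] by (simp add: inner_axis')
qed

lemma integrable_mult_character: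
  "integrable lborel f \<Longrightarrow> integrable lborel (\<lambda>x. f x * character \<xi> x)"
  by (rule Bochner_Integration.integrable_bound[of _ f]) (auto simp: norm_mult)

lemma norm_fourier_le: "norm (fourier f \<xi>) \<le> (LINT x|lborel. norm (f x))"
proof -
  have "norm (fourier f \<xi>) \<le> (LINT x|lborel. norm (f x * character \<xi> x))"
    unfolding fourier_character by (rule integral_norm_bound)
  then show ?thesis by (simp add: norm_mult)
qed

lemma character_taylor:
  "norm (character h x - 1 + 2 * complex_of_real pi * \<i> * of_real (x \<bullet> h)) \<le> (2 * pi * norm x * norm h)\<^sup>2"
proof -
  define t where "t = - (2 * pi * (x \<bullet> h))"
  have "norm (iexp t - (\<Sum>k\<le>1. (\<i> * t) ^ k / fact k)) \<le> \<bar>t\<bar> ^ Suc 1 / fact (Suc 1)"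
    by (rule iexp_approx1)
  then have "norm (iexp t - 1 - \<i> * t) \<le> t\<^sup>2 / 2"
    by (simp add: algebra_simps power2_eq_square)
  moreover have "iexp t = character h x"
    by (simp add: character_eq_cis t_def cis_conv_exp)
  ultimately have "norm (character h x - 1 + 2 * complex_of_real pi * \<i> * of_real (x \<bullet> h)) \<le> t\<^sup>2 / 2"
    by (simp add: t_def algebra_simps)
  also have "\<dots> \<le> t\<^sup>2" by simp
  also have "\<dots> \<le> (2 * pi * norm x * norm h)\<^sup>2"
    using Cauchy_Schwarz_ineq2[of x h]
    by (intro iffD1[OF abs_le_square_iff]) (auto simp: t_def abs_mult mult.assoc)
  finally show ?thesis .
qed

text \<open>Compact support bounds \<open>norm x\<close> by \<open>R\<close>, so the second-order
  remainder of the character integrates to at most a constant times the square of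
  \<open>norm h\<close>; the derivative under the integral sign is justified by this direct
  estimate.\<close>

lemma fourier_has_derivative:
  fixes \<phi> :: "real^'n::finite \<Rightarrow> complex"
  assumes "\<phi> \<in> test_functions"
  shows "(fourier \<phi> has_derivative
     (\<lambda>h. LINT x|lborel. \<phi> x * character \<xi> x * (- 2 * complex_of_real pi * \<i> * of_real (x \<bullet> h)))) (at \<xi>)"
proof -
  let ?D = "\<lambda>h. LINT x|lborel. \<phi> x * character \<xi> x * (- 2 * complex_of_real pi * \<i> * of_real (x \<bullet> h))"
  obtain R where R: "0 < R" "\<And>x. R < norm x \<Longrightarrow> \<phi> x = 0"
    using assms by (rule test_functions_bounded_support) blast
  have [measurable]: "\<phi> \<in> borel_measurable borel"
    using assms by (intro borel_measurable_smooth test_functions_smooth)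
  note int = test_functions_integrable[OF assms]
  define I where "I = (LINT x|lborel. norm (\<phi> x))"
  have bd: "norm (\<phi> x * character \<xi> x * (- 2 * complex_of_real pi * \<i> * of_real (x \<bullet> h)))
      \<le> 2 * pi * R * norm h * norm (\<phi> x)" for x h
  proof (cases "R < norm x")
    case False
    have "norm (\<phi> x * character \<xi> x * (- 2 * complex_of_real pi * \<i> * of_real (x \<bullet> h)))
        = 2 * pi * norm (\<phi> x) * \<bar>x \<bullet> h\<bar>" by (simp add: norm_mult)
    also have "\<dots> \<le> 2 * pi * norm (\<phi> x) * (R * norm h)"
      using False by (intro mult_left_mono order_trans[OF Cauchy_Schwarz_ineq2] mult_right_mono) auto
    finally show ?thesis by (simp add: mult_ac)
  qed (use R in auto)
  have intD: "integrable lborel (\<lambda>x. \<phi> x * character \<xi> x * (- 2 * complex_of_real pi * \<i> * of_real (x \<bullet> h)))" for h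
    by (rule Bochner_Integration.integrable_bound[of _ "\<lambda>x. 2 * pi * R * norm h * norm (\<phi> x)"])
      (use bd int R in auto)
  have bl: "bounded_linear ?D"
  proof (rule bounded_linear_intro[where K="2 * pi * R * I"])
    show "?D (g + h) = ?D g + ?D h" for g h
      using intD by (subst Bochner_Integration.integral_add[symmetric])
        (auto simp: inner_add_right algebra_simps intro!: Bochner_Integration.integral_cong)
    show "?D (r *\<^sub>R h) = r *\<^sub>R ?D h" for r h
      by (subst integral_scaleR_right[symmetric], intro Bochner_Integration.integral_cong)
        (auto simp: scaleR_conv_of_real[of r "z::complex" for z])
    show "norm (?D h) \<le> norm h * (2 * pi * R * I)" for h
    proof -
      have "norm (?D h) \<le> (LINT x|lborel. 2 * pi * R * norm h * norm (\<phi> x))"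
        by (rule order_trans[OF integral_norm_bound], rule integral_mono)
          (use bd int intD in \<open>auto\<close>)
      then show ?thesis by (simp add: I_def mult_ac)
    qed
  qed
  have est: "norm (fourier \<phi> (\<xi> + h) - fourier \<phi> \<xi> - ?D h) \<le> (2 * pi * R)\<^sup>2 * I * (norm h)\<^sup>2" for h
  proof -
    let ?g = "\<lambda>x. \<phi> x * character \<xi> x * (character h x - 1 + 2 * complex_of_real pi * \<i> * of_real (x \<bullet> h))"
    have "fourier \<phi> (\<xi> + h) - fourier \<phi> \<xi> - ?D h = (LINT x|lborel. ?g x)"
    proof -
      let ?F = "\<lambda>x. \<phi> x * character (\<xi> + h) x" and ?G = "\<lambda>x. \<phi> x * character \<xi> x"
      let ?H = "\<lambda>x. \<phi> x * character \<xi> x * (- 2 * complex_of_real pi * \<i> * of_real (x \<bullet> h))"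
      have "(LINT x|lborel. ?F x - ?G x - ?H x) = (LINT x|lborel. ?F x) - (LINT x|lborel. ?G x) - (LINT x|lborel. ?H x)"
        using integrable_mult_character[OF int] intD
        by (simp only: Bochner_Integration.integral_diff Bochner_Integration.integrable_diff)
      moreover have "?F x - ?G x - ?H x = ?g x" for x
        by (simp add: character_add algebra_simps)
      ultimately show ?thesis by (simp add: fourier_character)
    qed
    also have "norm \<dots> \<le> (LINT x|lborel. (2 * pi * R * norm h)\<^sup>2 * norm (\<phi> x))"
    proof (rule Bochner_Integration.integral_norm_bound_integral)
      show g: "norm (?g x) \<le> (2 * pi * R * norm h)\<^sup>2 * norm (\<phi> x)" for x
      proof (cases "R < norm x")
        case False
        have "norm (?g x) = norm (\<phi> x) * norm (character h x - 1 + 2 * complex_of_real pi * \<i> * of_real (x \<bullet> h))"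
          by (simp add: norm_mult)
        also have "\<dots> \<le> norm (\<phi> x) * (2 * pi * R * norm h)\<^sup>2"
          using False R
          by (intro mult_left_mono order_trans[OF character_taylor] power_mono mult_mono) auto
        finally show ?thesis by (simp add: mult_ac)
      qed (use R in auto)
      show "integrable lborel (\<lambda>x. (2 * pi * R * norm h)\<^sup>2 * norm (\<phi> x))"
        using int by auto
      then show "integrable lborel ?g"
        by (rule Bochner_Integration.integrable_bound) (use g in auto)
    qed
    finally show ?thesis by (simp add: I_def power_mult_distrib mult_ac)
  qed
  show ?thesis
    unfolding has_derivative_at
  proof (intro conjI bl)
    show "(\<lambda>h. norm (fourier \<phi> (\<xi> + h) - fourier \<phi> \<xi> - ?D h) / norm h) \<midarrow>0\<rightarrow> 0"
    proof (rule Lim_null_comparison)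
      show "\<forall>\<^sub>F h in at 0. norm (norm (fourier \<phi> (\<xi> + h) - fourier \<phi> \<xi> - ?D h) / norm h)
          \<le> (2 * pi * R)\<^sup>2 * I * norm h"
        using est by (intro eventually_at_filter[THEN iffD2] always_eventually)
          (auto simp: divide_simps power2_eq_square mult_ac)
      show "((\<lambda>h::real^'n. (2 * pi * R)\<^sup>2 * I * norm h) \<longlongrightarrow> 0) (at 0)"
        by (auto intro!: tendsto_eq_intros)
    qed
  qed
qed

lemma partial_deriv_fourier:
  assumes "\<phi> \<in> test_functions"
  shows "partial_deriv i (fourier \<phi>) = fourier (\<lambda>x. \<phi> x * (- 2 * complex_of_real pi * \<i> * of_real (x $ i)))"
  by (intro ext, subst partial_deriv_eqI[OF fourier_has_derivative[OF assms]])
    (auto simp: fourier_character inner_axis mult_ac)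

lemma iter_partial_fourier:
  assumes "\<phi> \<in> test_functions"
  shows "\<exists>\<psi>\<in>test_functions. iter_partial is (fourier \<phi>) = fourier \<psi>"
proof (induction "is")
  case (Cons i "is")
  then obtain \<psi> where "\<psi> \<in> test_functions" "iter_partial is (fourier \<phi>) = fourier \<psi>" by blast
  moreover from this have "(\<lambda>x. \<psi> x * (- 2 * complex_of_real pi * \<i> * of_real (x $ i))) \<in> test_functions"
    by (intro test_functions_mult smooth_mult smooth_const smooth_component)
  ultimately show ?case
    by (metis iter_partial_Cons partial_deriv_fourier)
qed (use assms in auto)

lemma smooth_fourier:
  assumes "\<phi> \<in> test_functions"
  shows "smooth (fourier \<phi>)"
  unfolding smooth_def
proof (intro allI)
  fix "is" \<xi>
  obtain \<psi> where \<psi>: "\<psi> \<in> test_functions" "iter_partial is (fourier \<phi>) = fourier \<psi>"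
    using iter_partial_fourier[OF assms] by blast
  show "iter_partial is (fourier \<phi>) differentiable (at \<xi>)"
    unfolding \<psi>(2) by (rule differentiableI[OF fourier_has_derivative[OF \<psi>(1)]])
qed

section \<open>Integration by parts and decay of Fourier transforms\<close>

lemma has_vector_derivative_along_axis:
  assumes "smooth \<phi>"
  shows "((\<lambda>t. \<phi> (x + t *\<^sub>R axis i 1)) has_vector_derivative partial_deriv i \<phi> (x + t *\<^sub>R axis i 1)) (at t within S)"
proof -
  have "(\<phi> has_derivative frechet_derivative \<phi> (at (x + t *\<^sub>R axis i 1))) (at (x + t *\<^sub>R axis i 1))"
    using smooth_imp_differentiable[OF assms] frechet_derivative_works by blast
  then have "((\<lambda>t. \<phi> (x + t *\<^sub>R axis i 1)) has_derivative
      (\<lambda>h. frechet_derivative \<phi> (at (x + t *\<^sub>R axis i 1)) (h *\<^sub>R axis i 1))) (at t within S)"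
    by (rule has_derivative_compose[rotated]) (auto intro!: derivative_eq_intros)
  then show ?thesis
    unfolding has_vector_derivative_def partial_deriv_def
    by (simp add: linear_cmul[OF linear_frechet_derivative[OF smooth_imp_differentiable[OF assms]]])
qed

text \<open>Difference quotients in direction \<open>i\<close> have integral 0 by translation
  invariance and converge to the derivative. Domination: the steps \<open>t n \<le> 1\<close> keep
  their supports in the ball of radius \<open>R + 1\<close>, and the mean value inequality bounds
  them by \<open>K\<close>.\<close>

lemma integral_partial_deriv_eq_0:
  fixes \<phi> :: "real^'n::finite \<Rightarrow> complex"
  assumes "\<phi> \<in> test_functions"
  shows "(LINT x|lborel. partial_deriv i \<phi> x) = 0"
proof -
  let ?e = "axis i 1 :: real^'n"
  define t :: "nat \<Rightarrow> real" where "t n = 1 / (real n + 1)" for n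
  have t: "0 < t n" "t n \<le> 1" for n by (auto simp: t_def)
  have t0: "t \<longlonglongrightarrow> 0" unfolding t_def using LIMSEQ_inverse_real_of_nat by (simp add: divide_inverse add.commute)
  obtain R where R: "0 < R" "\<And>x. R < norm x \<Longrightarrow> \<phi> x = 0"
    using assms by (rule test_functions_bounded_support) blast
  obtain K where K: "0 < K" "\<And>x. norm (partial_deriv i \<phi> x) \<le> K"
    using test_functions_partial_deriv[OF assms] by (rule test_functions_bounded) blast
  note sm = test_functions_smooth[OF assms]
  have [measurable]: "\<phi> \<in> borel_measurable borel" "partial_deriv i \<phi> \<in> borel_measurable borel"
    using sm by (auto intro!: borel_measurable_smooth smooth_partial_deriv)
  let ?q = "\<lambda>n x. (\<phi> (x + t n *\<^sub>R ?e) - \<phi> x) /\<^sub>R t n"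
  have "(\<lambda>n. LINT x|lborel. ?q n x) \<longlonglongrightarrow> (LINT x|lborel. partial_deriv i \<phi> x)"
  proof (rule integral_dominated_convergence[where w="\<lambda>x. indicator (cball 0 (R + 1)) x *\<^sub>R K"])
    show "integrable lborel (\<lambda>x::real^'n. indicator (cball 0 (R + 1)) x *\<^sub>R K)"
      by (rule borel_integrable_compact) auto
    show "AE x in lborel. (\<lambda>n. ?q n x) \<longlonglongrightarrow> partial_deriv i \<phi> x"
    proof (intro always_eventually allI)
      fix x
      have "(\<lambda>s. norm (\<phi> (x + s *\<^sub>R ?e) - \<phi> x - s *\<^sub>R partial_deriv i \<phi> x) / norm s) \<midarrow>0\<rightarrow> 0"
        using has_vector_derivative_along_axis[OF sm, of x i 0 UNIV]
        by (simp add: has_vector_derivative_def has_derivative_at)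
      then have "(\<lambda>s. norm ((\<phi> (x + s *\<^sub>R ?e) - \<phi> x) /\<^sub>R s - partial_deriv i \<phi> x)) \<midarrow>0\<rightarrow> 0"
      proof (rule tendsto_cong[THEN iffD1, rotated])
        have "norm (a - s *\<^sub>R v) / norm s = norm (a /\<^sub>R s - v)" if "s \<noteq> 0" for s :: real and a v :: complex
        proof -
          have "a /\<^sub>R s - v = (a - s *\<^sub>R v) /\<^sub>R s" using that by (simp add: scaleR_diff_right)
          then show ?thesis by (simp add: divide_inverse mult.commute)
        qed
        then show "\<forall>\<^sub>F s in at 0. norm (\<phi> (x + s *\<^sub>R ?e) - \<phi> x - s *\<^sub>R partial_deriv i \<phi> x) / norm s
            = norm ((\<phi> (x + s *\<^sub>R ?e) - \<phi> x) /\<^sub>R s - partial_deriv i \<phi> x)"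
          by (simp add: eventually_at_filter)
      qed
      then have "((\<lambda>s. (\<phi> (x + s *\<^sub>R ?e) - \<phi> x) /\<^sub>R s) \<longlongrightarrow> partial_deriv i \<phi> x) (at 0)"
        by (simp add: tendsto_norm_zero_iff LIM_zero_iff)
      then show "(\<lambda>n. ?q n x) \<longlonglongrightarrow> partial_deriv i \<phi> x"
        by (rule filterlim_compose) (use t t0 in \<open>auto simp: filterlim_at less_imp_neq[symmetric]\<close>)
    qed
    show "AE x in lborel. norm (?q n x) \<le> indicator (cball 0 (R + 1)) x *\<^sub>R K" for n
    proof (intro always_eventually allI)
      fix x
      show "norm (?q n x) \<le> indicator (cball 0 (R + 1)) x *\<^sub>R K"
      proof (cases "x \<in> cball 0 (R + 1)")
        case False
        then have "R + 1 < norm x" by simp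
        moreover have "norm x \<le> norm (x + t n *\<^sub>R ?e) + t n"
          using norm_triangle_ineq4[of "x + t n *\<^sub>R ?e" "t n *\<^sub>R ?e"] t[of n] by simp
        ultimately show ?thesis using t[of n] R by (auto simp: False)
      next
        case True
        have "norm (\<phi> (x + t n *\<^sub>R ?e) - \<phi> (x + 0 *\<^sub>R ?e)) \<le> K * norm (t n - 0)"
        proof (rule differentiable_bound[where S="{0..t n}" and f'="\<lambda>s h. h *\<^sub>R partial_deriv i \<phi> (x + s *\<^sub>R ?e)"])
          show "((\<lambda>s. \<phi> (x + s *\<^sub>R ?e)) has_derivative (\<lambda>h. h *\<^sub>R partial_deriv i \<phi> (x + s *\<^sub>R ?e))) (at s within {0..t n})" for s
            using has_vector_derivative_along_axis[OF sm] by (simp add: has_vector_derivative_def)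
          show "onorm (\<lambda>h. h *\<^sub>R partial_deriv i \<phi> (x + s *\<^sub>R ?e)) \<le> K" for s :: real
            using K by (intro onorm_bound) (auto simp: mult.commute[of K] intro!: mult_left_mono)
        qed (use t[of n] in auto)
        then show ?thesis using True t[of n] by (simp add: divide_simps mult.commute)
      qed
    qed
  qed auto
  moreover have "(LINT x|lborel. ?q n x) = 0" for n
  proof -
    have int: "integrable lborel \<phi>" using assms by (rule test_functions_integrable)
    have int2: "integrable lborel (\<lambda>x. \<phi> (x + t n *\<^sub>R ?e))"
      using test_functions_affine[OF assms, of 1 "t n *\<^sub>R ?e"] by (auto intro: test_functions_integrable)
    have "(LINT x|lborel. \<phi> (x + t n *\<^sub>R ?e)) = (LINT x|lborel. \<phi> x)"
      by (subst (2) lborel_distr_plus[symmetric, of "t n *\<^sub>R ?e"]) (simp add: integral_distr add.commute)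
    then show ?thesis using int int2 by simp
  qed
  ultimately have "(\<lambda>n. 0) \<longlonglongrightarrow> (LINT x|lborel. partial_deriv i \<phi> x)" by (simp only:)
  then show ?thesis by (simp add: LIMSEQ_const_iff)
qed

text \<open>Integration by parts: a test function times a character is again a test function, so the
  integral of its derivative vanishes.\<close>

lemma fourier_partial_deriv:
  assumes "\<phi> \<in> test_functions"
  shows "fourier (partial_deriv i \<phi>) \<xi> = 2 * complex_of_real pi * \<i> * of_real (\<xi> $ i) * fourier \<phi> \<xi>"
proof -
  let ?c = "2 * complex_of_real pi * \<i> * of_real (\<xi> $ i)"
  have "partial_deriv i (\<lambda>x. \<phi> x * character \<xi> x) = (\<lambda>x. partial_deriv i \<phi> x * character \<xi> x - ?c * (\<phi> x * character \<xi> x))"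
    using assms by (intro ext, subst partial_deriv_mult)
     (auto simp: partial_deriv_character intro!: smooth_imp_differentiable smooth_character test_functions_smooth)
  moreover have "(LINT x|lborel. partial_deriv i (\<lambda>x. \<phi> x * character \<xi> x) x) = 0"
    using assms by (intro integral_partial_deriv_eq_0 test_functions_mult smooth_character)
  ultimately have "0 = (LINT x|lborel. partial_deriv i \<phi> x * character \<xi> x) - ?c * (LINT x|lborel. \<phi> x * character \<xi> x)"
    using assms by (simp add: integrable_mult_character test_functions_integrable test_functions_partial_deriv)
  then show ?thesis by (simp add: fourier_character)
qed

text \<open>One power of \<open>1 + norm \<xi>\<close> is traded for one derivative of
  \<open>\<phi>\<close>: \<open>norm \<xi>\<close> is at most the sum of the
  \<open>\<bar>\<xi> $ i\<bar>\<close>, and each of these is absorbed by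
  \<open>fourier_partial_deriv\<close>. As derivatives of \<open>\<phi>\<close> appear, the
  induction keeps the test function arbitrary.\<close>

lemma fourier_decay:
  assumes "\<phi> \<in> test_functions"
  shows "\<exists>K. \<forall>\<xi>. (1 + norm \<xi>) ^ N * norm (fourier \<phi> \<xi>) \<le> K"
  using assms
proof (induction N arbitrary: \<phi>)
  case 0
  then show ?case using norm_fourier_le by auto
next
  case (Suc N)
  obtain K where K: "\<And>\<xi>. (1 + norm \<xi>) ^ N * norm (fourier \<phi> \<xi>) \<le> K"
    using Suc by blast
  have "\<forall>i. \<exists>K. \<forall>\<xi>. (1 + norm \<xi>) ^ N * norm (fourier (partial_deriv i \<phi>) \<xi>) \<le> K"
    using Suc test_functions_partial_deriv by blast
  then obtain L where L: "\<And>i \<xi>. (1 + norm \<xi>) ^ N * norm (fourier (partial_deriv i \<phi>) \<xi>) \<le> L i"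
    by metis
  have "(1 + norm \<xi>) ^ Suc N * norm (fourier \<phi> \<xi>) \<le> K + (\<Sum>i\<in>UNIV. L i)" for \<xi>
  proof -
    have *: "\<bar>\<xi> $ i\<bar> * norm (fourier \<phi> \<xi>) \<le> norm (fourier (partial_deriv i \<phi>) \<xi>)" for i
    proof -
      have "1 * (\<bar>\<xi> $ i\<bar> * norm (fourier \<phi> \<xi>)) \<le> (2 * pi) * (\<bar>\<xi> $ i\<bar> * norm (fourier \<phi> \<xi>))"
        using pi_ge_two by (intro mult_right_mono) auto
      then show ?thesis
        by (simp add: fourier_partial_deriv[OF Suc.prems] norm_mult mult_ac)
    qed
    have "(1 + norm \<xi>) ^ Suc N * norm (fourier \<phi> \<xi>)
       \<le> (1 + norm \<xi>) ^ N * ((1 + (\<Sum>i\<in>UNIV. \<bar>\<xi> $ i\<bar>)) * norm (fourier \<phi> \<xi>))"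
    proof -
      have "(1 + norm \<xi>) * norm (fourier \<phi> \<xi>) \<le> (1 + (\<Sum>i\<in>UNIV. \<bar>\<xi> $ i\<bar>)) * norm (fourier \<phi> \<xi>)"
        using norm_le_l1_cart[of \<xi>] by (intro mult_right_mono) auto
      then have "(1 + norm \<xi>) ^ N * ((1 + norm \<xi>) * norm (fourier \<phi> \<xi>))
         \<le> (1 + norm \<xi>) ^ N * ((1 + (\<Sum>i\<in>UNIV. \<bar>\<xi> $ i\<bar>)) * norm (fourier \<phi> \<xi>))"
        by (intro mult_left_mono) auto
      then show ?thesis by (simp only: power_Suc mult_ac)
    qed
    also have "\<dots> = (1 + norm \<xi>) ^ N * (norm (fourier \<phi> \<xi>) + (\<Sum>i\<in>UNIV. \<bar>\<xi> $ i\<bar> * norm (fourier \<phi> \<xi>)))"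
      by (simp add: distrib_right sum_distrib_right)
    also have "\<dots> \<le> (1 + norm \<xi>) ^ N * (norm (fourier \<phi> \<xi>) + (\<Sum>i\<in>UNIV. norm (fourier (partial_deriv i \<phi>) \<xi>)))"
      by (intro mult_left_mono add_left_mono sum_mono *) auto
    also have "\<dots> = (1 + norm \<xi>) ^ N * norm (fourier \<phi> \<xi>) +
       (\<Sum>i\<in>UNIV. (1 + norm \<xi>) ^ N * norm (fourier (partial_deriv i \<phi>) \<xi>))"
      by (simp add: distrib_left sum_distrib_left)
    also have "\<dots> \<le> K + (\<Sum>i\<in>UNIV. L i)"
      by (intro add_mono K sum_mono L)
    finally show ?thesis .
  qed
  then show ?case by blast
qed

lemma fourier_schwartz:
  assumes "\<phi> \<in> test_functions"
  shows "fourier \<phi> \<in> schwartz_space"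
  unfolding schwartz_space_iff
proof (intro conjI allI smooth_fourier[OF assms])
  fix N "is"
  obtain \<psi> where "\<psi> \<in> test_functions" "iter_partial is (fourier \<phi>) = fourier \<psi>"
    using iter_partial_fourier[OF assms] by blast
  then show "\<exists>K. \<forall>x. (1 + norm x) ^ N * norm (iter_partial is (fourier \<phi>) x) \<le> K"
    using fourier_decay by simp
qed

section \<open>Affine substitution in integrals and symmetries of the Fourier transform\<close>

lemma integral_lborel_affine:
  fixes g :: "'a::euclidean_space \<Rightarrow> complex"
  assumes [measurable]: "g \<in> borel_measurable borel" and a: "a \<noteq> 0"
  shows "(LINT x|lborel. g x) = of_real (\<bar>a\<bar> ^ DIM('a)) * (LINT x|lborel. g (t + a *\<^sub>R x))"
proof -
  have "(LINT x|lborel. g x) =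
      (LINT x|density (distr lborel borel (\<lambda>x. t + a *\<^sub>R x)) (\<lambda>_. ennreal (\<bar>a\<bar> ^ DIM('a))). g x)"
    by (subst lborel_affine[OF a, of t]) (simp add: ennreal_power)
  also have "\<dots> = of_real (\<bar>a\<bar> ^ DIM('a)) * (LINT x|lborel. g (t + a *\<^sub>R x))"
    by (subst integral_density) (auto simp: integral_distr scaleR_conv_of_real)
  finally show ?thesis .
qed

lemma nn_integral_lborel_affine:
  fixes g :: "'a::euclidean_space \<Rightarrow> ennreal"
  assumes [measurable]: "g \<in> borel_measurable borel" and a: "a \<noteq> 0"
  shows "(\<integral>\<^sup>+x. g x \<partial>lborel) = ennreal (\<bar>a\<bar> ^ DIM('a)) * (\<integral>\<^sup>+x. g (t + a *\<^sub>R x) \<partial>lborel)"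
proof -
  have "(\<integral>\<^sup>+x. g x \<partial>lborel) =
      (\<integral>\<^sup>+x. g x \<partial>density (distr lborel borel (\<lambda>x. t + a *\<^sub>R x)) (\<lambda>_. ennreal (\<bar>a\<bar> ^ DIM('a))))"
    by (subst lborel_affine[OF a, of t]) (simp add: ennreal_power)
  also have "\<dots> = ennreal (\<bar>a\<bar> ^ DIM('a)) * (\<integral>\<^sup>+x. g (t + a *\<^sub>R x) \<partial>lborel)"
    by (subst nn_integral_density) (auto simp: nn_integral_distr nn_integral_cmult)
  finally show ?thesis .
qed

lemma character_commute: "character \<xi> x = character x \<xi>"
  by (simp add: character_def inner_commute)

lemma fourier_dilation:
  fixes \<phi> :: "real^'n::finite \<Rightarrow> complex"
  assumes [measurable]: "\<phi> \<in> borel_measurable borel" and t: "0 < t"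
  shows "fourier (\<lambda>x. \<phi> ((1 / t) *\<^sub>R x)) \<xi> = of_real (t ^ CARD('n)) * fourier \<phi> (t *\<^sub>R \<xi>)"
proof -
  have "fourier (\<lambda>x. \<phi> ((1 / t) *\<^sub>R x)) \<xi> =
      of_real (\<bar>t\<bar> ^ DIM(real^'n)) * (LINT x|lborel. \<phi> ((1 / t) *\<^sub>R (0 + t *\<^sub>R x)) * character \<xi> (0 + t *\<^sub>R x))"
    unfolding fourier_character using t by (intro integral_lborel_affine) auto
  then show ?thesis using t by (simp add: fourier_character character_def)
qed

lemma fourier_modulation:
  "fourier (\<lambda>\<xi>. \<phi> \<xi> * character (- x) \<xi>) y = fourier \<phi> (y - x)"
  by (simp add: fourier_character mult.assoc character_add[symmetric])

lemma fourier_translation: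
  fixes \<phi> :: "real^'n::finite \<Rightarrow> complex"
  assumes [measurable]: "\<phi> \<in> borel_measurable borel"
  shows "fourier (\<lambda>x. \<phi> (x + b)) \<xi> = character (- b) \<xi> * fourier \<phi> \<xi>"
proof -
  have "fourier \<phi> \<xi> = of_real (\<bar>1\<bar> ^ DIM(real^'n)) *
      (LINT x|lborel. \<phi> (b + 1 *\<^sub>R x) * character \<xi> (b + 1 *\<^sub>R x))"
    unfolding fourier_character by (intro integral_lborel_affine) auto
  also have "\<dots> = character b \<xi> * fourier (\<lambda>x. \<phi> (x + b)) \<xi>"
  proof -
    have "\<phi> (b + 1 *\<^sub>R x) * character \<xi> (b + 1 *\<^sub>R x) = character b \<xi> * (\<phi> (x + b) * character \<xi> x)" for x
      by (simp add: character_commute[of \<xi>] character_add mult_ac add.commute)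
    then show ?thesis by (simp add: fourier_character)
  qed
  finally have "character (- b) \<xi> * fourier \<phi> \<xi> = character (- b) \<xi> * character b \<xi> * fourier (\<lambda>x. \<phi> (x + b)) \<xi>"
    by simp
  also have "character (- b) \<xi> * character b \<xi> = 1"
    by (subst character_add[symmetric]) (simp add: character_def)
  finally show ?thesis by simp
qed

lemma character_pair_measurable [measurable]:
  "(\<lambda>(x, \<xi>). character \<xi> x) \<in> borel_measurable (borel \<Otimes>\<^sub>M borel)"
  unfolding character_def by measurable

lemma fourier_multiplication:
  fixes f g :: "real^'n::finite \<Rightarrow> complex"
  assumes f: "integrable lborel f" and g: "integrable lborel g"
  shows "(LINT \<xi>|lborel. fourier f \<xi> * g \<xi>) = (LINT x|lborel. f x * fourier g x)"
proof -
  have [measurable]: "f \<in> borel_measurable borel" "g \<in> borel_measurable borel"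
    using f g by auto
  let ?h = "\<lambda>x \<xi>. f x * g \<xi> * character \<xi> x"
  have "integrable (lborel \<Otimes>\<^sub>M lborel) (case_prod ?h)"
  proof (rule lborel_pair.Fubini_integrable)
    show "case_prod ?h \<in> borel_measurable (lborel \<Otimes>\<^sub>M lborel)"
      using character_pair_measurable by (simp add: case_prod_unfold)
    show "integrable lborel (\<lambda>x. LINT \<xi>|lborel. norm (case (x, \<xi>) of (x, \<xi>) \<Rightarrow> ?h x \<xi>))"
      using f by (simp add: norm_mult)
    show "AE x in lborel. integrable lborel (\<lambda>\<xi>. case (x, \<xi>) of (x, \<xi>) \<Rightarrow> ?h x \<xi>)"
      using integrable_mult_character[OF g]
      by (auto simp: character_commute[of _ x for x] mult.assoc)
  qed
  from lborel_pair.Fubini_integral[OF this]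
  have "(LINT \<xi>|lborel. LINT x|lborel. ?h x \<xi>) = (LINT x|lborel. LINT \<xi>|lborel. ?h x \<xi>)" .
  moreover have "(LINT x|lborel. ?h x \<xi>) = fourier f \<xi> * g \<xi>" for \<xi>
  proof -
    have "(LINT x|lborel. ?h x \<xi>) = (LINT x|lborel. (f x * character \<xi> x) * g \<xi>)"
      by (intro Bochner_Integration.integral_cong) auto
    then show ?thesis by (simp add: fourier_character)
  qed
  moreover have "(LINT \<xi>|lborel. ?h x \<xi>) = f x * fourier g x" for x
    by (simp add: fourier_character mult.assoc character_commute[of _ x])
  ultimately show ?thesis by simp
qed

section \<open>Integrals of Fourier transforms\<close>

lemma integral_pos_of_continuous:
  fixes g :: "'a::euclidean_space \<Rightarrow> real"
  assumes int: "integrable lborel g" and nonneg: "\<And>x. 0 \<le> g x"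
    and cont: "continuous_on UNIV g" and pos: "0 < g z"
  shows "0 < (LINT x|lborel. g x)"
proof (rule ccontr)
  assume "\<not> 0 < (LINT x|lborel. g x)"
  then have "(LINT x|lborel. g x) = 0"
    using Bochner_Integration.integral_nonneg[of lborel g, OF nonneg] by linarith
  then have AE: "AE x in lborel. g x = 0"
    using int nonneg by (subst (asm) integral_nonneg_eq_0_iff_AE) auto
  have "open {x. 0 < g x}" using cont by (intro open_Collect_less) auto
  then obtain e where e: "0 < e" "ball z e \<subseteq> {x. 0 < g x}"
    using pos openE by blast
  have "AE x in lborel. x \<notin> ball z e"
    using AE by (rule AE_mp) (use e in \<open>auto intro!: always_eventually\<close>)
  then have "emeasure lborel (ball z e) = 0"
    by (subst (asm) AE_iff_measurable[of "ball z e"]) auto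
  then show False using e content_ball_pos[of e z]
    by (simp add: measure_def)
qed

lemma dilation_limit:
  fixes g H :: "real^'n::finite \<Rightarrow> complex"
  assumes g: "g \<in> test_functions" and H: "integrable lborel H" and c: "c \<longlonglongrightarrow> 0"
  shows "(\<lambda>n. LINT u|lborel. g (c n *\<^sub>R u) * H u) \<longlonglongrightarrow> g 0 * (LINT u|lborel. H u)"
proof -
  have [measurable]: "g \<in> borel_measurable borel" "H \<in> borel_measurable borel"
    using g H by (auto intro: borel_measurable_smooth test_functions_smooth)
  obtain K where K: "0 < K" "\<And>x. norm (g x) \<le> K"
    using g by (rule test_functions_bounded) blast
  have "(\<lambda>n. LINT u|lborel. g (c n *\<^sub>R u) * H u) \<longlonglongrightarrow> (LINT u|lborel. g 0 * H u)"
  proof (rule integral_dominated_convergence[where w="\<lambda>u. K * norm (H u)"])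
    show "AE u in lborel. (\<lambda>n. g (c n *\<^sub>R u) * H u) \<longlonglongrightarrow> g 0 * H u"
    proof (intro always_eventually allI)
      fix u :: "real^'n"
      have "isCont g 0"
        using smooth_imp_continuous_on[OF test_functions_smooth[OF g], of UNIV]
        by (simp add: continuous_on_eq_continuous_at)
      moreover have "(\<lambda>n. c n *\<^sub>R u) \<longlonglongrightarrow> 0"
        using tendsto_scaleR[OF c tendsto_const[of u]] by simp
      ultimately have "(\<lambda>n. g (c n *\<^sub>R u)) \<longlonglongrightarrow> g 0" by (rule isCont_tendsto_compose)
      then show "(\<lambda>n. g (c n *\<^sub>R u) * H u) \<longlonglongrightarrow> g 0 * H u" by (intro tendsto_intros)
    qed
    show "AE u in lborel. norm (g (c n *\<^sub>R u) * H u) \<le> K * norm (H u)" for n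
      using K by (auto simp: norm_mult intro!: always_eventually mult_right_mono)
  qed (use H in auto)
  then show ?thesis by simp
qed

text \<open>Suppose all these integrals vanish, in particular for the translates of a bump
  \<open>\<psi>\<close>. Translation multiplies \<open>fourier \<psi>\<close> by a character, so the
  Fourier transform of \<open>g\<close>, the conjugate of \<open>fourier \<psi>\<close>, is
  identically 0. The multiplication formula then gives \<open>fourier \<psi>\<close> square integral
  0, although it is continuous and its value at 0 is the positive integral of the bump.\<close>

lemma exists_test_function_fourier_integral_nonzero:
  "\<exists>\<phi>\<in>test_functions. (LINT \<xi>|lborel. fourier (\<phi> :: real^'n::finite \<Rightarrow> complex) \<xi>) \<noteq> 0"
proof (rule ccontr)
  assume "\<not> ?thesis"
  then have zero: "(LINT \<xi>|lborel. fourier \<phi> \<xi>) = 0" if "\<phi> \<in> test_functions" for \<phi> :: "real^'n \<Rightarrow> complex"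
    using that by blast
  define \<psi> :: "real^'n \<Rightarrow> complex" where "\<psi> = (\<lambda>x. complex_of_real (bump 1 x))"
  have \<psi>: "\<psi> \<in> test_functions" unfolding \<psi>_def by (rule bump_test_function)
  have [measurable]: "\<psi> \<in> borel_measurable borel"
    using \<psi> by (intro borel_measurable_smooth test_functions_smooth)
  define g where "g = (\<lambda>\<xi>. cnj (fourier \<psi> \<xi>))"
  have F: "integrable lborel (fourier \<psi>)"
    by (intro schwartz_integrable fourier_schwartz \<psi>)
  have g: "integrable lborel g" unfolding g_def using F by simp
  have "fourier g \<xi> = 0" for \<xi>
  proof -
    have "fourier g \<xi> = (LINT y|lborel. cnj (fourier \<psi> y * character (- \<xi>) y))"
      unfolding fourier_character[of g]
      by (intro Bochner_Integration.integral_cong) (auto simp: g_def character_eq_cis cis_cnj)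
    also have "\<dots> = cnj (LINT y|lborel. fourier (\<lambda>x. \<psi> (x + \<xi>)) y)"
      by (subst fourier_translation) (auto simp: mult.commute simp del: complex_cnj_mult simp flip: Bochner_Integration.integral_cnj)
    also have "\<dots> = 0"
      using test_functions_affine[OF \<psi>, of 1 \<xi>] by (simp add: zero)
    finally show ?thesis .
  qed
  then have "(LINT \<xi>|lborel. fourier \<psi> \<xi> * g \<xi>) = 0"
    by (subst fourier_multiplication) (auto intro: g test_functions_integrable \<psi>)
  moreover have "(LINT \<xi>|lborel. fourier \<psi> \<xi> * g \<xi>) = of_real (LINT \<xi>|lborel. (norm (fourier \<psi> \<xi>))\<^sup>2)"
    unfolding integral_complex_of_real[symmetric] by (simp add: g_def complex_norm_square[symmetric])
  ultimately have 0: "(LINT \<xi>|lborel. (norm (fourier \<psi> \<xi>))\<^sup>2) = 0" by simp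
  have cont: "continuous_on UNIV (fourier \<psi>)"
    by (intro smooth_imp_continuous_on smooth_fourier \<psi>)
  have "0 < (LINT x|lborel. bump 1 (x::real^'n))"
  proof (rule integral_pos_of_continuous[where z=0])
    have "integrable lborel (\<lambda>x. Re (\<psi> x))" by (intro integrable_Re test_functions_integrable \<psi>)
    then show "integrable lborel (\<lambda>x::real^'n. bump 1 x)" by (simp add: \<psi>_def)
    have "continuous_on UNIV (\<lambda>x. Re (\<psi> x))"
      by (intro continuous_intros smooth_imp_continuous_on test_functions_smooth \<psi>)
    then show "continuous_on UNIV (\<lambda>x::real^'n. bump 1 x)" by (simp add: \<psi>_def)
  qed (auto simp: bump_nonneg bump_eq_1)
  moreover have "fourier \<psi> 0 = of_real (LINT x|lborel. bump 1 (x::real^'n))"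
    by (simp add: fourier_character character_def \<psi>_def)
  ultimately have "0 < (norm (fourier \<psi> 0))\<^sup>2" by simp
  moreover have "integrable lborel (\<lambda>\<xi>. (norm (fourier \<psi> \<xi>))\<^sup>2)"
  proof (rule Bochner_Integration.integrable_bound)
    show "integrable lborel (\<lambda>\<xi>. (LINT x|lborel. norm (\<psi> x)) * norm (fourier \<psi> \<xi>))"
      using F by simp
    show "AE \<xi> in lborel. norm ((norm (fourier \<psi> \<xi>))\<^sup>2) \<le> norm ((LINT x|lborel. norm (\<psi> x)) * norm (fourier \<psi> \<xi>))"
      using norm_fourier_le[of \<psi>]
      by (auto simp: power2_eq_square abs_mult intro!: always_eventually mult_right_mono order_trans[OF _ abs_ge_self])
  qed (use F in auto)
  ultimately have "0 < (LINT \<xi>|lborel. (norm (fourier \<psi> \<xi>))\<^sup>2)"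
    using cont by (intro integral_pos_of_continuous[where z=0]) (auto intro!: continuous_intros)
  with 0 show False by simp
qed

text \<open>This replaces Fourier inversion: by duality and dilation,
  \<open>\<phi> 0 * \<integral>fourier \<kappa> = \<kappa> 0 * \<integral>fourier \<phi>\<close> for all test functions.\<close>
lemma fourier_integral_nonzero:
  fixes \<kappa> :: "real^'n::finite \<Rightarrow> complex"
  assumes \<kappa>: "\<kappa> \<in> test_functions" and "\<kappa> 0 \<noteq> 0"
  shows "(LINT \<xi>|lborel. fourier \<kappa> \<xi>) \<noteq> 0"
proof -
  obtain \<phi> :: "real^'n \<Rightarrow> complex"
    where \<phi>: "\<phi> \<in> test_functions" and nz: "(LINT \<xi>|lborel. fourier \<phi> \<xi>) \<noteq> 0"
    using exists_test_function_fourier_integral_nonzero by blast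
  have [measurable]: "\<kappa> \<in> borel_measurable borel" "\<phi> \<in> borel_measurable borel"
    using \<kappa> \<phi> by (auto intro: borel_measurable_smooth test_functions_smooth)
  have F: "integrable lborel (fourier \<kappa>)" "integrable lborel (fourier \<phi>)"
    using \<kappa> \<phi> by (auto intro: schwartz_integrable fourier_schwartz)
  have [measurable]: "fourier \<phi> \<in> borel_measurable borel" using F by auto
  define t :: "nat \<Rightarrow> real" where "t n = real n + 1" for n
  have t: "0 < t n" for n by (simp add: t_def)
  have c: "(\<lambda>n. 1 / t n) \<longlonglongrightarrow> 0"
    unfolding t_def using LIMSEQ_inverse_real_of_nat by (simp add: divide_inverse add.commute)
  have "(LINT u|lborel. \<phi> ((1 / t n) *\<^sub>R u) * fourier \<kappa> u) = (LINT u|lborel. \<kappa> ((1 / t n) *\<^sub>R u) * fourier \<phi> u)" for n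
  proof -
    have i: "integrable lborel (\<lambda>u. \<phi> ((1 / t n) *\<^sub>R u))"
      using test_functions_affine[OF \<phi>, of "1 / t n" 0] t[of n] by (auto intro: test_functions_integrable)
    have "(LINT u|lborel. \<phi> ((1 / t n) *\<^sub>R u) * fourier \<kappa> u)
       = (LINT u|lborel. fourier \<kappa> u * \<phi> ((1 / t n) *\<^sub>R u))" by (simp add: mult.commute)
    also have "\<dots> = (LINT u|lborel. \<kappa> u * fourier (\<lambda>u. \<phi> ((1 / t n) *\<^sub>R u)) u)"
      by (rule fourier_multiplication[OF test_functions_integrable[OF \<kappa>] i])
    also have "\<dots> = of_real (t n ^ CARD('n)) * (LINT u|lborel. \<kappa> u * fourier \<phi> (t n *\<^sub>R u))"
    proof -
      have "\<kappa> u * fourier (\<lambda>u. \<phi> ((1 / t n) *\<^sub>R u)) u = of_real (t n ^ CARD('n)) * (\<kappa> u * fourier \<phi> (t n *\<^sub>R u))" for u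
        using t[of n] by (subst fourier_dilation) auto
      then have "(LINT u|lborel. \<kappa> u * fourier (\<lambda>u. \<phi> ((1 / t n) *\<^sub>R u)) u)
         = (LINT u|lborel. of_real (t n ^ CARD('n)) * (\<kappa> u * fourier \<phi> (t n *\<^sub>R u)))" by (simp only:)
      then show ?thesis by simp
    qed
    also have "(LINT u|lborel. \<kappa> u * fourier \<phi> (t n *\<^sub>R u)) =
        of_real (\<bar>1 / t n\<bar> ^ DIM(real^'n)) * (LINT u|lborel. \<kappa> (0 + (1 / t n) *\<^sub>R u) * fourier \<phi> (t n *\<^sub>R (0 + (1 / t n) *\<^sub>R u)))"
      using t[of n] by (intro integral_lborel_affine) auto
    finally show ?thesis using t[of n] by (simp add: power_divide)
  qed
  then have "\<phi> 0 * (LINT u|lborel. fourier \<kappa> u) = \<kappa> 0 * (LINT u|lborel. fourier \<phi> u)"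
    using dilation_limit[OF \<phi> F(1) c] dilation_limit[OF \<kappa> F(2) c] by (auto intro: LIMSEQ_unique)
  then show ?thesis using nz assms(2) by auto
qed

section \<open>The reproducing formula\<close>

lemma schwartz_space_add:
  assumes "\<phi> \<in> schwartz_space" "\<psi> \<in> schwartz_space"
  shows "(\<lambda>x. \<phi> x + \<psi> x) \<in> schwartz_space"
  unfolding schwartz_space_iff
proof (intro conjI allI)
  have sm: "smooth \<phi>" "smooth \<psi>" using assms by (auto simp: schwartz_space_iff)
  then show "smooth (\<lambda>x. \<phi> x + \<psi> x)" by (rule smooth_add)
  fix N "is"
  obtain K L where "\<And>x. (1 + norm x) ^ N * norm (iter_partial is \<phi> x) \<le> K"
    and "\<And>x. (1 + norm x) ^ N * norm (iter_partial is \<psi> x) \<le> L"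
    using assms unfolding schwartz_space_iff by meson
  then have "(1 + norm x) ^ N * norm (iter_partial is (\<lambda>x. \<phi> x + \<psi> x) x) \<le> K + L" for x
    unfolding iter_partial_add[OF sm]
    by (intro order_trans[OF mult_left_mono[OF norm_triangle_ineq]])
      (auto simp: distrib_left intro: add_mono)
  then show "\<exists>K. \<forall>x. (1 + norm x) ^ N * norm (iter_partial is (\<lambda>x. \<phi> x + \<psi> x) x) \<le> K" by blast
qed

text \<open>Continuity in a form that asks for one pointwise bound \<open>K\<close> on all
  derivatives up to order \<open>N\<close>: each supremum in the seminorm is at most
  \<open>K\<close>, and the number of index lists goes into \<open>B\<close>.\<close>

lemma tempered_distribution_bound:
  fixes T :: "(real^'n::finite \<Rightarrow> complex) \<Rightarrow> complex"
  assumes "tempered_distribution T"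
  obtains B N where "0 \<le> B"
    and "\<And>\<phi> K. \<phi> \<in> schwartz_space \<Longrightarrow>
       (\<And>is x. length is \<le> N \<Longrightarrow> (1 + norm x) ^ N * norm (iter_partial is \<phi> x) \<le> K) \<Longrightarrow> norm (T \<phi>) \<le> B * K"
proof -
  obtain B N where BN: "\<And>\<phi>. \<phi> \<in> schwartz_space \<Longrightarrow> norm (T \<phi>) \<le> B * schwartz_seminorm N \<phi>"
    using assms unfolding tempered_distribution_def by blast
  let ?L = "{is :: 'n list. length is \<le> N}"
  have "norm (T \<phi>) \<le> \<bar>B\<bar> * real (card ?L) * K"
    if \<phi>: "\<phi> \<in> schwartz_space"
      and K: "\<And>is x. length is \<le> N \<Longrightarrow> (1 + norm x) ^ N * norm (iter_partial is \<phi> x) \<le> K" for \<phi> K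
  proof -
    have "\<bar>SUP x. (1 + norm x) ^ N * norm (iter_partial is \<phi> x)\<bar> \<le> K" if "is \<in> ?L" for "is"
      using K that by (intro cSup_abs_le) (auto simp: abs_mult)
    then have "\<bar>schwartz_seminorm N \<phi>\<bar> \<le> (\<Sum>is\<in>?L. K)"
      unfolding schwartz_seminorm_def by (intro order_trans[OF sum_abs] sum_mono)
    then have "\<bar>B\<bar> * \<bar>schwartz_seminorm N \<phi>\<bar> \<le> \<bar>B\<bar> * (real (card ?L) * K)"
      by (intro mult_left_mono) auto
    moreover have "norm (T \<phi>) \<le> \<bar>B * schwartz_seminorm N \<phi>\<bar>"
      using BN[OF \<phi>] by linarith
    ultimately show ?thesis by (simp add: abs_mult mult.assoc)
  qed
  then show thesis by (intro that[of "\<bar>B\<bar> * real (card ?L)" N]) auto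
qed

lemma weight_shift:
  fixes x y :: "'a::real_normed_vector"
  shows "1 + norm y \<le> (1 + norm x) * (1 + norm (y - x))"
proof -
  have "norm y \<le> norm x + norm (y - x)" using norm_triangle_sub[of y x] by simp
  moreover have "0 \<le> norm x * norm (y - x)" by simp
  ultimately show ?thesis by (simp add: algebra_simps del: mult_nonneg_nonneg zero_le_mult_iff)
qed

lemma schwartz_uniform_bound:
  fixes \<phi> :: "real^'n::finite \<Rightarrow> complex"
  assumes "\<phi> \<in> schwartz_space"
  obtains K where "0 \<le> K"
    and "\<And>is x. length is \<le> N \<Longrightarrow> (1 + norm x) ^ M * norm (iter_partial is \<phi> x) \<le> K"
proof -
  have "\<forall>is. \<exists>K. \<forall>x. (1 + norm x) ^ M * norm (iter_partial is \<phi> x) \<le> K"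
    using assms by (simp add: schwartz_space_iff)
  then obtain k where k: "\<And>is x. (1 + norm x) ^ M * norm (iter_partial is \<phi> x) \<le> k is"
    by metis
  let ?L = "{is :: 'n list. length is \<le> N}"
  have fin: "finite ?L" using finite_lists_length_le[of "UNIV :: 'n set" N] by simp
  have k0: "0 \<le> k is" for "is"
    using k[of 0 "is"] by (rule order_trans[rotated]) auto
  have "(1 + norm x) ^ M * norm (iter_partial is \<phi> x) \<le> (\<Sum>is\<in>?L. k is)" if "length is \<le> N" for "is" x
    using that fin k0 by (intro order_trans[OF k] member_le_sum) auto
  then show thesis using k0 by (intro that[of "\<Sum>is\<in>?L. k is"] sum_nonneg)
qed

lemma iter_partial_cmult:
  assumes "smooth f"
  shows "iter_partial is (\<lambda>x. c * f x) = (\<lambda>x. c * iter_partial is f x)"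
proof (induction "is")
  case (Cons i "is")
  show ?case unfolding iter_partial_Cons Cons
    using partial_deriv_affine[of "iter_partial is f" i c 1 0]
      smooth_imp_differentiable[OF smooth_iter_partial[OF assms]] by auto
qed simp

lemma norm_iter_partial_const_le: "norm (iter_partial is (\<lambda>x. c) x) \<le> norm c"
proof (cases "is" rule: rev_cases)
  case (snoc js i)
  have "iter_partial js (\<lambda>x. 0) = (\<lambda>x. 0)"
    by (induction js) (simp_all add: partial_deriv_const)
  then show ?thesis by (simp add: snoc iter_partial_snoc partial_deriv_const)
qed simp

text \<open>As a function of \<open>y\<close>, the dilate of \<open>H\<close> around
  \<open>x\<close>, normalised to keep its integral. For \<open>H = fourier \<kappa>\<close> it is
  the Fourier transform of \<open>\<kappa> ((1 / t) *\<^sub>R \<xi>)\<close> times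
  \<open>character (- x) \<xi>\<close>.\<close>

definition dilated_kernel :: "(real^'n::finite \<Rightarrow> complex) \<Rightarrow> real \<Rightarrow> real^'n \<Rightarrow> real^'n \<Rightarrow> complex" where
  "dilated_kernel H t x y = of_real (t ^ CARD('n)) * H (t *\<^sub>R (y - x))"

lemma dilated_kernel_fourier:
  fixes \<kappa> :: "real^'n::finite \<Rightarrow> complex"
  assumes "\<kappa> \<in> test_functions" "0 < t"
  shows "dilated_kernel (fourier \<kappa>) t x = fourier (\<lambda>\<xi>. \<kappa> ((1 / t) *\<^sub>R \<xi>) * character (- x) \<xi>)"
  using assms
  by (intro ext) (subst fourier_modulation,
    simp add: fourier_dilation dilated_kernel_def borel_measurable_smooth test_functions_smooth)

lemma dilated_test_function:
  assumes "\<kappa> \<in> test_functions" "0 < t"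
  shows "(\<lambda>\<xi>. \<kappa> ((1 / t) *\<^sub>R \<xi>) * character (- x) \<xi>) \<in> test_functions"
  using test_functions_affine[OF assms(1), of "1 / t" 0] assms(2)
  by (intro test_functions_mult smooth_character) auto

lemma dilated_kernel_schwartz:
  assumes "\<kappa> \<in> test_functions" "0 < t"
  shows "dilated_kernel (fourier \<kappa>) t x \<in> schwartz_space"
  unfolding dilated_kernel_fourier[OF assms]
  by (intro fourier_schwartz dilated_test_function assms)

lemma tempered_distribution_add:
  "tempered_distribution T \<Longrightarrow> \<phi> \<in> schwartz_space \<Longrightarrow> \<psi> \<in> schwartz_space \<Longrightarrow>
    T (\<lambda>x. \<phi> x + \<psi> x) = T \<phi> + T \<psi>"
  by (simp add: tempered_distribution_def)

text \<open>The two kernels differ by the Fourier transform of \<open>d\<close>, a difference of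
  dilates of \<open>\<kappa>\<close> times a common character. Both dilates equal 1 where
  \<open>norm \<xi> < 3 * A * s\<close>, so \<open>d\<close> vanishes there. The margin between the
  factors 3 and 2 keeps the closed set \<open>fun_support d\<close> disjoint from the
  spectrum.\<close>

lemma distribution_dilated_kernel_eq:
  fixes T :: "(real^'n::finite \<Rightarrow> complex) \<Rightarrow> complex"
  assumes T: "tempered_distribution T"
    and supp: "supported_in (dist_fourier T) {\<xi>. norm \<xi> \<le> 2 * (A * s)}"
    and \<kappa>: "\<kappa> \<in> test_functions" and \<kappa>1: "\<And>\<xi>. norm \<xi> \<le> 3 * A \<Longrightarrow> \<kappa> \<xi> = 1"
    and A: "0 < A" and s: "0 < s" "s \<le> t"
  shows "T (dilated_kernel (fourier \<kappa>) t x) = T (dilated_kernel (fourier \<kappa>) s x)"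
proof -
  have t: "0 < t" using s by simp
  define g where "g r = (\<lambda>\<xi>. \<kappa> ((1 / r) *\<^sub>R \<xi>) * character (- x) \<xi>)" for r
  have g: "g t \<in> test_functions" "g s \<in> test_functions"
    unfolding g_def using dilated_test_function[OF \<kappa>] t s by auto
  define d where "d = (\<lambda>\<xi>. g t \<xi> - g s \<xi>)"
  have d: "d \<in> test_functions" unfolding d_def using g by (rule test_functions_diff)
  have "{\<xi>. d \<xi> \<noteq> 0} \<subseteq> {\<xi>. 3 * A * s \<le> norm \<xi>}"
  proof clarify
    fix \<xi> assume nz: "d \<xi> \<noteq> 0"
    show "3 * A * s \<le> norm \<xi>"
    proof (rule ccontr)
      assume *: "\<not> 3 * A * s \<le> norm \<xi>"
      then have "norm ((1 / s) *\<^sub>R \<xi>) \<le> 3 * A" using s by (simp add: field_simps)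
      moreover have "3 * A * s \<le> 3 * A * t" using A s by (intro mult_left_mono) auto
      then have "norm ((1 / t) *\<^sub>R \<xi>) \<le> 3 * A" using * t by (simp add: field_simps)
      ultimately show False using nz \<kappa>1 by (simp add: d_def g_def)
    qed
  qed
  then have "fun_support d \<subseteq> {\<xi>. 3 * A * s \<le> norm \<xi>}"
    unfolding fun_support_def
    by (intro closure_minimal closed_Collect_le continuous_intros)
  moreover have "2 * (A * s) < 3 * A * s" using A s by simp
  ultimately have "fun_support d \<inter> {\<xi>. norm \<xi> \<le> 2 * (A * s)} = {}" by fastforce
  then have "T (fourier d) = 0"
    using supp d unfolding supported_in_def dist_fourier_def by blast
  moreover have "fourier (g t) = (\<lambda>y. fourier (g s) y + fourier d y)"
    unfolding fourier_character d_def
    using g by (intro ext) (simp add: left_diff_distrib integrable_mult_character test_functions_integrable)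
  then have "T (fourier (g t)) = T (fourier (g s)) + T (fourier d)"
    using T g d by (simp add: tempered_distribution_add fourier_schwartz)
  ultimately show ?thesis
    using dilated_kernel_fourier[OF \<kappa>] t s by (simp add: g_def)
qed

lemma smooth_dilated_kernel: "smooth H \<Longrightarrow> smooth (dilated_kernel H t x)"
  using smooth_affine[of H t "- (t *\<^sub>R x)"]
  unfolding dilated_kernel_def[abs_def]
  by (intro smooth_mult smooth_const) (simp add: scaleR_diff_right)

lemma iter_partial_dilated_kernel:
  assumes "smooth (H :: real^'n::finite \<Rightarrow> complex)"
  shows "iter_partial is (dilated_kernel H t x) y =
    of_real (t ^ CARD('n)) * (of_real t ^ length is * iter_partial is H (t *\<^sub>R (y - x)))"
proof -
  have eq: "dilated_kernel H t x = (\<lambda>y. of_real (t ^ CARD('n)) * H (t *\<^sub>R y + (- (t *\<^sub>R x))))"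
    by (simp add: dilated_kernel_def[abs_def] scaleR_diff_right)
  show ?thesis
    unfolding eq iter_partial_cmult[OF smooth_affine[OF assms]] iter_partial_affine[OF assms]
    by (simp add: scaleR_diff_right)
qed

definition cutoff :: "real^'n::finite \<Rightarrow> complex" where
  "cutoff v = of_real (bump 1 v)"

lemma cutoff_test_function: "cutoff \<in> test_functions"
  unfolding cutoff_def[abs_def] by (rule bump_test_function)

lemma cutoff_eq_1: "norm v \<le> 1 \<Longrightarrow> cutoff v = 1"
  by (simp add: cutoff_def bump_eq_1)

text \<open>The factor \<open>1 - cutoff (y - x)\<close> vanishes on the unit ball around
  \<open>x\<close>. Outside it, dilation costs at most \<open>t ^ (d + N)\<close> in the
  derivatives, while the decay of \<open>H\<close> in \<open>t * norm (y - x)\<close> has any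
  prescribed order.\<close>

lemma distribution_far_part_bound:
  fixes T :: "(real^'n::finite \<Rightarrow> complex) \<Rightarrow> complex"
  assumes T: "tempered_distribution T" and H: "H \<in> schwartz_space"
    and S: "\<And>t. 1 \<le> t \<Longrightarrow> (\<lambda>y. dilated_kernel H t x y * (1 - cutoff (y - x))) \<in> schwartz_space"
  shows "\<exists>C. \<forall>t\<ge>1. norm (T (\<lambda>y. dilated_kernel H t x y * (1 - cutoff (y - x)))) \<le> C / t"
proof -
  obtain B N where B: "0 \<le> B"
    and TB: "\<And>\<phi> K. \<phi> \<in> schwartz_space \<Longrightarrow>
       (\<And>is x. length is \<le> N \<Longrightarrow> (1 + norm x) ^ N * norm (iter_partial is \<phi> x) \<le> K) \<Longrightarrow> norm (T \<phi>) \<le> B * K"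
    using T by (rule tempered_distribution_bound) blast
  have smH: "smooth H" using H by (simp add: schwartz_space_iff)
  let ?d = "CARD('n)"
  \<comment> \<open>\<open>N\<close> powers absorb the weight, \<open>d + N\<close> the factors of
    \<open>t\<close> from normalisation and differentiation, and the last one leaves
    \<open>1 / t\<close>.\<close>
  define L where "L = N + (?d + N) + 1"
  obtain K where K: "0 \<le> K" "\<And>is u. length is \<le> N \<Longrightarrow> (1 + norm u) ^ L * norm (iter_partial is H u) \<le> K"
    using H by (rule schwartz_uniform_bound) blast
  define g where "g = (\<lambda>y::real^'n. 1 - cutoff (y - x))"
  have m: "(\<lambda>y. (-1) * cutoff (1 *\<^sub>R y + (- x))) \<in> test_functions"
    by (intro test_functions_cmult test_functions_affine cutoff_test_function) auto
  have g_eq: "g = (\<lambda>y. 1 + (-1) * cutoff (1 *\<^sub>R y + (- x)))" by (simp add: g_def)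
  have smg: "smooth g" unfolding g_eq by (intro smooth_add smooth_const test_functions_smooth m)
  obtain b' where b': "0 \<le> b'"
    "\<And>is y. length is \<le> N \<Longrightarrow> (1 + norm y) ^ 0 * norm (iter_partial is (\<lambda>y. (-1) * cutoff (1 *\<^sub>R y + (- x))) y) \<le> b'"
    using test_functions_schwartz[OF m] by (rule schwartz_uniform_bound) blast
  define b where "b = 1 + b'"
  have b: "norm (iter_partial is g y) \<le> b" if "length is \<le> N" for "is" y
    unfolding g_eq iter_partial_add[OF smooth_const test_functions_smooth[OF m]] b_def
    using norm_iter_partial_const_le[of "is" 1 y] b'(2)[OF that, of y]
    by (intro norm_triangle_mono) auto
  have b0: "0 \<le> b" using b' by (simp add: b_def)
  define C where "C = (1 + norm x) ^ N * 2 ^ N * K * b"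
  have C0: "0 \<le> C" using K b0 by (simp add: C_def)
  have "norm (T (\<lambda>y. dilated_kernel H t x y * g y)) \<le> B * (C / t)" if t: "1 \<le> t" for t
  proof (rule TB)
    show "(\<lambda>y. dilated_kernel H t x y * g y) \<in> schwartz_space"
      using S[OF t] by (simp add: g_def)
    fix "is" :: "'n list" and y :: "real^'n" assume len: "length is \<le> N"
    define s where "s = norm (y - x)"
    show "(1 + norm y) ^ N * norm (iter_partial is (\<lambda>y. dilated_kernel H t x y * g y) y) \<le> C / t"
    proof (cases "s < 1")
      case True
      have "iter_partial is (\<lambda>y. dilated_kernel H t x y * g y) y = 0"
      proof (rule iter_partial_eq_zero_on_open)
        show "open (ball x 1)" by simp
        show "dilated_kernel H t x z * g z = 0" if "z \<in> ball x 1" for z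
          using that cutoff_eq_1[of "z - x"] by (simp add: g_def dist_norm norm_minus_commute)
        show "y \<in> ball x 1" using True by (simp add: s_def dist_norm norm_minus_commute)
      qed
      then show ?thesis using C0 t by simp
    next
      case False
      then have s: "1 \<le> s" by simp
      \<comment> \<open>As \<open>s\<close> and \<open>t\<close> are at least 1, \<open>w\<close>
        dominates both \<open>1 + s\<close> and \<open>t\<close>, so a single quantity carries the
        weight, the dilation and the decay.\<close>
      define w where "w = 1 + t * s"
      have "s \<le> t * s" "t \<le> t * s" using s t by auto
      then have w: "1 \<le> w" "1 + s \<le> w" "t \<le> w"
        using s t unfolding w_def by linarith+
      have ker: "norm (iter_partial js (dilated_kernel H t x) y) \<le> t ^ (?d + N) * (K / w ^ L)"
        if "length js \<le> N" for js
      proof -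
        have nw: "1 + norm (t *\<^sub>R (y - x)) = w" using t by (simp add: w_def s_def)
        have "norm (iter_partial js H (t *\<^sub>R (y - x))) \<le> K / w ^ L"
          using K(2)[OF that, of "t *\<^sub>R (y - x)"] w unfolding nw by (simp add: field_simps)
        moreover have "t ^ ?d * t ^ length js \<le> t ^ (?d + N)"
          unfolding power_add[symmetric] using t that by (intro power_increasing) auto
        ultimately have "t ^ ?d * t ^ length js * norm (iter_partial js H (t *\<^sub>R (y - x))) \<le> t ^ (?d + N) * (K / w ^ L)"
          using t by (intro mult_mono) auto
        then show ?thesis
          unfolding iter_partial_dilated_kernel[OF smH] using t
          by (simp add: norm_mult norm_power mult.assoc)
      qed
      have "norm (iter_partial is (\<lambda>y. dilated_kernel H t x y * g y) y) \<le> 2 ^ N * (t ^ (?d + N) * (K / w ^ L)) * b"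
        by (intro iter_partial_mult_bound smooth_dilated_kernel smH smg len ker b)
      moreover have "(1 + norm y) ^ N \<le> ((1 + norm x) * w) ^ N"
      proof (intro power_mono)
        have "1 + norm y \<le> (1 + norm x) * (1 + s)" unfolding s_def by (rule weight_shift)
        also have "\<dots> \<le> (1 + norm x) * w" using w by (intro mult_left_mono) auto
        finally show "1 + norm y \<le> (1 + norm x) * w" .
      qed auto
      ultimately have "(1 + norm y) ^ N * norm (iter_partial is (\<lambda>y. dilated_kernel H t x y * g y) y)
         \<le> ((1 + norm x) * w) ^ N * (2 ^ N * (t ^ (?d + N) * (K / w ^ L)) * b)"
        using w by (intro mult_mono) auto
      also have "\<dots> \<le> ((1 + norm x) * w) ^ N * (2 ^ N * (w ^ (?d + N) * (K / w ^ L)) * b)"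
        using w t K b0 by (intro mult_left_mono mult_right_mono power_mono) auto
      also have "\<dots> = C / w"
        using w unfolding C_def L_def power_mult_distrib power_add by (simp add: divide_simps mult_ac)
      also have "\<dots> \<le> C / t" using C0 w t by (intro divide_left_mono) auto
      finally show ?thesis .
    qed
  qed
  then show ?thesis by (intro exI[of _ "B * C"]) (auto simp: g_def)
qed

text \<open>The kernel is split by the cutoff around \<open>x\<close>. Near \<open>x\<close> the
  pairing is an integral against \<open>f\<close> cut off to the test function \<open>G\<close>,
  which is bounded, so dominated convergence applies; the far part is of order \<open>1 / t\<close>
  by continuity of \<open>T\<close>.\<close>

lemma distribution_dilated_kernel_limit:
  fixes f :: "real^'n::finite \<Rightarrow> complex"
  assumes T: "tempered_distribution T" and rep: "represented_by T f" and f: "smooth f"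
    and \<kappa>: "\<kappa> \<in> test_functions"
    and t: "\<And>n. 1 \<le> t n" and t_lim: "(\<lambda>n. 1 / t n) \<longlonglongrightarrow> 0"
  shows "(\<lambda>n. T (dilated_kernel (fourier \<kappa>) (t n) x)) \<longlonglongrightarrow> f x * (LINT u|lborel. fourier \<kappa> u)"
proof -
  let ?H = "fourier \<kappa>"
  let ?k = "\<lambda>r. dilated_kernel ?H r x"
  have H: "?H \<in> schwartz_space" by (intro fourier_schwartz \<kappa>)
  then have smH: "smooth ?H" by (simp add: schwartz_space_iff)
  have [measurable]: "?H \<in> borel_measurable borel" "f \<in> borel_measurable borel"
    using smH f by (auto intro: borel_measurable_smooth)
  have c: "(\<lambda>y. cutoff (1 *\<^sub>R y + (- x))) \<in> test_functions"
    by (intro test_functions_affine cutoff_test_function) auto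
  have near: "(\<lambda>y. ?k r y * cutoff (y - x)) \<in> test_functions" for r
    using test_functions_mult[OF c smooth_dilated_kernel[OF smH, of r x]] by (simp add: mult.commute)
  have far: "(\<lambda>y. ?k r y * (1 - cutoff (y - x))) \<in> schwartz_space" if "1 \<le> r" for r
  proof -
    have "(\<lambda>y. ?k r y + (-1) * (?k r y * cutoff (y - x))) \<in> schwartz_space"
      using that by (intro schwartz_space_add dilated_kernel_schwartz \<kappa> test_functions_schwartz
        test_functions_cmult near) auto
    then show ?thesis by (simp add: algebra_simps)
  qed
  obtain C where C: "\<And>r. 1 \<le> r \<Longrightarrow> norm (T (\<lambda>y. ?k r y * (1 - cutoff (y - x)))) \<le> C / r"
    using distribution_far_part_bound[OF T H far] by blast
  have lim_far: "(\<lambda>n. T (\<lambda>y. ?k (t n) y * (1 - cutoff (y - x)))) \<longlonglongrightarrow> 0"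
  proof (rule Lim_null_comparison)
    show "\<forall>\<^sub>F n in sequentially. norm (T (\<lambda>y. ?k (t n) y * (1 - cutoff (y - x)))) \<le> C * (1 / t n)"
      using C t by simp
    show "(\<lambda>n. C * (1 / t n)) \<longlonglongrightarrow> 0" using tendsto_mult_right_zero[OF t_lim] .
  qed
  define G where "G = (\<lambda>v. cutoff v * f (1 *\<^sub>R v + x))"
  have G: "G \<in> test_functions"
    unfolding G_def by (intro test_functions_mult cutoff_test_function smooth_affine f)
  have near_eq: "T (\<lambda>y. ?k r y * cutoff (y - x)) = (LINT u|lborel. G ((1 / r) *\<^sub>R u) * ?H u)" if r: "1 \<le> r" for r
  proof -
    have [measurable]: "(\<lambda>y. f y * (?k r y * cutoff (y - x))) \<in> borel_measurable borel"
      by (rule borel_measurable_smooth[OF smooth_mult[OF f test_functions_smooth[OF near]]])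
    have "T (\<lambda>y. ?k r y * cutoff (y - x)) = (LINT y|lborel. f y * (?k r y * cutoff (y - x)))"
      using rep test_functions_schwartz[OF near] unfolding represented_by_def by blast
    also have "\<dots> = of_real (\<bar>1 / r\<bar> ^ DIM(real^'n)) *
      (LINT u|lborel. f (x + (1 / r) *\<^sub>R u) * (?k r (x + (1 / r) *\<^sub>R u) * cutoff ((x + (1 / r) *\<^sub>R u) - x)))"
      using r by (intro integral_lborel_affine) auto
    also have "\<dots> = of_real (\<bar>1 / r\<bar> ^ DIM(real^'n)) *
      (LINT u|lborel. of_real (r ^ CARD('n)) * (G ((1 / r) *\<^sub>R u) * ?H u))"
      using r by (simp add: dilated_kernel_def G_def mult_ac add.commute)
    also have "\<dots> = (LINT u|lborel. G ((1 / r) *\<^sub>R u) * ?H u)"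
      using r by (simp add: power_divide)
    finally show ?thesis .
  qed
  have "(\<lambda>n. LINT u|lborel. G ((1 / t n) *\<^sub>R u) * ?H u) \<longlonglongrightarrow> G 0 * (LINT u|lborel. ?H u)"
    by (intro dilation_limit G schwartz_integrable H t_lim)
  then have lim_near: "(\<lambda>n. T (\<lambda>y. ?k (t n) y * cutoff (y - x))) \<longlonglongrightarrow> f x * (LINT u|lborel. ?H u)"
    using near_eq t by (simp add: G_def cutoff_eq_1)
  have "T (?k r) = T (\<lambda>y. ?k r y * cutoff (y - x)) + T (\<lambda>y. ?k r y * (1 - cutoff (y - x)))" if "1 \<le> r" for r
    using tempered_distribution_add[OF T test_functions_schwartz[OF near] far[OF that], of r]
    by (simp add: algebra_simps)
  then show ?thesis
    using tendsto_add[OF lim_near lim_far] t by simp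
qed

text \<open>A sequence that is constant by \<open>distribution_dilated_kernel_eq\<close> and
  converges to \<open>f x * \<Lambda>\<close> has this value, and division by
  \<open>\<Lambda>\<close> gives the formula. \<open>H\<close> is fixed before \<open>s\<close>, the
  source of uniformity in the scale. The last clause later makes a weighted supremum finite.\<close>

proposition band_limited_reproducing:
  fixes A :: real
  assumes A: "0 < A"
  obtains H :: "real^'n::finite \<Rightarrow> complex" where "H \<in> schwartz_space"
    and "\<And>s f x. 0 < s \<Longrightarrow> f \<in> band_limited (A * s) \<Longrightarrow>
       integrable lborel (\<lambda>y. f y * dilated_kernel H s x y) \<and>
       f x = (LINT y|lborel. f y * dilated_kernel H s x y)"
    and "\<And>s f :: real^'n \<Rightarrow> complex. 0 < s \<Longrightarrow> f \<in> band_limited (A * s) \<Longrightarrow>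
       \<exists>N K. \<forall>x. norm (f x) \<le> K * (1 + norm x) ^ N"
proof -
  define \<kappa> :: "real^'n \<Rightarrow> complex" where "\<kappa> = (\<lambda>\<xi>. of_real (bump (3 * A) \<xi>))"
  have \<kappa>: "\<kappa> \<in> test_functions" unfolding \<kappa>_def by (rule bump_test_function)
  have \<kappa>1: "\<kappa> \<xi> = 1" if "norm \<xi> \<le> 3 * A" for \<xi> using that by (simp add: \<kappa>_def bump_eq_1)
  define \<Lambda> where "\<Lambda> = (LINT u|lborel. fourier \<kappa> u)"
  have \<Lambda>: "\<Lambda> \<noteq> 0" unfolding \<Lambda>_def using A by (intro fourier_integral_nonzero \<kappa>) (simp add: \<kappa>1)
  have main: "f x * \<Lambda> = T (dilated_kernel (fourier \<kappa>) s x)"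
    if s: "0 < s" and T: "tempered_distribution T" "represented_by T f"
      "supported_in (dist_fourier T) {\<xi>. norm \<xi> \<le> 2 * (A * s)}" and f: "smooth f" for s f T x
  proof -
    \<comment> \<open>Two lower bounds are built in: \<open>t n \<ge> s\<close>, for the pairing to
      be constant, and \<open>t n \<ge> 1\<close>, for the estimate of the far part.\<close>
    define t where "t n = s + 1 + real n" for n
    have t: "1 \<le> t n" "s \<le> t n" for n using s by (auto simp: t_def)
    have "filterlim t at_top sequentially"
      unfolding t_def by (intro filterlim_tendsto_add_at_top[OF tendsto_const] filterlim_real_sequentially)
    then have "(\<lambda>n. 1 / t n) \<longlonglongrightarrow> 0"
      using tendsto_inverse_0_at_top by (simp add: divide_inverse)
    from distribution_dilated_kernel_limit[OF T(1,2) f \<kappa> t(1) this, of x]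
    have "(\<lambda>n. T (dilated_kernel (fourier \<kappa>) s x)) \<longlonglongrightarrow> f x * \<Lambda>"
      using distribution_dilated_kernel_eq[OF T(1,3) \<kappa> \<kappa>1 A s t(2)] by (simp add: \<Lambda>_def)
    then show ?thesis by (simp add: LIMSEQ_const_iff)
  qed
  define H where "H = (\<lambda>u. fourier \<kappa> u / \<Lambda>)"
  have H_eq: "H = fourier (\<lambda>\<xi>. inverse \<Lambda> * \<kappa> \<xi>)"
    by (simp add: H_def fourier_character fun_eq_iff mult.assoc divide_inverse mult.commute[of _ "inverse \<Lambda>"])
  have ker: "dilated_kernel H s x y = inverse \<Lambda> * dilated_kernel (fourier \<kappa>) s x y" for s x y
    by (simp add: H_def dilated_kernel_def divide_inverse)
  show thesis
  proof (rule that[of H])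
    show "H \<in> schwartz_space"
      unfolding H_eq by (intro fourier_schwartz test_functions_cmult \<kappa>)
    fix s :: real and f :: "real^'n \<Rightarrow> complex"
    assume s: "0 < s" and "f \<in> band_limited (A * s)"
    then obtain T where f: "smooth f" and T: "tempered_distribution T" "represented_by T f"
      "supported_in (dist_fourier T) {\<xi>. norm \<xi> \<le> 2 * (A * s)}"
      unfolding band_limited_def by auto
    show "integrable lborel (\<lambda>y. f y * dilated_kernel H s x y) \<and>
       f x = (LINT y|lborel. f y * dilated_kernel H s x y)" for x
    proof -
      let ?k = "dilated_kernel (fourier \<kappa>) s x"
      have "?k \<in> schwartz_space" by (intro dilated_kernel_schwartz \<kappa> s)
      then have int: "integrable lborel (\<lambda>y. f y * ?k y)" and "T ?k = (LINT y|lborel. f y * ?k y)"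
        using T(2) unfolding represented_by_def by auto
      then have "f x = inverse \<Lambda> * (LINT y|lborel. f y * ?k y)"
        using main[OF s T f, of x] \<Lambda> by (simp add: field_simps)
      then show ?thesis using int by (simp add: ker mult.left_commute[of _ "inverse \<Lambda>"])
    qed
    obtain B N where B: "0 \<le> B"
      and TB: "\<And>\<phi> K. \<phi> \<in> schwartz_space \<Longrightarrow>
         (\<And>is x. length is \<le> N \<Longrightarrow> (1 + norm x) ^ N * norm (iter_partial is \<phi> x) \<le> K) \<Longrightarrow> norm (T \<phi>) \<le> B * K"
      using T(1) by (rule tempered_distribution_bound) blast
    let ?k0 = "dilated_kernel (fourier \<kappa>) s 0"
    have k0: "?k0 \<in> schwartz_space" by (intro dilated_kernel_schwartz \<kappa> s)
    then have smk0: "smooth ?k0" by (simp add: schwartz_space_iff)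
    obtain K where K: "0 \<le> K" "\<And>is u. length is \<le> N \<Longrightarrow> (1 + norm u) ^ N * norm (iter_partial is ?k0 u) \<le> K"
      using k0 by (rule schwartz_uniform_bound) blast
    \<comment> \<open>The kernels at different \<open>x\<close> are translates of
      \<open>?k0\<close>, and translation by \<open>x\<close> costs a factor
      \<open>(1 + norm x) ^ N\<close> under a weight of order \<open>N\<close>.\<close>
    have "norm (f x) \<le> (B * K / norm \<Lambda>) * (1 + norm x) ^ N" for x
    proof -
      have "norm (T (dilated_kernel (fourier \<kappa>) s x)) \<le> B * ((1 + norm x) ^ N * K)"
      proof (rule TB)
        show "dilated_kernel (fourier \<kappa>) s x \<in> schwartz_space" by (intro dilated_kernel_schwartz \<kappa> s)
        fix "is" :: "'n list" and y :: "real^'n" assume len: "length is \<le> N"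
        have "dilated_kernel (fourier \<kappa>) s x = (\<lambda>y. ?k0 (1 *\<^sub>R y + (- x)))"
          by (simp add: dilated_kernel_def[abs_def])
        then have "norm (iter_partial is (dilated_kernel (fourier \<kappa>) s x) y) = norm (iter_partial is ?k0 (y - x))"
          by (simp only: iter_partial_affine[OF smk0]) simp
        moreover have "(1 + norm y) ^ N \<le> (1 + norm x) ^ N * (1 + norm (y - x)) ^ N"
          unfolding power_mult_distrib[symmetric] by (intro power_mono weight_shift) auto
        ultimately have "(1 + norm y) ^ N * norm (iter_partial is (dilated_kernel (fourier \<kappa>) s x) y)
          \<le> (1 + norm x) ^ N * ((1 + norm (y - x)) ^ N * norm (iter_partial is ?k0 (y - x)))"
          by (simp add: mult.assoc[symmetric] mult_right_mono)
        also have "\<dots> \<le> (1 + norm x) ^ N * K"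
          using K(2)[OF len] by (intro mult_left_mono) auto
        finally show "(1 + norm y) ^ N * norm (iter_partial is (dilated_kernel (fourier \<kappa>) s x) y) \<le> (1 + norm x) ^ N * K" .
      qed
      then have "norm (f x) * norm \<Lambda> \<le> B * ((1 + norm x) ^ N * K)"
        using main[OF s T f, of x] by (simp add: norm_mult[symmetric])
      then show ?thesis using \<Lambda> by (simp add: field_simps)
    qed
    then show "\<exists>N K. \<forall>x. norm (f x) \<le> K * (1 + norm x) ^ N" by blast
  qed
qed

section \<open>The Peetre inequality\<close>

text \<open>The factor \<open>s ^ CARD('n)\<close> makes the total mass independent of
  \<open>s\<close>.\<close>

definition decay_kernel :: "real \<Rightarrow> real \<Rightarrow> real^'n::finite \<Rightarrow> real^'n \<Rightarrow> real" where
  "decay_kernel s M x w = s ^ CARD('n) * (1 + s * norm (x - w)) powr (- M)"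

definition decay_mean :: "(real^'n::finite \<Rightarrow> complex) \<Rightarrow> real \<Rightarrow> real \<Rightarrow> real \<Rightarrow> real^'n \<Rightarrow> ennreal" where
  "decay_mean f q s M x = (\<integral>\<^sup>+w. ennreal (norm (f w) powr q * decay_kernel s M x w) \<partial>lborel)"

lemma decay_kernel_nonneg: "0 \<le> s \<Longrightarrow> 0 \<le> decay_kernel s M x w"
  by (simp add: decay_kernel_def)

lemma decay_kernel_measurable [measurable]:
  "decay_kernel s M x \<in> borel_measurable borel"
  unfolding decay_kernel_def[abs_def] by measurable

lemma scaled_weight_triangle:
  fixes x y z :: "'a::real_normed_vector"
  assumes "0 \<le> s"
  shows "1 + s * norm (x - z) \<le> (1 + s * norm (x - y)) * (1 + s * norm (y - z))"
proof -
  have "s * norm (x - z) \<le> s * (norm (x - y) + norm (y - z))"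
    using norm_triangle_ineq[of "x - y" "y - z"] assms by (intro mult_left_mono) auto
  moreover have "0 \<le> (s * norm (x - y)) * (s * norm (y - z))"
    using assms by simp
  ultimately show ?thesis by (simp only: distrib_left distrib_right mult_1 mult_1_right)
qed

lemma decay_kernel_shift:
  assumes s: "0 \<le> s" and M: "0 \<le> M"
  shows "decay_kernel s M z w \<le> (1 + s * norm (x - z)) powr M * decay_kernel s M x w"
proof -
  define X Y Z where "X = 1 + s * norm (x - w)" and "Y = 1 + s * norm (z - w)" and "Z = 1 + s * norm (x - z)"
  have p: "1 \<le> X" "1 \<le> Y" "1 \<le> Z" using s by (auto simp: X_def Y_def Z_def)
  have "X \<le> Z * Y" unfolding X_def Y_def Z_def by (rule scaled_weight_triangle[OF s])
  then have "X powr M \<le> Z powr M * Y powr M"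
    using p M by (subst powr_mult[symmetric]) (auto intro: powr_mono2)
  then have "Y powr (- M) \<le> Z powr M * X powr (- M)"
    using p by (simp add: powr_minus field_simps)
  then have "s ^ CARD('a) * Y powr (- M) \<le> s ^ CARD('a) * (Z powr M * X powr (- M))"
    using s by (intro mult_left_mono) auto
  then show ?thesis by (simp add: decay_kernel_def X_def Y_def Z_def mult_ac)
qed

lemma decay_mean_shift:
  assumes [measurable]: "f \<in> borel_measurable borel" and s: "0 \<le> s" and M: "0 \<le> M"
  shows "decay_mean f q s M z \<le> ennreal ((1 + s * norm (x - z)) powr M) * decay_mean f q s M x"
proof -
  have "decay_mean f q s M z \<le>
      (\<integral>\<^sup>+w. ennreal ((1 + s * norm (x - z)) powr M) * ennreal (norm (f w) powr q * decay_kernel s M x w) \<partial>lborel)"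
    unfolding decay_mean_def
  proof (intro nn_integral_mono)
    fix w
    have "norm (f w) powr q * decay_kernel s M z w \<le>
        norm (f w) powr q * ((1 + s * norm (x - z)) powr M * decay_kernel s M x w)"
      by (intro mult_left_mono decay_kernel_shift s M) auto
    then show "ennreal (norm (f w) powr q * decay_kernel s M z w) \<le>
        ennreal ((1 + s * norm (x - z)) powr M) * ennreal (norm (f w) powr q * decay_kernel s M x w)"
      using s by (simp add: ennreal_mult[symmetric] decay_kernel_nonneg mult_ac ennreal_leI)
  qed
  also have "\<dots> = ennreal ((1 + s * norm (x - z)) powr M) * decay_mean f q s M x"
    unfolding decay_mean_def by (rule nn_integral_cmult) measurable
  finally show ?thesis .
qed

lemma decay_kernel_mono:
  assumes "0 \<le> s" "M \<le> L"
  shows "decay_kernel s L x w \<le> decay_kernel s M x w"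
  unfolding decay_kernel_def using assms
  by (intro mult_left_mono powr_mono) auto

lemma decay_mean_mono:
  assumes "0 \<le> s" "M \<le> L"
  shows "decay_mean f q s L x \<le> decay_mean f q s M x"
  unfolding decay_mean_def
  by (intro nn_integral_mono ennreal_leI mult_left_mono decay_kernel_mono assms) auto

lemma nn_integral_decay_kernel:
  fixes x :: "real^'n::finite"
  assumes s: "0 < s"
  shows "(\<integral>\<^sup>+w. ennreal (decay_kernel s M x w) \<partial>lborel) =
    (\<integral>\<^sup>+u. ennreal ((1 + norm (u::real^'n)) powr (- M)) \<partial>lborel)"
proof -
  have "(\<integral>\<^sup>+w. ennreal (decay_kernel s M x w) \<partial>lborel) =
      ennreal (\<bar>1 / s\<bar> ^ DIM(real^'n)) * (\<integral>\<^sup>+u. ennreal (decay_kernel s M x (x + (1 / s) *\<^sub>R u)) \<partial>lborel)"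
    using s by (intro nn_integral_lborel_affine) auto
  also have "\<dots> = (\<integral>\<^sup>+u. ennreal (\<bar>1 / s\<bar> ^ DIM(real^'n)) * ennreal (decay_kernel s M x (x + (1 / s) *\<^sub>R u)) \<partial>lborel)"
    by (rule nn_integral_cmult[symmetric]) measurable
  also have "\<dots> = (\<integral>\<^sup>+u. ennreal ((1 + norm (u::real^'n)) powr (- M)) \<partial>lborel)"
    using s by (intro nn_integral_cong)
      (simp add: decay_kernel_def ennreal_mult'[symmetric] power_divide)
  finally show ?thesis .
qed

text \<open>Let \<open>F\<close> be the maximal function of \<open>f\<close> at \<open>x\<close>
  with exponent \<open>b\<close>. Bounding the factor \<open>|f|^(1-q)\<close> of \<open>|f|\<close>
  by \<open>F\<close> in the representation gives \<open>F \<le> F powr (1 - q) * (K * W)\<close>.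
  Finiteness of \<open>F\<close> permits division by \<open>F powr (1 - q)\<close>; as the size of
  \<open>F0\<close> does not enter the result, a bound that depends on \<open>f\<close> is good
  enough.\<close>

lemma peetre_inequality_of_finite:
  fixes f :: "real^'n::finite \<Rightarrow> complex"
  assumes [measurable]: "f \<in> borel_measurable borel"
    and q: "0 < q" "q < 1" and s: "0 < s" and b: "0 \<le> b" and K: "0 \<le> K" and W: "0 \<le> W"
    and rep: "\<And>z. ennreal (norm (f z)) \<le> (\<integral>\<^sup>+w. ennreal (norm (f w) * (K * decay_kernel s b z w)) \<partial>lborel)"
    and mean: "decay_mean f q s (b * q) x = ennreal W"
    and fin: "\<And>w. norm (f w) \<le> F0 * (1 + s * norm (x - w)) powr b"
  shows "norm (f z) powr q \<le> K * W * (1 + s * norm (x - z)) powr (b * q)"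
proof -
  define F where "F = (SUP w. norm (f w) * (1 + s * norm (x - w)) powr (- b))"
  have s1: "1 \<le> 1 + s * norm y" for y :: "real^'n" using s by simp
  have s0: "0 < 1 + s * norm y" for y :: "real^'n" using s1[of y] by linarith
  have "norm (f w) * (1 + s * norm (x - w)) powr (- b) \<le> F0" for w
    using fin[of w] s0[of "x - w"] by (simp add: powr_minus field_simps)
  then have bdd: "bdd_above (range (\<lambda>w. norm (f w) * (1 + s * norm (x - w)) powr (- b)))"
    by (intro bdd_aboveI2)
  have F_ge: "norm (f w) * (1 + s * norm (x - w)) powr (- b) \<le> F" for w
    unfolding F_def by (rule cSUP_upper[OF _ bdd]) simp
  then have fF: "norm (f w) \<le> F * (1 + s * norm (x - w)) powr b" for w
  proof -
    have "norm (f w) = norm (f w) * (1 + s * norm (x - w)) powr (- b) * (1 + s * norm (x - w)) powr b"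
      using s0[of "x - w"] by (simp add: mult.assoc powr_add[symmetric])
    also have "\<dots> \<le> F * (1 + s * norm (x - w)) powr b"
      by (intro mult_right_mono F_ge) simp
    finally show ?thesis .
  qed
  have F0: "0 \<le> F" using F_ge[of x] order_trans[OF _ F_ge[of x]] by simp
  have key: "norm (f z) \<le> F powr (1 - q) * K * (1 + s * norm (x - z)) powr b * W" for z
  proof -
    define Z where "Z = 1 + s * norm (x - z)"
    have Z: "1 \<le> Z" unfolding Z_def by (rule s1)
    \<comment> \<open>The weight \<open>X powr (b * (1 - q))\<close> is read as
      \<open>X powr b * X powr (- (b * q))\<close>: the second factor builds
      \<open>decay_kernel s (b * q) x w\<close>, the first is split by \<open>X \<le> Z * Y\<close>,
      and its part \<open>Y powr b\<close> cancels against the kernel centred at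
      \<open>z\<close>.\<close>
    have pw: "norm (f w) * (K * decay_kernel s b z w) \<le>
        (F powr (1 - q) * K * Z powr b) * (norm (f w) powr q * decay_kernel s (b * q) x w)" for w
    proof (cases "f w = 0")
      case False
      define X Y where "X = 1 + s * norm (x - w)" and "Y = 1 + s * norm (z - w)"
      have X: "1 \<le> X" and Y: "1 \<le> Y" unfolding X_def Y_def by (rule s1)+
      have "X \<le> Z * Y" unfolding X_def Y_def Z_def using s by (intro scaled_weight_triangle) auto
      then have XZ: "X powr b \<le> Z powr b * Y powr b"
        using X Y Z b by (subst powr_mult[symmetric]) (auto intro: powr_mono2)
      have "norm (f w) = norm (f w) powr q * norm (f w) powr (1 - q)"
        using False by (simp add: powr_add[symmetric])
      also have "\<dots> \<le> norm (f w) powr q * (F * X powr b) powr (1 - q)"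
        using fF[of w] q by (intro mult_left_mono powr_mono2) (auto simp: X_def)
      also have "(F * X powr b) powr (1 - q) = F powr (1 - q) * (X powr b * X powr (- (b * q)))"
        using F0 X by (simp add: powr_mult powr_powr powr_add[symmetric] algebra_simps)
      finally have "norm (f w) \<le> norm (f w) powr q * (F powr (1 - q) * (X powr b * X powr (- (b * q))))" .
      also have "\<dots> \<le> norm (f w) powr q * (F powr (1 - q) * ((Z powr b * Y powr b) * X powr (- (b * q))))"
        by (intro mult_left_mono mult_right_mono XZ) auto
      finally have "norm (f w) * (K * (s ^ CARD('n) * Y powr (- b))) \<le>
         (norm (f w) powr q * (F powr (1 - q) * ((Z powr b * Y powr b) * X powr (- (b * q))))) * (K * (s ^ CARD('n) * Y powr (- b)))"
        using K s by (intro mult_right_mono) auto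
      also have "\<dots> = (F powr (1 - q) * K * Z powr b) * (norm (f w) powr q * (s ^ CARD('n) * X powr (- (b * q)))) * (Y powr b * Y powr (- b))"
        by (simp only: mult_ac)
      also have "Y powr b * Y powr (- b) = 1" using Y by (simp add: powr_add[symmetric])
      finally show ?thesis by (simp add: decay_kernel_def X_def Y_def)
    qed (use F0 K s q in \<open>simp add: decay_kernel_def\<close>)
    have "ennreal (norm (f z)) \<le> (\<integral>\<^sup>+w. ennreal (F powr (1 - q) * K * Z powr b) *
         ennreal (norm (f w) powr q * decay_kernel s (b * q) x w) \<partial>lborel)"
      using pw K s by (intro order_trans[OF rep] nn_integral_mono)
        (simp add: ennreal_mult[symmetric] decay_kernel_nonneg ennreal_leI)
    also have "\<dots> = ennreal (F powr (1 - q) * K * Z powr b) * decay_mean f q s (b * q) x"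
      unfolding decay_mean_def by (rule nn_integral_cmult) measurable
    finally show ?thesis
      using K W by (simp add: mean ennreal_mult[symmetric] Z_def)
  qed
  have "F \<le> F powr (1 - q) * (K * W)"
    unfolding F_def
  proof (rule cSUP_least, unfold F_def[symmetric])
    fix z
    show "norm (f z) * (1 + s * norm (x - z)) powr (- b) \<le> F powr (1 - q) * (K * W)"
      using key[of z] s0[of "x - z"] by (simp add: powr_minus field_simps)
  qed simp
  then have Fq: "F powr q \<le> K * W"
  proof (cases "F = 0")
    case False
    then have "0 < F" using F0 by simp
    moreover have "F = F powr (1 - q) * F powr q" using False F0 by (simp add: powr_add[symmetric])
    moreover assume "F \<le> F powr (1 - q) * (K * W)"
    ultimately have "F powr (1 - q) * F powr q \<le> F powr (1 - q) * (K * W)" by simp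
    then show ?thesis using \<open>0 < F\<close> by simp
  qed (use K W in simp)
  have "norm (f z) powr q \<le> (F * (1 + s * norm (x - z)) powr b) powr q"
    using fF q by (intro powr_mono2) auto
  also have "\<dots> = F powr q * (1 + s * norm (x - z)) powr (b * q)"
    using F0 by (simp add: powr_mult powr_powr)
  also have "\<dots> \<le> K * W * (1 + s * norm (x - z)) powr (b * q)"
    by (intro mult_right_mono Fq) simp
  finally show ?thesis .
qed

text \<open>Two exponents are at work: with \<open>L\<close> the kernel has finite mass
  \<open>J\<close>, which pays for the constant term of the pointwise inequality, while
  \<open>M \<le> L\<close> is the exponent wanted in the mean.\<close>

lemma peetre_inequality_of_ge_1:
  fixes f :: "real^'n::finite \<Rightarrow> complex"
  assumes [measurable]: "f \<in> borel_measurable borel"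
    and q: "1 \<le> q" and s: "0 < s" and K: "0 \<le> K" and W: "0 \<le> W" and J: "0 \<le> J"
    and L: "M \<le> L" "(\<integral>\<^sup>+u. ennreal ((1 + norm (u::real^'n)) powr (- L)) \<partial>lborel) = ennreal J"
    and rep: "ennreal (norm (f z)) \<le> (\<integral>\<^sup>+w. ennreal (norm (f w) * (K * decay_kernel s L z w)) \<partial>lborel)"
    and mean: "decay_mean f q s M z = ennreal W"
  shows "norm (f z) powr q \<le> (K * (J + 1)) powr q * W"
proof -
  \<comment> \<open>Young's inequality in the form \<open>t \<le> r + t\<^sup>q r\<^sup>1\<^sup>-\<^sup>q\<close>, optimised in \<open>r\<close>, replaces Hoelder's inequality.\<close>
  have young: "norm (f z) \<le> K * (r * J + r powr (1 - q) * W)" if r: "0 < r" for r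
  proof -
    have pw: "norm (f w) * (K * decay_kernel s L z w) \<le>
       K * r * decay_kernel s L z w + K * r powr (1 - q) * (norm (f w) powr q * decay_kernel s M z w)" for w
    proof -
      define t where "t = norm (f w)"
      have t0: "0 \<le> t" by (simp add: t_def)
      have k: "0 \<le> decay_kernel s L z w" "decay_kernel s L z w \<le> decay_kernel s M z w"
        using s L by (auto intro: decay_kernel_nonneg decay_kernel_mono)
      have "t \<le> r + r powr (1 - q) * t powr q"
      proof (cases "t \<le> r")
        case False
        then have "t = t powr (1 - q) * t powr q" using r by (simp add: powr_add[symmetric])
        also have "\<dots> \<le> r powr (1 - q) * t powr q"
          using False r q by (intro mult_right_mono powr_mono2') auto
        finally show ?thesis using r by simp
      qed (use r in \<open>simp add: add_increasing2\<close>)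
      then have "t * (K * decay_kernel s L z w) \<le> (r + r powr (1 - q) * t powr q) * (K * decay_kernel s L z w)"
        using K k by (intro mult_right_mono) auto
      also have "\<dots> = K * r * decay_kernel s L z w + K * r powr (1 - q) * (t powr q * decay_kernel s L z w)"
        by (simp add: algebra_simps)
      also have "\<dots> \<le> K * r * decay_kernel s L z w + K * r powr (1 - q) * (t powr q * decay_kernel s M z w)"
        using K k by (intro add_left_mono mult_left_mono) auto
      finally show ?thesis by (simp add: t_def)
    qed
    have "ennreal (norm (f z)) \<le> (\<integral>\<^sup>+w. ennreal (K * r) * ennreal (decay_kernel s L z w) +
        ennreal (K * r powr (1 - q)) * ennreal (norm (f w) powr q * decay_kernel s M z w) \<partial>lborel)"
      using pw K s r by (intro order_trans[OF rep] nn_integral_mono)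
        (simp add: ennreal_mult[symmetric] ennreal_plus[symmetric] decay_kernel_nonneg ennreal_leI del: ennreal_plus)
    also have "\<dots> = ennreal (K * r) * (\<integral>\<^sup>+w. ennreal (decay_kernel s L z w) \<partial>lborel) +
        ennreal (K * r powr (1 - q)) * decay_mean f q s M z"
      unfolding decay_mean_def by (subst nn_integral_add) (auto simp: nn_integral_cmult)
    also have "\<dots> = ennreal (K * (r * J + r powr (1 - q) * W))"
      using K r J W by (simp add: nn_integral_decay_kernel[OF s] L(2) mean ennreal_mult[symmetric]
        ennreal_plus[symmetric] algebra_simps del: ennreal_plus)
    finally show ?thesis
      using K r J W by (subst (asm) ennreal_le_iff) auto
  qed
  show ?thesis
  proof (cases "W = 0")
    case True
    \<comment> \<open>The balancing value of \<open>r\<close> would be 0 here, so \<open>r\<close>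
      is sent to 0 through the values \<open>e / (K * J + 1)\<close>; the summand 1 guards against
      \<open>K * J = 0\<close>.\<close>
    have "norm (f z) \<le> 0 + e" if e: "0 < e" for e
    proof -
      have "K * (e / (K * J + 1) * J) \<le> e"
      proof -
        have "K * e * J \<le> e * (K * J + 1)" using e by (simp add: algebra_simps)
        then show ?thesis using e K J by (simp add: pos_divide_le_eq add_nonneg_pos mult.assoc)
      qed
      moreover have "0 < e / (K * J + 1)" using e K J by (simp add: add_nonneg_pos)
      ultimately show ?thesis using young[of "e / (K * J + 1)"] True by simp
    qed
    then have "f z = 0" using field_le_epsilon[of "norm (f z)" 0] by simp
    then show ?thesis using True by simp
  next
    case False
    \<comment> \<open>This value makes the two terms \<open>r\<close> and
      \<open>r powr (1 - q) * W\<close> equal.\<close>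
    define r where "r = W powr (1 / q)"
    have r: "0 < r" using False W by (simp add: r_def)
    have "r powr (1 - q) * W = r"
    proof -
      have "r powr (1 - q) * W = W powr (1 / q * (1 - q)) * W powr 1"
        using False W by (simp add: r_def powr_powr)
      also have "\<dots> = r" unfolding r_def powr_add[symmetric] using q by (simp add: field_simps)
      finally show ?thesis .
    qed
    then have "norm (f z) \<le> K * (J + 1) * r" using young[OF r] by (simp add: algebra_simps)
    then have "norm (f z) powr q \<le> (K * (J + 1) * r) powr q" using q by (intro powr_mono2) auto
    also have "\<dots> = (K * (J + 1)) powr q * W"
      using K J W q r by (subst powr_mult) (auto simp: r_def powr_powr)
    finally show ?thesis .
  qed
qed

lemma schwartz_decay:
  fixes H :: "real^'n::finite \<Rightarrow> complex"
  assumes "H \<in> schwartz_space"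
  obtains K where "0 < K" "\<And>s z w. 0 < s \<Longrightarrow> norm (dilated_kernel H s z w) \<le> K * decay_kernel s b z w"
proof -
  define N where "N = nat \<lceil>b\<rceil>"
  have N: "b \<le> real N" unfolding N_def by linarith
  obtain K where K: "\<And>x. (1 + norm x) ^ N * norm (iter_partial [] H x) \<le> K"
    using assms unfolding schwartz_space_iff by meson
  have H: "norm (H u) \<le> (\<bar>K\<bar> + 1) * (1 + norm u) powr (- b)" for u
  proof -
    have "norm (H u) \<le> K * (1 + norm u) powr (- real N)"
      using K[of u] powr_realpow[of "1 + norm u" N]
      by (simp add: powr_minus field_simps add_pos_nonneg)
    also have "\<dots> \<le> (\<bar>K\<bar> + 1) * (1 + norm u) powr (- b)"
      using N by (intro mult_mono powr_mono) auto
    finally show ?thesis .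
  qed
  have "norm (dilated_kernel H s z w) \<le> (\<bar>K\<bar> + 1) * decay_kernel s b z w" if "0 < s" for s z w
  proof -
    have "norm (H (s *\<^sub>R (w - z))) \<le> (\<bar>K\<bar> + 1) * (1 + s * norm (z - w)) powr (- b)"
      using H[of "s *\<^sub>R (w - z)"] that by (simp add: norm_minus_commute)
    then have "s ^ CARD('n) * norm (H (s *\<^sub>R (w - z))) \<le> s ^ CARD('n) * ((\<bar>K\<bar> + 1) * (1 + s * norm (z - w)) powr (- b))"
      using that by (intro mult_left_mono) auto
    then show ?thesis
      using that by (simp add: dilated_kernel_def decay_kernel_def norm_mult norm_power mult_ac)
  qed
  then show thesis by (intro that[of "\<bar>K\<bar> + 1"]) auto
qed

text \<open>Supplies the finiteness hypothesis: a weight of unit scale centred at 0 is dominated by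
  one of scale \<open>s\<close> centred at \<open>z\<close>, at the cost of a factor depending on
  \<open>z\<close> and \<open>s\<close>.\<close>

lemma polynomial_growth_finite:
  fixes f :: "real^'n::finite \<Rightarrow> complex"
  assumes f: "\<And>x. norm (f x) \<le> K * (1 + norm x) ^ N" and s: "0 < s" and b: "real N \<le> b"
  shows "\<exists>F. \<forall>w. norm (f w) \<le> F * (1 + s * norm (z - w)) powr b"
proof -
  have K: "0 \<le> K" using f[of 0] order_trans[OF norm_ge_zero f[of 0]] by simp
  define c where "c = 1 + 1 / s"
  have c: "1 \<le> c" using s by (simp add: c_def)
  have "norm (f w) \<le> (K * ((1 + norm z) * c) ^ N) * (1 + s * norm (z - w)) powr b" for w
  proof -
    define X where "X = 1 + s * norm (z - w)"
    have X: "1 \<le> X" using s by (simp add: X_def)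
    have "1 + norm (w - z) \<le> c * X"
      using s by (simp add: c_def X_def norm_minus_commute field_simps add_pos_nonneg)
    then have "(1 + norm z) * (1 + norm (w - z)) \<le> (1 + norm z) * (c * X)"
      by (intro mult_left_mono) auto
    then have "1 + norm w \<le> (1 + norm z) * c * X"
      using weight_shift[of w z] by (simp add: mult.assoc)
    then have "(1 + norm w) ^ N \<le> ((1 + norm z) * c) ^ N * X ^ N"
      unfolding power_mult_distrib[symmetric] by (intro power_mono) auto
    also have "X ^ N \<le> X powr b" using X b powr_mono[of "real N" b X] by (simp add: powr_realpow)
    then have "((1 + norm z) * c) ^ N * X ^ N \<le> ((1 + norm z) * c) ^ N * X powr b"
      using c by (intro mult_left_mono) auto
    finally have "(1 + norm w) ^ N \<le> ((1 + norm z) * c) ^ N * X powr b" .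
    then have "K * (1 + norm w) ^ N \<le> K * (((1 + norm z) * c) ^ N * X powr b)"
      using K by (intro mult_left_mono)
    then show ?thesis using f[of w] by (simp add: X_def mult.assoc)
  qed
  then show ?thesis by blast
qed

text \<open>The two ranges of \<open>q\<close> call for different kernels. For \<open>q < 1\<close>
  the final pass uses kernel exponent \<open>a\<close>, so that the mean obtained has exponent
  \<open>a * q\<close>; for \<open>q \<ge> 1\<close> a large exponent gives the estimate at
  \<open>z\<close>, and \<open>decay_mean_shift\<close> moves the centre to \<open>x\<close>. The
  final constants come from \<open>H\<close> and the exponents, hence not from \<open>s\<close> or
  \<open>f\<close>.\<close>

proposition peetre_inequality:
  fixes A a q :: real
  assumes A: "0 < A" and q: "0 < q" and a: "0 < a"
  shows "\<exists>C>0. \<forall>s>0. \<forall>f\<in>band_limited (A * s). \<forall>x z :: real^'n::finite.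
    ennreal (norm (f z) powr q) \<le>
      ennreal (C * (1 + s * norm (x - z)) powr (a * q)) * decay_mean f q s (a * q) x"
proof -
  obtain H :: "real^'n \<Rightarrow> complex" where H: "H \<in> schwartz_space"
    and repr: "\<And>s f x. 0 < s \<Longrightarrow> f \<in> band_limited (A * s) \<Longrightarrow>
       integrable lborel (\<lambda>y. f y * dilated_kernel H s x y) \<and>
       f x = (LINT y|lborel. f y * dilated_kernel H s x y)"
    and growth: "\<And>s f :: real^'n \<Rightarrow> complex. 0 < s \<Longrightarrow> f \<in> band_limited (A * s) \<Longrightarrow>
       \<exists>N K. \<forall>x. norm (f x) \<le> K * (1 + norm x) ^ N"
    using A by (rule band_limited_reproducing) blast
  have rep: "\<exists>K>0. \<forall>s>0. \<forall>f\<in>band_limited (A * s). \<forall>z :: real^'n.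
      ennreal (norm (f z)) \<le> (\<integral>\<^sup>+w. ennreal (norm (f w) * (K * decay_kernel s b z w)) \<partial>lborel)" for b
  proof -
    obtain K where K: "0 < K" "\<And>s z w. 0 < s \<Longrightarrow> norm (dilated_kernel H s z w) \<le> K * decay_kernel s b z w"
      using H by (rule schwartz_decay) blast
    have *: "ennreal (norm (f z)) \<le> (\<integral>\<^sup>+w. ennreal (norm (f w) * (K * decay_kernel s b z w)) \<partial>lborel)"
      if s: "0 < s" and f: "f \<in> band_limited (A * s)" for s f and z :: "real^'n"
    proof -
      have "ennreal (norm (LINT y|lborel. f y * dilated_kernel H s z y)) \<le>
         (\<integral>\<^sup>+w. ennreal (norm (f w * dilated_kernel H s z w)) \<partial>lborel)"
        using repr[OF s f] by (intro integral_norm_bound_ennreal) blast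
      also have "\<dots> \<le> (\<integral>\<^sup>+w. ennreal (norm (f w) * (K * decay_kernel s b z w)) \<partial>lborel)"
        using K s by (intro nn_integral_mono ennreal_leI) (auto simp: norm_mult intro!: mult_left_mono)
      finally show ?thesis using repr[OF s f, of z] by simp
    qed
    show ?thesis by (intro exI[of _ K] conjI K(1) allI ballI impI *) assumption+
  qed
  have meas: "f \<in> borel_measurable borel" if "f \<in> band_limited \<rho>" for f :: "real^'n \<Rightarrow> complex" and \<rho>
    using that by (auto simp: band_limited_def intro: borel_measurable_smooth)
  \<comment> \<open>An infinite mean makes the right side infinite, because the coefficient is
    positive; this leaves finite means.\<close>
  have reduce: "ennreal u \<le> ennreal (C * v) * m"
    if "0 < C" "0 < v" "\<And>W. 0 \<le> W \<Longrightarrow> m = ennreal W \<Longrightarrow> u \<le> C * W * v" for C u v and m :: ennreal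
  proof (cases m)
    case (real W)
    then have "u \<le> C * v * W" using that(3)[of W] by (simp add: mult_ac)
    then show ?thesis using real that by (simp add: ennreal_mult[symmetric] ennreal_leI)
  next
    case top
    then show ?thesis using that by (simp add: ennreal_mult_top)
  qed
  show ?thesis
  proof (cases "q < 1")
    case True
    obtain Ka where Ka: "0 < Ka"
      and rep_a: "\<And>s f (z :: real^'n). 0 < s \<Longrightarrow> f \<in> band_limited (A * s) \<Longrightarrow> 
         ennreal (norm (f z)) \<le> (\<integral>\<^sup>+w. ennreal (norm (f w) * (Ka * decay_kernel s a z w)) \<partial>lborel)"
      using rep[of a] that by (elim exE conjE) (intro that, assumption, simp)
    have *: "ennreal (norm (f z) powr q) \<le>
       ennreal (Ka * (1 + s * norm (x - z)) powr (a * q)) * decay_mean f q s (a * q) x"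
      if s: "0 < s" and f: "f \<in> band_limited (A * s)" for s f and x z :: "real^'n"
    proof (rule reduce)
      fix W assume W: "0 \<le> W" and mean: "decay_mean f q s (a * q) x = ennreal W"
      have [measurable]: "f \<in> borel_measurable borel" using f by (rule meas)
      have s0: "0 < 1 + s * norm y" for y :: "real^'n" using s by (simp add: add_pos_nonneg)
      obtain N K where NK: "\<And>x. norm (f x) \<le> K * (1 + norm x) ^ N"
        using growth[OF s f] by blast
      define b where "b = max a (real N)"
      have b: "a \<le> b" "real N \<le> b" by (auto simp: b_def)
      obtain Kb where Kb: "0 < Kb" and rep_b: "\<And>z. 
         ennreal (norm (f z)) \<le> (\<integral>\<^sup>+w. ennreal (norm (f w) * (Kb * decay_kernel s b z w)) \<partial>lborel)"
        using rep[of b] s f that by (elim exE conjE) (intro that, assumption, simp)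
      \<comment> \<open>Large exponents, depending on \<open>f\<close>, yield the finiteness needed for the exponent \<open>a\<close>.\<close>
      have pre: "norm (f w) powr q \<le> Kb * W * (1 + s * norm (x - w)) powr (a * q)" for w
      proof -
        obtain F where F: "\<And>v. norm (f v) \<le> F * (1 + s * norm (w - v)) powr b"
          using polynomial_growth_finite[OF NK s b(2)] by blast
        have "decay_mean f q s (b * q) w \<le> decay_mean f q s (a * q) w"
          using s b q by (intro decay_mean_mono) auto
        also have "\<dots> \<le> ennreal ((1 + s * norm (x - w)) powr (a * q)) * decay_mean f q s (a * q) x"
          using s a q by (intro decay_mean_shift) auto
        also have "\<dots> = ennreal ((1 + s * norm (x - w)) powr (a * q) * W)"
          by (simp add: mean ennreal_mult W)
        finally have le: "decay_mean f q s (b * q) w \<le> ennreal ((1 + s * norm (x - w)) powr (a * q) * W)" .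
        then obtain V where V: "0 \<le> V" "decay_mean f q s (b * q) w = ennreal V"
          by (cases "decay_mean f q s (b * q) w") (auto simp: top_unique)
        \<comment> \<open>Centre and evaluation point coincide, so the weight is 1 and the exponent
          \<open>b\<close> disappears; the growth in \<open>x - w\<close> comes from shifting the
          mean with exponent \<open>a * q\<close> instead.\<close>
        have "norm (f w) powr q \<le> Kb * V * (1 + s * norm (w - w)) powr (b * q)"
          by (rule peetre_inequality_of_finite[OF _ q True s _ _ V(1) rep_b V(2) F])
            (use a b Kb in auto)
        also have "\<dots> = Kb * V" by simp
        also have "\<dots> \<le> Kb * ((1 + s * norm (x - w)) powr (a * q) * W)"
          using le V W Kb by (intro mult_left_mono) auto
        finally show ?thesis by (simp add: mult_ac)
      qed
      have "norm (f w) \<le> (Kb * W) powr (1 / q) * (1 + s * norm (x - w)) powr a" for w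
      proof -
        have "norm (f w) = (norm (f w) powr q) powr (1 / q)" using q by (simp add: powr_powr)
        also have "\<dots> \<le> (Kb * W * (1 + s * norm (x - w)) powr (a * q)) powr (1 / q)"
          using pre q by (intro powr_mono2) auto
        also have "\<dots> = (Kb * W) powr (1 / q) * (1 + s * norm (x - w)) powr a"
          using Kb W q by (simp add: powr_mult powr_powr)
        finally show ?thesis .
      qed
      then show "norm (f z) powr q \<le> Ka * W * (1 + s * norm (x - z)) powr (a * q)"
        by (intro peetre_inequality_of_finite[OF _ q True s _ _ W rep_a[OF s f] mean])
          (use a Ka in auto)
    next
      have "0 < 1 + s * norm (x - z)" using s by (intro add_pos_nonneg) auto
      then show "0 < (1 + s * norm (x - z)) powr (a * q)" unfolding powr_gt_zero by (rule less_imp_neq[symmetric])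
    qed (rule Ka)
    show ?thesis by (intro exI[of _ Ka] conjI Ka allI ballI impI *) assumption+
  next
    case False
    \<comment> \<open>At least \<open>a * q\<close> to compare the two kernels, and above the
      dimension for a finite mass.\<close>
    define L where "L = max (a * q) (real CARD('n) + 1)"
    have "real CARD('n) < L" by (simp add: L_def less_max_iff_disj)
    note fin = nn_integral_decay_finite[where 'n='n, OF this]
    obtain J where J: "0 \<le> J" "(\<integral>\<^sup>+u. ennreal ((1 + norm (u::real^'n)) powr (- L)) \<partial>lborel) = ennreal J"
      using fin
      by (cases "\<integral>\<^sup>+u. ennreal ((1 + norm (u::real^'n)) powr (- L)) \<partial>lborel") auto
    obtain K where K: "0 < K"
      and rep_L: "\<And>s f (z :: real^'n). 0 < s \<Longrightarrow> f \<in> band_limited (A * s) \<Longrightarrow> 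
         ennreal (norm (f z)) \<le> (\<integral>\<^sup>+w. ennreal (norm (f w) * (K * decay_kernel s L z w)) \<partial>lborel)"
      using rep[of L] that by (elim exE conjE) (intro that, assumption, simp)
    define C where "C = (K * (J + 1)) powr q"
    have C: "0 < C" using K J by (simp add: C_def add_nonneg_pos)
    have *: "ennreal (norm (f z) powr q) \<le>
       ennreal (C * (1 + s * norm (x - z)) powr (a * q)) * decay_mean f q s (a * q) x"
      if s: "0 < s" and f: "f \<in> band_limited (A * s)" for s f and x z :: "real^'n"
    proof -
      have [measurable]: "f \<in> borel_measurable borel" using f by (rule meas)
      have "ennreal (norm (f z) powr q) \<le> ennreal (C * 1) * decay_mean f q s (a * q) z"
      proof (rule reduce)
        fix W assume "0 \<le> W" and mean: "decay_mean f q s (a * q) z = ennreal W"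
        then have "norm (f z) powr q \<le> (K * (J + 1)) powr q * W"
          using False K by (intro peetre_inequality_of_ge_1[OF _ _ s _ _ J(1) _ J(2) rep_L[OF s f] mean])
            (auto simp: L_def)
        then show "norm (f z) powr q \<le> C * W * 1" by (simp add: C_def)
      qed (use C in auto)
      also have "\<dots> \<le> ennreal (C * 1) * (ennreal ((1 + s * norm (x - z)) powr (a * q)) * decay_mean f q s (a * q) x)"
        using s a q by (intro mult_left_mono decay_mean_shift) auto
      finally show ?thesis using C by (simp add: ennreal_mult mult.assoc)
    qed
    show ?thesis by (intro exI[of _ C] conjI C allI ballI impI *) assumption+
  qed
qed

section \<open>From point values to the maximal function\<close>

lemma ennpowr_ennreal: "0 \<le> u \<Longrightarrow> ennpowr (ennreal u) p = ennreal (u powr p)"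
  by (simp add: ennpowr_def)

lemma ennpowr_mono: "0 \<le> p \<Longrightarrow> a \<le> b \<Longrightarrow> ennpowr a p \<le> ennpowr b p"
  by (cases a; cases b) (auto simp: ennpowr_def top_unique intro!: ennreal_leI powr_mono2)

text \<open>With \<open>z = x - y\<close> the weight in \<open>peetre_inequality\<close> is the
  \<open>q\<close>-th power of the denominator of the maximal function. Roots are taken for each
  \<open>y\<close> before the supremum, and \<open>ennpowr_mono\<close> carries the uniform bound
  back to the power.\<close>

corollary peetre_maximal_le:
  fixes A a q :: real
  assumes A: "0 < A" and q: "0 < q" and a: "0 < a"
  shows "\<exists>C>0. \<forall>k. \<forall>f\<in>band_limited (A * 2 powi k). \<forall>x :: real^'n::finite.
    ennpowr (peetre_maximal a k f x) q \<le> ennreal C * decay_mean f q (2 powi k) (a * q) x"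
proof -
  obtain C where C: "0 < C" and le: "\<And>s f x z :: real^'n. 0 < s \<Longrightarrow> f \<in> band_limited (A * s) \<Longrightarrow>
    ennreal (norm (f z) powr q) \<le>
      ennreal (C * (1 + s * norm (x - z)) powr (a * q)) * decay_mean f q s (a * q) x"
    using peetre_inequality[OF assms, where 'n='n] that by (elim exE conjE) (intro that, assumption, simp)
  have *: "ennpowr (peetre_maximal a k f x) q \<le> ennreal C * decay_mean f q (2 powi k) (a * q) x"
    if f: "f \<in> band_limited (A * 2 powi k)" for k f and x :: "real^'n"
  proof (cases "decay_mean f q (2 powi k) (a * q) x")
    case top
    then show ?thesis using C by (simp add: ennreal_mult_top)
  next
    case (real W)
    define s :: real where "s = 2 powi k"
    have s: "0 < s" by (simp add: s_def)
    have "ennreal (norm (f (x - y)) / (1 + s * norm y) powr a) \<le> ennreal ((C * W) powr (1 / q))" for y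
    proof -
      define X where "X = 1 + s * norm y"
      have X: "0 < X" using s by (simp add: X_def add_pos_nonneg)
      have "ennreal (norm (f (x - y)) powr q) \<le> ennreal (C * X powr (a * q) * W)"
        using le[OF s f[folded s_def], of "x - y" x] real C by (simp add: X_def s_def ennreal_mult)
      then have *: "norm (f (x - y)) powr q \<le> C * X powr (a * q) * W"
        using real C by (subst (asm) ennreal_le_iff) auto
      have "norm (f (x - y)) = (norm (f (x - y)) powr q) powr (1 / q)" using q by (simp add: powr_powr)
      also have "\<dots> \<le> (C * X powr (a * q) * W) powr (1 / q)" using * q by (intro powr_mono2) auto
      also have "\<dots> = (C * W) powr (1 / q) * X powr a"
        using C real q by (simp add: powr_mult powr_powr)
      finally show ?thesis using X by (intro ennreal_leI) (simp add: X_def field_simps)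
    qed
    then have "peetre_maximal a k f x \<le> ennreal ((C * W) powr (1 / q))"
      unfolding peetre_maximal_def s_def by (intro SUP_least)
    then have "ennpowr (peetre_maximal a k f x) q \<le> ennpowr (ennreal ((C * W) powr (1 / q))) q"
      using q by (intro ennpowr_mono) auto
    also have "\<dots> = ennreal (C * W)" using C real q by (simp add: ennpowr_ennreal powr_powr)
    finally show ?thesis using real C by (simp add: ennreal_mult)
  qed
  show ?thesis by (intro exI[of _ C] conjI C allI ballI impI *) assumption+
qed

section \<open>Dyadic cubes\<close>

abbreviation side :: "int \<Rightarrow> real" where "side \<mu> \<equiv> 2 powi (- \<mu>)"

text \<open>The label of the unique cube of side \<open>side \<mu>\<close> that contains
  \<open>x\<close>. Written with floors, the relation of lying in a common cube is measurable on the
  product space.\<close>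

definition cube_index :: "int \<Rightarrow> real^'n::finite \<Rightarrow> 'n \<Rightarrow> int" where
  "cube_index \<mu> x i = \<lfloor>2 powi \<mu> * x $ i\<rfloor>"

lemma side_pos: "0 < side \<mu>"
  by simp

lemma side_inverse: "2 powi \<mu> * side \<mu> = (1::real)"
  by (simp add: power_int_minus)

lemma mem_dyadic_cube_iff: "x \<in> dyadic_cube \<mu> m \<longleftrightarrow> cube_index \<mu> x = m"
proof -
  have "of_int (m i) * side \<mu> \<le> x $ i \<and> x $ i < (of_int (m i) + 1) * side \<mu> \<longleftrightarrow> \<lfloor>2 powi \<mu> * x $ i\<rfloor> = m i" for i
    by (simp add: floor_eq_iff power_int_minus divide_simps mult.commute flip: divide_inverse)
  then show ?thesis
    by (auto simp: dyadic_cube_def cube_index_def fun_eq_iff)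
qed

lemma vec_nth_measurable [measurable]: "(\<lambda>x::real^'n::finite. x $ i) \<in> borel_measurable borel"
  by (intro borel_measurable_continuous_onI continuous_intros)

lemma dyadic_cube_measurable [measurable]: "dyadic_cube \<mu> m \<in> sets borel"
  unfolding dyadic_cube_def by measurable

lemma emeasure_dyadic_cube:
  "emeasure lborel (dyadic_cube \<mu> m :: (real^'n::finite) set) = ennreal (side \<mu> ^ CARD('n))"
proof -
  define a b :: "real^'n" where "a = (\<chi> i. of_int (m i) * side \<mu>)" and "b = (\<chi> i. (of_int (m i) + 1) * side \<mu>)"
  have sub: "box a b \<subseteq> dyadic_cube \<mu> m" "dyadic_cube \<mu> m \<subseteq> cbox a b"
    by (auto simp: dyadic_cube_def mem_box_cart a_def b_def less_imp_le)
  have b_a: "(b - a) \<bullet> j = side \<mu>" if j: "j \<in> Basis" for j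
  proof -
    obtain i where "j = axis i 1" using j by (auto simp: Basis_vec_def)
    then show ?thesis by (simp add: inner_axis a_def b_def algebra_simps)
  qed
  then have le: "a \<bullet> j \<le> b \<bullet> j" if "j \<in> Basis" for j
    using that side_pos[of \<mu>] by (metis inner_diff_left diff_ge_0_iff_ge less_imp_le)
  have "(\<Prod>j\<in>Basis. (b - a) \<bullet> j) = side \<mu> ^ CARD('n)" using b_a by simp
  then have "emeasure lborel (box a b) = ennreal (side \<mu> ^ CARD('n))"
    "emeasure lborel (cbox a b) = ennreal (side \<mu> ^ CARD('n))"
    using le by (simp_all add: emeasure_lborel_box emeasure_lborel_cbox)
  then show ?thesis
    using emeasure_mono[OF sub(1), of lborel] emeasure_mono[OF sub(2), of lborel] by simp
qed

lemma dyadic_cube_diameter: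
  fixes x y :: "real^'n::finite"
  assumes "x \<in> dyadic_cube \<mu> m" "y \<in> dyadic_cube \<mu> m"
  shows "norm (x - y) \<le> real CARD('n) * side \<mu>"
proof -
  have "\<bar>(x - y) $ i\<bar> \<le> side \<mu>" for i
  proof -
    have "of_int (m i) * side \<mu> \<le> x $ i" "x $ i < (of_int (m i) + 1) * side \<mu>"
      "of_int (m i) * side \<mu> \<le> y $ i" "y $ i < (of_int (m i) + 1) * side \<mu>"
      using assms by (auto simp: dyadic_cube_def)
    then show ?thesis by (simp add: algebra_simps abs_le_iff)
  qed
  then have "(\<Sum>i\<in>UNIV. \<bar>(x - y) $ i\<bar>) \<le> (\<Sum>i\<in>(UNIV::'n set). side \<mu>)" by (intro sum_mono)
  then show ?thesis using norm_le_l1_cart[of "x - y"] by simp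
qed

text \<open>Tonelli's theorem for the pairs of points in a common cube, in place of a sum over the cubes.\<close>
lemma nn_integral_weighted_le:
  fixes g :: "real^'n::finite \<Rightarrow> ennreal" and \<mu> :: int
  assumes [measurable]: "g \<in> borel_measurable borel" and M: "0 \<le> M"
    and S: "\<And>m. (\<integral>\<^sup>+z\<in>dyadic_cube \<mu> m. g z \<partial>lborel) \<le> S"
  shows "(\<integral>\<^sup>+z. g z * ennreal (decay_kernel (2 powi \<mu>) M p z) \<partial>lborel)
    \<le> ennreal ((1 + real CARD('n)) powr M * (2 powi \<mu>) ^ CARD('n)) * S *
      (\<integral>\<^sup>+u. ennreal ((1 + norm (u::real^'n)) powr (- M)) \<partial>lborel)"
proof -
  define s :: real where "s = 2 powi \<mu>"
  have s: "0 < s" by (simp add: s_def)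
  define w where "w z = ennreal (decay_kernel s M p z)" for z
  have [measurable]: "w \<in> borel_measurable borel" unfolding w_def by measurable
  let ?c = "ennreal ((1 + real CARD('n)) powr M)"
  define E where "E z z' = (if \<forall>i. cube_index \<mu> z i = cube_index \<mu> z' i then 1 else 0 :: ennreal)" for z z' :: "real^'n"
  have E_ind: "E z z' = indicator (dyadic_cube \<mu> (cube_index \<mu> z')) z" for z z'
    by (auto simp: E_def mem_dyadic_cube_iff fun_eq_iff)
  have E_sym: "E z z' = E z' z" for z z' by (simp add: E_def eq_commute)
  have [measurable]: "(\<lambda>(z, z'). E z z') \<in> borel_measurable (borel \<Otimes>\<^sub>M borel)"
    unfolding E_def cube_index_def by measurable
  \<comment> \<open>On a cube of side \<open>1 / s\<close> the scaled distance is at most the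
    dimension, so the weight varies by a bounded factor.\<close>
  have wE: "w z * E z z' \<le> ?c * w z' * E z z'" for z z'
  proof (cases "E z z' = 0")
    case False
    then have "z \<in> dyadic_cube \<mu> (cube_index \<mu> z')" by (auto simp: E_ind split: split_indicator_asm)
    moreover have "z' \<in> dyadic_cube \<mu> (cube_index \<mu> z')" by (simp add: mem_dyadic_cube_iff)
    ultimately have "norm (z' - z) \<le> real CARD('n) * side \<mu>" by (rule dyadic_cube_diameter[rotated])
    then have "s * norm (z' - z) \<le> s * (real CARD('n) * side \<mu>)" using s by (intro mult_left_mono) auto
    also have "\<dots> = real CARD('n)" using side_inverse[of \<mu>] by (simp add: s_def mult.left_commute)
    finally have "(1 + s * norm (z' - z)) powr M \<le> (1 + real CARD('n)) powr M"
      using M s by (intro powr_mono2) auto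
    then have "(1 + s * norm (z' - z)) powr M * decay_kernel s M z' p \<le> (1 + real CARD('n)) powr M * decay_kernel s M z' p"
      using s by (intro mult_right_mono decay_kernel_nonneg) auto
    with decay_kernel_shift[of s M z p z'] s M
    have "decay_kernel s M z p \<le> (1 + real CARD('n)) powr M * decay_kernel s M z' p" by simp
    then have "w z \<le> ?c * w z'"
      using s by (simp add: w_def decay_kernel_def norm_minus_commute ennreal_mult'[symmetric] ennreal_leI)
    then show ?thesis by (intro mult_right_mono) auto
  qed simp
  have vol: "(\<integral>\<^sup>+z'. E z z' \<partial>lborel) = ennreal (side \<mu> ^ CARD('n))" for z
  proof -
    have "(\<integral>\<^sup>+z'. E z z' \<partial>lborel) = (\<integral>\<^sup>+z'. indicator (dyadic_cube \<mu> (cube_index \<mu> z)) z' \<partial>lborel)"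
      by (intro nn_integral_cong, subst E_sym, rule E_ind)
    then show ?thesis by (simp add: emeasure_dyadic_cube)
  qed
  \<comment> \<open>The volume of a cube is the integral of \<open>E\<close> over the partner point;
    moving the weight to the partner and exchanging the order leaves \<open>g\<close> integrated
    over a full cube, where \<open>S\<close> applies.\<close>
  have "ennreal (side \<mu> ^ CARD('n)) * (\<integral>\<^sup>+z. g z * w z \<partial>lborel)
     = (\<integral>\<^sup>+z. \<integral>\<^sup>+z'. g z * w z * E z z' \<partial>lborel \<partial>lborel)"
    by (simp add: nn_integral_cmult vol nn_integral_multc mult.commute)
  also have "\<dots> \<le> (\<integral>\<^sup>+z. \<integral>\<^sup>+z'. ?c * w z' * (g z * E z z') \<partial>lborel \<partial>lborel)"
    using mult_left_mono[OF wE] by (intro nn_integral_mono) (simp add: mult_ac)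
  also have "\<dots> = (\<integral>\<^sup>+z'. \<integral>\<^sup>+z. ?c * w z' * (g z * E z z') \<partial>lborel \<partial>lborel)"
    by (rule lborel_pair.Fubini'[symmetric]) measurable
  also have "\<dots> = (\<integral>\<^sup>+z'. ?c * w z' * (\<integral>\<^sup>+z\<in>dyadic_cube \<mu> (cube_index \<mu> z'). g z \<partial>lborel) \<partial>lborel)"
    by (simp add: E_ind nn_integral_cmult)
  also have "\<dots> \<le> (\<integral>\<^sup>+z'. ?c * w z' * S \<partial>lborel)"
    by (intro nn_integral_mono mult_left_mono S) auto
  also have "\<dots> = ?c * S * (\<integral>\<^sup>+z. w z \<partial>lborel)"
    by (simp add: nn_integral_cmult nn_integral_multc mult_ac)
  also have "(\<integral>\<^sup>+z. w z \<partial>lborel) = (\<integral>\<^sup>+u. ennreal ((1 + norm (u::real^'n)) powr (- M)) \<partial>lborel)"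
    unfolding w_def by (rule nn_integral_decay_kernel[OF s])
  finally have "ennreal (s ^ CARD('n)) * (ennreal (side \<mu> ^ CARD('n)) * (\<integral>\<^sup>+z. g z * w z \<partial>lborel)) \<le>
      ennreal (s ^ CARD('n)) * (?c * S * (\<integral>\<^sup>+u. ennreal ((1 + norm (u::real^'n)) powr (- M)) \<partial>lborel))"
    by (intro mult_left_mono) auto
  moreover have "ennreal (s ^ CARD('n)) * ennreal (side \<mu> ^ CARD('n)) = 1"
    using s side_inverse[of \<mu>] by (simp add: ennreal_mult'[symmetric] power_mult_distrib[symmetric] s_def)
  ultimately show ?thesis
    using s by (simp add: mult.assoc[symmetric] w_def s_def[symmetric] ennreal_mult')
      (simp add: mult_ac)
qed

text \<open>For \<open>z\<close> near the cube the full mass \<open>J\<close> is affordable, as the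
  coarse weight is bounded below there. Far away, raising the scale from \<open>t\<close> to
  \<open>s = r * t\<close> changes the tail by \<open>r powr (d - M) \<le> 1\<close>, since
  \<open>\<mu> \<le> k\<close> means \<open>r \<ge> 1\<close>. The majorant does not depend on
  \<open>k\<close>.\<close>

lemma nn_integral_decay_kernel_cube_le:
  fixes p z :: "real^'n::finite" and \<mu> k :: int
  assumes k: "\<mu> \<le> k" and M: "real CARD('n) \<le> M" and J: "0 \<le> J"
    and J_eq: "(\<integral>\<^sup>+u. ennreal ((1 + norm (u::real^'n)) powr (- M)) \<partial>lborel) = ennreal J"
    and p: "p \<in> dyadic_cube \<mu> m"
  shows "(\<integral>\<^sup>+x\<in>dyadic_cube \<mu> m. ennreal (decay_kernel (2 powi k) M x z) \<partial>lborel)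
    \<le> ennreal ((J * (1 + 2 * real CARD('n)) powr M + 4 powr M) * side \<mu> ^ CARD('n) * decay_kernel (2 powi \<mu>) M p z)"
proof -
  let ?d = "real CARD('n)"
  define s t :: real where "s = 2 powi k" and "t = 2 powi \<mu>"
  have st: "0 < t" "t \<le> s" "0 < s" using k by (auto simp: s_def t_def power_int_increasing)
  have tl: "t * side \<mu> = 1" unfolding t_def by (rule side_inverse)
  define D where "D = t * norm (p - z)"
  have D0: "0 \<le> D" using st by (simp add: D_def)
  have M0: "0 \<le> M" using M by linarith
  have d1: "1 \<le> ?d" by (simp add: Suc_leI)
  have kt: "side \<mu> ^ CARD('n) * decay_kernel t M p z = (1 + D) powr (- M)"
    using tl by (simp add: decay_kernel_def D_def power_mult_distrib[symmetric] mult.assoc[symmetric] mult.commute[of _ t])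
  have "(\<integral>\<^sup>+x\<in>dyadic_cube \<mu> m. ennreal (decay_kernel s M x z) \<partial>lborel)
     \<le> ennreal ((J * (1 + 2 * ?d) powr M + 4 powr M) * (1 + D) powr (- M))"
  proof (cases "D \<le> 2 * ?d")
    case True
    have "(\<integral>\<^sup>+x\<in>dyadic_cube \<mu> m. ennreal (decay_kernel s M x z) \<partial>lborel) \<le> (\<integral>\<^sup>+x. ennreal (decay_kernel s M z x) \<partial>lborel)"
      by (intro nn_integral_mono) (auto simp: decay_kernel_def norm_minus_commute split: split_indicator)
    also have "\<dots> = ennreal J" by (simp add: nn_integral_decay_kernel[OF st(3)] J_eq)
    also have "J \<le> J * ((1 + 2 * ?d) powr M * (1 + D) powr (- M))"
    proof -
      have "(1 + D) powr M \<le> (1 + 2 * ?d) powr M" using True D0 M0 by (intro powr_mono2) auto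
      then have "1 \<le> (1 + 2 * ?d) powr M * (1 + D) powr (- M)"
        using D0 by (simp add: powr_minus field_simps)
      then show ?thesis using J mult_left_mono[of 1 _ J] by simp
    qed
    also have "\<dots> \<le> (J * (1 + 2 * ?d) powr M + 4 powr M) * (1 + D) powr (- M)"
      by (simp add: distrib_right mult.assoc)
    finally show ?thesis by (simp add: ennreal_leI)
  next
    case False
    have far: "decay_kernel s M x z \<le> t ^ CARD('n) * (4 powr M * (1 + D) powr (- M))"
      if x: "x \<in> dyadic_cube \<mu> m" for x
    proof -
      have "norm (p - z) \<le> norm (p - x) + norm (x - z)"
        using norm_triangle_ineq[of "p - x" "x - z"] by simp
      then have "D \<le> t * (norm (p - x) + norm (x - z))" unfolding D_def using st by (intro mult_left_mono) auto
      moreover have "t * norm (p - x) \<le> t * (?d * side \<mu>)"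
        using dyadic_cube_diameter[OF p x] st by (intro mult_left_mono) auto
      ultimately have "D \<le> ?d + t * norm (x - z)" using tl by (simp add: distrib_left mult.left_commute[of t])
      \<comment> \<open>Here \<open>y \<ge> D - d > D / 2\<close>, and \<open>D > 2\<close> gives
        \<open>D / 2 \<ge> (1 + D) / 4\<close>.\<close>
      moreover have "(1 + D) / 4 \<le> y" if "D \<le> d + y" "\<not> D \<le> 2 * d" "1 \<le> d" for y d :: real
        using that by argo
      ultimately have Dx: "(1 + D) / 4 \<le> t * norm (x - z)" using False d1 by blast
      define y where "y = t * norm (x - z)"
      have y: "0 < y" "(1 + D) / 4 \<le> y" using Dx D0 by (auto simp: y_def)
      define r where "r = s / t"
      have r: "1 \<le> r" using st by (simp add: r_def)
      have sr: "s = r * t" using st by (simp add: r_def)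
      have "decay_kernel s M x z = s ^ CARD('n) * (1 + r * y) powr (- M)"
        by (simp add: decay_kernel_def sr y_def mult.assoc)
      also have "\<dots> \<le> s ^ CARD('n) * (r * y) powr (- M)"
        using st r y M0 by (intro mult_left_mono powr_mono2') auto
      also have "\<dots> = t ^ CARD('n) * (r powr (?d - M) * y powr (- M))"
      proof -
        have "(r * y) powr (- M) = r powr (- M) * y powr (- M)" by (rule powr_mult)
        moreover have "r ^ CARD('n) = r powr ?d" using r by (simp add: powr_realpow)
        moreover have "r powr (?d - M) = r powr ?d * r powr (- M)" by (simp flip: powr_add)
        ultimately show ?thesis by (simp only: sr power_mult_distrib mult_ac)
      qed
      also have "\<dots> \<le> t ^ CARD('n) * (1 * ((1 + D) / 4) powr (- M))"
      proof (intro mult_left_mono mult_mono)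
        show "r powr (?d - M) \<le> 1" using r M powr_mono[of "?d - M" 0 r] by simp
        show "y powr (- M) \<le> ((1 + D) / 4) powr (- M)" using y D0 M0 by (intro powr_mono2') auto
      qed (use st in auto)
      also have "((1 + D) / 4) powr (- M) = 4 powr M * (1 + D) powr (- M)"
        using D0 by (simp add: powr_divide powr_minus divide_simps)
      finally show ?thesis by simp
    qed
    have "(\<integral>\<^sup>+x\<in>dyadic_cube \<mu> m. ennreal (decay_kernel s M x z) \<partial>lborel) \<le>
        (\<integral>\<^sup>+x\<in>dyadic_cube \<mu> m. ennreal (t ^ CARD('n) * (4 powr M * (1 + D) powr (- M))) \<partial>lborel)"
      using far by (intro nn_integral_mono) (auto intro!: ennreal_leI split: split_indicator)
    also have "\<dots> = ennreal (t ^ CARD('n) * (4 powr M * (1 + D) powr (- M))) * ennreal (side \<mu> ^ CARD('n))"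
      by (simp add: nn_integral_cmult_indicator emeasure_dyadic_cube)
    also have "\<dots> = ennreal ((t * side \<mu>) ^ CARD('n) * (4 powr M * (1 + D) powr (- M)))"
      by (simp add: ennreal_mult'[symmetric] power_mult_distrib mult_ac)
    also have "\<dots> \<le> ennreal ((J * (1 + 2 * ?d) powr M + 4 powr M) * (1 + D) powr (- M))"
      unfolding tl using J by (intro ennreal_leI) (simp add: distrib_right)
    finally show ?thesis .
  qed
  then show ?thesis unfolding kt[symmetric] by (simp add: s_def t_def mult_ac)
qed

section \<open>Summation over the scales\<close>

lemma cube_mean_dyadic:
  fixes g :: "real^'n::finite \<Rightarrow> ennreal"
  shows "cube_mean (dyadic_cube \<mu> m) g =
    ennreal ((2 powi \<mu>) ^ CARD('n)) * (\<integral>\<^sup>+x\<in>dyadic_cube \<mu> m. g x \<partial>lborel)"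
proof -
  have "inverse (side \<mu> ^ CARD('n)) = (2 powi \<mu>) ^ CARD('n)"
    by (simp add: power_int_minus power_inverse)
  then have "inverse (ennreal (side \<mu> ^ CARD('n))) = ennreal ((2 powi \<mu>) ^ CARD('n))"
    using side_pos[of \<mu>] by (subst inverse_ennreal) auto
  then show ?thesis
    unfolding cube_mean_def emeasure_dyadic_cube by (simp add: divide_ennreal_def mult.commute)
qed

text \<open>An arbitrary upper bound \<open>S\<close> of the means keeps roots and suprema out of
  the integral estimates.\<close>

proposition cube_mean_peetre_maximal_le:
  fixes A a q :: real
  assumes A: "0 < A" and q: "0 < q" and a: "0 < a" and aq: "real CARD('n::finite) < a * q"
  shows "\<exists>C>0. \<forall>f :: int \<Rightarrow> real^'n \<Rightarrow> complex. \<forall>\<mu> S. \<forall>P\<in>dyadic_cubes \<mu>.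
    (\<forall>k. f k \<in> band_limited (A * 2 powi k)) \<longrightarrow>
    (\<forall>R\<in>dyadic_cubes \<mu>. cube_mean R (\<lambda>x. \<Sum>j. ennreal (norm (f (\<mu> + int j) x) powr q)) \<le> S) \<longrightarrow>
    cube_mean P (\<lambda>x. \<Sum>j. ennpowr (peetre_maximal a (\<mu> + int j) (f (\<mu> + int j)) x) q) \<le> ennreal C * S"
proof -
  define M where "M = a * q"
  have M: "real CARD('n) < M" "0 \<le> M" using aq a q by (auto simp: M_def)
  obtain C where C: "0 < C" and peetre: "\<And>k f x :: real^'n. f \<in> band_limited (A * 2 powi k) \<Longrightarrow>
     ennpowr (peetre_maximal a k f x) q \<le> ennreal C * decay_mean f q (2 powi k) (a * q) x"
    using peetre_maximal_le[OF A q a, where 'n='n] that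
    by (elim exE conjE) (intro that, assumption, simp)
  obtain J where J: "0 \<le> J" "(\<integral>\<^sup>+u. ennreal ((1 + norm (u::real^'n)) powr (- M)) \<partial>lborel) = ennreal J"
    using nn_integral_decay_finite[where 'n='n, OF M(1)]
    by (cases "\<integral>\<^sup>+u. ennreal ((1 + norm (u::real^'n)) powr (- M)) \<partial>lborel") auto
  define C1 where "C1 = J * (1 + 2 * real CARD('n)) powr M + 4 powr M"
  define C2 where "C2 = (1 + real CARD('n)) powr M"
  have C1: "0 \<le> C1" using J by (simp add: C1_def)
  have C2: "0 \<le> C2" by (simp add: C2_def)
  \<comment> \<open>The summand 1 ensures positivity, as \<open>J\<close> is only known to be
    nonnegative.\<close>
  define C' where "C' = C * C1 * C2 * J + 1"
  have C': "0 < C'" using C C1 C2 J by (simp add: C'_def add_nonneg_pos)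
  have *: "cube_mean P (\<lambda>x. \<Sum>j. ennpowr (peetre_maximal a (\<mu> + int j) (f (\<mu> + int j)) x) q) \<le> ennreal C' * S"
    if P: "P \<in> dyadic_cubes \<mu>" and f: "\<forall>k. f k \<in> band_limited (A * 2 powi k)"
      and S: "\<forall>R\<in>dyadic_cubes \<mu>. cube_mean R (\<lambda>x. \<Sum>j. ennreal (norm (f (\<mu> + int j) x) powr q)) \<le> S"
    for f :: "int \<Rightarrow> real^'n \<Rightarrow> complex" and \<mu> S P
  proof -
    let ?d = "CARD('n)"
    define s where "s j = (2::real) powi (\<mu> + int j)" for j :: nat
    define F where "F j x = norm (f (\<mu> + int j) x) powr q" for j x
    define G where "G x = (\<Sum>j. ennreal (F j x))" for x
    define t :: real where "t = 2 powi \<mu>"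
    have t: "0 < t" by (simp add: t_def)
    have sd: "t * side \<mu> = 1" unfolding t_def by (rule side_inverse)
    have sdn: "t ^ ?d * side \<mu> ^ ?d = 1" unfolding power_mult_distrib[symmetric] sd by simp
    have s: "0 < s j" for j by (simp add: s_def)
    have [measurable]: "f k \<in> borel_measurable borel" for k
      using f by (auto simp: band_limited_def intro: borel_measurable_smooth)
    have [measurable]: "F j \<in> borel_measurable borel" for j unfolding F_def by measurable
    have [measurable]: "G \<in> borel_measurable borel" unfolding G_def by measurable
    have [measurable]: "(\<lambda>(x, z). decay_kernel (s j) M x z) \<in> borel_measurable (borel \<Otimes>\<^sub>M borel)" for j
      unfolding decay_kernel_def by measurable
    obtain m where m: "P = dyadic_cube \<mu> m" using P by (auto simp: dyadic_cubes_def)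
    \<comment> \<open>Any point of the cube could be the centre of the coarse kernel; this corner
      belongs to the half-open cube.\<close>
    define p :: "real^'n" where "p = (\<chi> i. of_int (m i) * side \<mu>)"
    have p: "p \<in> dyadic_cube \<mu> m" by (simp add: p_def dyadic_cube_def)
    have S_int: "(\<integral>\<^sup>+z\<in>dyadic_cube \<mu> m'. G z \<partial>lborel) \<le> ennreal (side \<mu> ^ ?d) * S" for m'
    proof -
      have "dyadic_cube \<mu> m' \<in> dyadic_cubes \<mu>" by (simp add: dyadic_cubes_def)
      with S have "cube_mean (dyadic_cube \<mu> m') G \<le> S" unfolding G_def F_def by (rule bspec)
      then have "ennreal (t ^ ?d) * (\<integral>\<^sup>+z\<in>dyadic_cube \<mu> m'. G z \<partial>lborel) \<le> S"
        unfolding cube_mean_dyadic t_def .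
      then have "ennreal (side \<mu> ^ ?d) * (ennreal (t ^ ?d) * (\<integral>\<^sup>+z\<in>dyadic_cube \<mu> m'. G z \<partial>lborel)) \<le> ennreal (side \<mu> ^ ?d) * S"
        by (intro mult_left_mono) auto
      then show ?thesis using sdn t
        by (simp add: mult.assoc[symmetric] ennreal_mult'[symmetric] mult.commute[of "side \<mu> ^ ?d"])
    qed
    have "(\<integral>\<^sup>+x\<in>P. (\<Sum>j. ennpowr (peetre_maximal a (\<mu> + int j) (f (\<mu> + int j)) x) q) \<partial>lborel)
       \<le> (\<integral>\<^sup>+x. (\<Sum>j. ennreal C * (decay_mean (f (\<mu> + int j)) q (s j) M x * indicator P x)) \<partial>lborel)"
    proof (intro nn_integral_mono)
      fix x
      have "(\<Sum>j. ennpowr (peetre_maximal a (\<mu> + int j) (f (\<mu> + int j)) x) q)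
         \<le> (\<Sum>j. ennreal C * decay_mean (f (\<mu> + int j)) q (s j) M x)"
        unfolding s_def M_def using peetre f by (intro suminf_le) auto
      then show "(\<Sum>j. ennpowr (peetre_maximal a (\<mu> + int j) (f (\<mu> + int j)) x) q) * indicator P x
         \<le> (\<Sum>j. ennreal C * (decay_mean (f (\<mu> + int j)) q (s j) M x * indicator P x))"
        by (auto split: split_indicator)
    qed
    also have "\<dots> = (\<Sum>j. ennreal C * (\<integral>\<^sup>+x\<in>P. decay_mean (f (\<mu> + int j)) q (s j) M x \<partial>lborel))"
      unfolding m decay_mean_def F_def[symmetric]
      by (subst nn_integral_suminf) (auto simp: nn_integral_cmult)
    \<comment> \<open>By Tonelli the fine kernel is averaged over \<open>P\<close> with
      \<open>z\<close> fixed. The majorant at scale \<open>t\<close> is the same for all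
      \<open>j\<close>, so the sum over \<open>j\<close> can be collected into
      \<open>G\<close>.\<close>
    also have "\<dots> \<le> (\<Sum>j. ennreal C * (\<integral>\<^sup>+z. ennreal (F j z) * ennreal (C1 * side \<mu> ^ ?d * decay_kernel t M p z) \<partial>lborel))"
    proof (intro suminf_le mult_left_mono)
      fix j
      have "(\<integral>\<^sup>+x\<in>P. decay_mean (f (\<mu> + int j)) q (s j) M x \<partial>lborel)
          = (\<integral>\<^sup>+x. \<integral>\<^sup>+z. ennreal (F j z) * ennreal (decay_kernel (s j) M x z) * indicator P x \<partial>lborel \<partial>lborel)"
        unfolding decay_mean_def F_def[symmetric] m using s[of j]
        by (subst nn_integral_multc[symmetric]) (auto simp: ennreal_mult decay_kernel_nonneg F_def intro!: nn_integral_cong)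
      also have "\<dots> = (\<integral>\<^sup>+z. \<integral>\<^sup>+x. ennreal (F j z) * ennreal (decay_kernel (s j) M x z) * indicator P x \<partial>lborel \<partial>lborel)"
        unfolding m by (rule lborel_pair.Fubini'[symmetric]) measurable
      also have "\<dots> = (\<integral>\<^sup>+z. ennreal (F j z) * (\<integral>\<^sup>+x\<in>P. ennreal (decay_kernel (s j) M x z) \<partial>lborel) \<partial>lborel)"
        unfolding m by (simp add: mult.assoc nn_integral_cmult)
      also have "\<dots> \<le> (\<integral>\<^sup>+z. ennreal (F j z) * ennreal (C1 * side \<mu> ^ ?d * decay_kernel t M p z) \<partial>lborel)"
        unfolding m s_def t_def C1_def
        by (intro nn_integral_mono mult_left_mono nn_integral_decay_kernel_cube_le J p) (use M in auto)
      finally show "(\<integral>\<^sup>+x\<in>P. decay_mean (f (\<mu> + int j)) q (s j) M x \<partial>lborel)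
         \<le> (\<integral>\<^sup>+z. ennreal (F j z) * ennreal (C1 * side \<mu> ^ ?d * decay_kernel t M p z) \<partial>lborel)" .
    qed auto
    also have "\<dots> = ennreal C * (\<integral>\<^sup>+z. (\<Sum>j. ennreal (F j z) * ennreal (C1 * side \<mu> ^ ?d * decay_kernel t M p z)) \<partial>lborel)"
      by (subst nn_integral_suminf) auto
    also have "\<dots> = ennreal C * (\<integral>\<^sup>+z. ennreal (C1 * side \<mu> ^ ?d) * (G z * ennreal (decay_kernel t M p z)) \<partial>lborel)"
    proof -
      have "(\<Sum>j. ennreal (F j z) * ennreal (C1 * side \<mu> ^ ?d * decay_kernel t M p z)) =
          ennreal (C1 * side \<mu> ^ ?d) * (G z * ennreal (decay_kernel t M p z))" for z
      proof -
        have "ennreal (C1 * side \<mu> ^ ?d * decay_kernel t M p z) = ennreal (C1 * side \<mu> ^ ?d) * ennreal (decay_kernel t M p z)"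
          using C1 t by (intro ennreal_mult decay_kernel_nonneg) auto
        then show ?thesis unfolding ennreal_suminf_multc G_def by (simp only: mult_ac)
      qed
      then show ?thesis by (simp only:)
    qed
    also have "\<dots> = ennreal (C * C1 * side \<mu> ^ ?d) * (\<integral>\<^sup>+z. G z * ennreal (decay_kernel t M p z) \<partial>lborel)"
      using C C1 by (subst nn_integral_cmult) (auto simp: ennreal_mult' mult.assoc)
    also have "\<dots> \<le> ennreal (C * C1 * side \<mu> ^ ?d) * (ennreal (C2 * t ^ ?d) * (ennreal (side \<mu> ^ ?d) * S) * ennreal J)"
      unfolding t_def C2_def J(2)[symmetric]
      by (intro mult_left_mono nn_integral_weighted_le M S_int) auto
    finally have "cube_mean P (\<lambda>x. \<Sum>j. ennpowr (peetre_maximal a (\<mu> + int j) (f (\<mu> + int j)) x) q) \<le>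
        ennreal (t ^ ?d) * (ennreal (C * C1 * side \<mu> ^ ?d) * (ennreal (C2 * t ^ ?d) * (ennreal (side \<mu> ^ ?d) * S) * ennreal J))"
      unfolding m cube_mean_dyadic t_def[symmetric] by (intro mult_left_mono) auto
    \<comment> \<open>Two volumes cancel against two inverse volumes, which removes
      \<open>\<mu>\<close> from the constant.\<close>
    also have "\<dots> = ennreal ((t ^ ?d * side \<mu> ^ ?d) * (t ^ ?d * side \<mu> ^ ?d) * (C * C1 * C2 * J)) * S"
      using C C1 C2 J t by (simp add: ennreal_mult' mult_ac)
    also have "\<dots> \<le> ennreal C' * S"
      unfolding sdn by (intro mult_right_mono ennreal_leI) (auto simp: C'_def)
    finally show ?thesis .
  qed
  show ?thesis
    by (intro exI[of _ C'] conjI allI ballI impI) (rule C', (rule *; assumption))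
qed

theorem corollary1p4:
  fixes r q A :: real
  assumes "0 < r" and "r < q" and "0 < A"
  shows "\<exists>C>0. \<forall>f :: int \<Rightarrow> real^'n::finite \<Rightarrow> complex.
    (\<forall>k. f k \<in> band_limited (A * 2 powi k)) \<longrightarrow>
    (\<forall>\<mu>. \<forall>P\<in>dyadic_cubes \<mu>.
      ennpowr (cube_mean P (\<lambda>x. \<Sum>j. ennpowr
          (peetre_maximal (real CARD('n) / r) (\<mu> + int j) (f (\<mu> + int j)) x) q)) (1 / q)
      \<le> ennreal C * (SUP R\<in>dyadic_cubes \<mu>.
          ennpowr (cube_mean R (\<lambda>x. \<Sum>j. ennreal (norm (f (\<mu> + int j) x) powr q))) (1 / q)))"
proof -
  let ?a = "real CARD('n) / r"
  have q: "0 < q" using assms by linarith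
  have a: "0 < ?a" using assms by simp
  \<comment> \<open>This is the gain from \<open>r < q\<close>: the decay exponent of the kernel
    exceeds the dimension.\<close>
  have aq: "real CARD('n) < ?a * q"
    using assms by (simp add: field_simps)
  obtain C where C: "0 < C" and le: "\<forall>f :: int \<Rightarrow> real^'n \<Rightarrow> complex. \<forall>\<mu> S. \<forall>P\<in>dyadic_cubes \<mu>.
    (\<forall>k. f k \<in> band_limited (A * 2 powi k)) \<longrightarrow>
    (\<forall>R\<in>dyadic_cubes \<mu>. cube_mean R (\<lambda>x. \<Sum>j. ennreal (norm (f (\<mu> + int j) x) powr q)) \<le> S) \<longrightarrow>
    cube_mean P (\<lambda>x. \<Sum>j. ennpowr (peetre_maximal ?a (\<mu> + int j) (f (\<mu> + int j)) x) q) \<le> ennreal C * S"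
    using cube_mean_peetre_maximal_le[OF assms(3) q a aq] by (elim exE conjE)
  have C': "0 < C powr (1 / q)" using C by simp
  have *: "ennpowr (cube_mean P (\<lambda>x. \<Sum>j. ennpowr (peetre_maximal ?a (\<mu> + int j) (f (\<mu> + int j)) x) q)) (1 / q)
      \<le> ennreal (C powr (1 / q)) * (SUP R\<in>dyadic_cubes \<mu>.
          ennpowr (cube_mean R (\<lambda>x. \<Sum>j. ennreal (norm (f (\<mu> + int j) x) powr q))) (1 / q))"
    if f: "\<forall>k. f k \<in> band_limited (A * 2 powi k)" and P: "P \<in> dyadic_cubes \<mu>"
    for f :: "int \<Rightarrow> real^'n \<Rightarrow> complex" and \<mu> P
  proof -
    let ?m = "\<lambda>R. cube_mean R (\<lambda>x. \<Sum>j. ennreal (norm (f (\<mu> + int j) x) powr q))"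
    define T where "T = (SUP R\<in>dyadic_cubes \<mu>. ennpowr (?m R) (1 / q))"
    show ?thesis
    proof (cases T)
      case top
      then show ?thesis using C' by (simp add: T_def[symmetric] ennreal_mult_top)
    next
      case (real u)
      \<comment> \<open>A finite supremum \<open>u\<close> of the roots bounds every mean by
        \<open>u powr q\<close>, which serves as \<open>S\<close>; taking roots at the end turns
        \<open>C\<close> into \<open>C powr (1 / q)\<close>.\<close>
      have "?m R \<le> ennreal (u powr q)" if "R \<in> dyadic_cubes \<mu>" for R
      proof -
        have "ennpowr (?m R) (1 / q) \<le> ennreal u"
          using that unfolding real(2)[symmetric] T_def by (rule SUP_upper)
        then show ?thesis
        proof (cases "?m R")
          case (real v)
          with \<open>ennpowr (?m R) (1 / q) \<le> ennreal u\<close> have "v powr (1 / q) \<le> u"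
            using \<open>0 \<le> u\<close> by (simp add: ennpowr_ennreal)
          then have "(v powr (1 / q)) powr q \<le> u powr q" using q by (intro powr_mono2) auto
          then show ?thesis using real q by (simp add: powr_powr ennreal_leI)
        qed (simp add: ennpowr_def top_unique)
      qed
      then have "ennpowr (cube_mean P (\<lambda>x. \<Sum>j. ennpowr (peetre_maximal ?a (\<mu> + int j) (f (\<mu> + int j)) x) q)) (1 / q)
         \<le> ennpowr (ennreal C * ennreal (u powr q)) (1 / q)"
        using q P f by (intro ennpowr_mono le[rule_format]) auto
      also have "\<dots> = ennreal (C powr (1 / q)) * ennreal u"
        using C q real(1) by (simp add: ennreal_mult'[symmetric] ennpowr_ennreal powr_mult powr_powr)
      finally show ?thesis using real by (simp add: T_def)
    qed
  qed
  show ?thesis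
    by (intro exI[of _ "C powr (1 / q)"] conjI allI ballI impI) (rule C', (rule *; assumption))
qed

end
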